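(* Let $K, m\ge 1$ and $B>0$ be constants ($m$ an integer). Let $\mathbf{M}_n^{(1)},\ldots,\mathbf{M}_n^{(m)}$ be independent $n\times n$ random matrices in which each entry takes the value $+1$ or $-1$ independently with probability $1/2$. Then, for all sufficiently large $n$ (depending only on $m$, $K$, and $B$), the probability that the matrix $$\mathbf{M}_n := \mathbf{M}_n^{(1)}\cdots\mathbf{M}_n^{(m)}$$ has an eigenvalue that is an algebraic number of degree at most $K$ is bounded above by $n^{-B}$.
   Context: The degree of an algebraic number is the degree of its minimal polynomial over $\mathbb{Q}$. Eigenvalues are complex eigenvalues. *)

theory Defs
  imports
    "HOL-Probability.Probability"
    "HOL-Probability.Product_PMF"
    "Jordan_Normal_Form.Char_Poly"
begin

definition is_minimal_poly :: "complex \<Rightarrow> rat poly \<Rightarrow> bool" where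
  "is_minimal_poly z p \<longleftrightarrow>
     lead_coeff p = 1 \<and> poly (map_poly of_rat p) z = 0 \<and>
     (\<forall>q. q \<noteq> 0 \<longrightarrow> poly (map_poly of_rat q) z = 0 \<longrightarrow> degree p \<le> degree q)"

lemma is_minimal_poly_ex1:
  assumes "algebraic z"
  shows "\<exists>!p. is_minimal_poly z p"
proof -
  interpret h: field_hom "of_rat :: rat \<Rightarrow> complex"
    by unfold_locales (auto simp: of_rat_add of_rat_mult)
  interpret hp: map_poly_inj_idom_hom "of_rat :: rat \<Rightarrow> complex" ..
  define R where "R q \<longleftrightarrow> q \<noteq> 0 \<and> poly (map_poly of_rat q) z = 0" for q :: "rat poly"
  from assms obtain q where q: "\<And>i. coeff q i \<in> \<int>" "q \<noteq> 0" "poly q z = 0"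
    by (elim Polynomial.algebraicE) blast
  have "\<forall>i. \<exists>k. coeff q i = of_int k"
    using q(1) by (blast elim: Ints_cases)
  then obtain f where f: "\<And>i. coeff q i = of_int (f i)"
    by (auto dest: choice)
  have q': "map_poly of_rat (map_poly (\<lambda>c. of_int (floor (Re c)) :: rat) q) = q"
    by (rule poly_eqI) (simp add: coeff_map_poly f)
  have "R (map_poly (\<lambda>c. of_int (floor (Re c)) :: rat) q)"
    unfolding R_def using q q' by auto
  then have ex: "\<exists>q. R q" ..
  define p0 where "p0 = arg_min degree R"
  have p0: "R p0" "\<And>q. R q \<Longrightarrow> degree p0 \<le> degree q"
    unfolding p0_def using ex by (auto intro: arg_min_natI arg_min_nat_le)
  define p where "p = Polynomial.smult (inverse (lead_coeff p0)) p0"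
  have p: "is_minimal_poly z p"
    using p0 by (auto simp: is_minimal_poly_def p_def R_def hom_distribs)
  show ?thesis
  proof (rule ex1I[where P = "is_minimal_poly z", OF p])
    fix r assume r: "is_minimal_poly z r"
    show "r = p"
    proof (rule ccontr)
      assume ne: "r \<noteq> p"
      have nz: "p \<noteq> 0" "r \<noteq> 0" using p r by (auto simp: is_minimal_poly_def)
      have deg: "degree r = degree p"
        using p r nz by (auto simp: is_minimal_poly_def intro!: antisym)
      have "poly (map_poly of_rat (r - p)) z = 0"
        using p r by (simp add: is_minimal_poly_def hom_distribs)
      with ne p have le: "degree p \<le> degree (r - p)" by (auto simp: is_minimal_poly_def)
      moreover have "degree (r - p) \<le> degree p" using deg by (metis degree_diff_le order_refl)
      ultimately have "degree (r - p) = degree p" by simp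
      then have "lead_coeff (r - p) = 0"
        using p r deg by (simp add: is_minimal_poly_def)
      then have "r - p = 0" by (simp only: leading_coeff_0_iff)
      then show False using ne by simp
    qed
  qed
qed

definition minimal_poly :: "complex \<Rightarrow> rat poly" where
  "minimal_poly z = (THE p. is_minimal_poly z p)"

text \<open>Only meaningful for algebraic \<open>z\<close>.\<close>

definition algebraic_degree :: "complex \<Rightarrow> nat" where
  "algebraic_degree z = degree (minimal_poly z)"

lemma is_minimal_poly_minimal_poly: "algebraic z \<Longrightarrow> is_minimal_poly z (minimal_poly z)"
  unfolding minimal_poly_def by (rule theI'[OF is_minimal_poly_ex1])

text \<open>
  \<open>Pi_pmf\<close> is the joint law of independent entries; its second argument only fixes the value
  of the entry function outside the index range, which \<open>Matrix.mat\<close> ignores.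
\<close>

definition random_sign_matrix :: "nat \<Rightarrow> int mat pmf" where
  "random_sign_matrix n =
     map_pmf (Matrix.mat n n)
       (Pi_pmf ({..<n} \<times> {..<n}) 0 (\<lambda>_. pmf_of_set {-1, 1}))"

definition mat_product :: "nat \<Rightarrow> 'a :: semiring_1 mat list \<Rightarrow> 'a mat" where
  "mat_product n Ms = foldr (*) Ms (1\<^sub>m n)"

end

theory Submission
  imports Defs "HOL-Real_Asymp.Real_Asymp"
begin

text \<open>
  An eigenvalue \<open>z\<close> of \<open>M = M\<^sub>1 \<cdots> M\<^sub>m\<close> of degree at most \<open>d\<close> is an algebraic integer of modulus at
  most \<open>n ^ (m + 1)\<close>, so its minimal polynomial \<open>f\<close> is one of polynomially many monic integer
  polynomials (\<open>exists_factor_candidate\<close>), and \<open>f\<close> divides the characteristic polynomial. It therefore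
  suffices to show for each fixed \<open>f\<close> that the probability of this divisibility is smaller than any
  prescribed power of \<open>n\<close>. Choose a prime \<open>p\<close> which is a large power of \<open>n\<close>
  (\<open>exists_prime_between\<close>) and a maximal ideal \<open>P\<close> of the ring of integer polynomials containing \<open>p\<close>
  and \<open>f\<close> (\<open>exists_residue_field\<close>). If \<open>f\<close> divides the characteristic polynomial, then the
  characteristic matrix \<open>x - M\<close> is singular over the finite field modulo \<open>P\<close>, which has at most
  \<open>p ^ d\<close> elements. Conditioning on \<open>M\<^sub>2, \<dots>, M\<^sub>m\<close> and multiplying by the adjugate of their product
  reduces this to the singularity over the field of \<open>\<gamma> M\<^sub>1 + B\<close>, where \<open>\<gamma> \<noteq> 0\<close> and \<open>B\<close> are
  deterministic but otherwise arbitrary (\<open>prob_product_singular_le\<close>).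

  If \<open>\<gamma> M\<^sub>1 + B\<close> is singular, one row lies in the span of the others and is orthogonal to any vector
  \<open>w\<close> orthogonal to the others; such a \<open>w\<close> can be selected from the other rows alone. Call \<open>w\<close> bad if
  some value of the signed sum \<open>\<Sum>\<^sub>i x\<^sub>i w\<^sub>i\<close> has probability larger than \<open>\<rho>\<close>, a small power of
  \<open>n\<close>. If \<open>w\<close> is not bad, the last row is orthogonal to it with probability at most \<open>\<rho>\<close>. For bad
  \<open>w\<close> take the union bound over all of them (\<open>card_singular_le\<close>): if the signed sums of \<open>w\<close>
  concentrate with probability \<open>\<beta>(w)\<close>, the other \<open>n - 1\<close> rows contribute \<open>\<beta>(w) ^ (n - 1)\<close>, and the
  sum of these numbers over all bad \<open>w\<close> has to be small (\<open>bad_vectors_sum\<close>).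

  Two facts about additive relations \<open>\<plusminus> w\<^sub>i\<^sub>1 \<plusminus> \<dots> \<plusminus> w\<^sub>i\<^sub>2\<^sub>k = 0\<close> achieve this. Let \<open>r(w)\<close> be the
  least density of such relations among the entries with indices in any set of at least \<open>s\<close> places in
  the support of \<open>w\<close>, where \<open>s\<close> is about \<open>sqrt n\<close>. Fourier analysis (\<open>halasz\<close>) shows that for bad
  \<open>w\<close> of large support \<open>\<beta>(w)\<close> can be taken to be a constant multiple of \<open>r(w) / h\<close>, where the saving
  \<open>h\<close> is a small power of \<open>n\<close>. Conversely, vectors with many relations are rare: a relation
  expresses one entry through others, and removing the entries one after another shows that for a
  support of size \<open>s + t\<close> the sum of \<open>r(w) ^ t\<close> is at most the number of choices of \<open>s\<close> entries
  (\<open>sum_min_density_le\<close>). So the powers of \<open>r(w)\<close> are absorbed by the number of vectors, and the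
  saving \<open>h ^ (n - 1)\<close> beats all other factors. The few vectors of small support are treated with the
  trivial bound \<open>\<beta>(w) = 1 / 2\<close>.
\<close>

section \<open>Characters of a finite residue field\<close>

text \<open>The characteristic grows with the dimension of the matrices, so the residue field cannot be a
  type; it is represented by a prime ideal \<open>P\<close> of a fixed ring together with a finite transversal
  \<open>C\<close> of its classes.\<close>

locale finite_residue_field =
  fixes P C :: "'a::comm_ring_1 set" and p :: nat
  assumes zero_in: "0 \<in> P"
    and add_in: "a \<in> P \<Longrightarrow> b \<in> P \<Longrightarrow> a + b \<in> P"
    and mult_in: "a \<in> P \<Longrightarrow> r * a \<in> P"
    and prime_ideal: "a * b \<in> P \<Longrightarrow> a \<in> P \<or> b \<in> P"
    and one_notin: "1 \<notin> P"
    and p_prime: "prime p" and p_odd: "p > 2" and p_in: "of_nat p \<in> P"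
    and fin_C: "finite C"
    and rep_exists: "\<And>a. \<exists>c\<in>C. a - c \<in> P"
    and rep_unique: "c \<in> C \<Longrightarrow> c' \<in> C \<Longrightarrow> c - c' \<in> P \<Longrightarrow> c = c'"
begin

lemma mult_in': "a \<in> P \<Longrightarrow> a * r \<in> P"
  using mult_in[of a r] by (simp add: mult.commute)

lemma uminus_in: "a \<in> P \<Longrightarrow> - a \<in> P"
  using mult_in[of a "-1"] by simp

lemma diff_in: "a \<in> P \<Longrightarrow> b \<in> P \<Longrightarrow> a - b \<in> P"
  using add_in[of a "- b"] uminus_in[of b] by simp

lemma diff_in_sym: "a - b \<in> P \<Longrightarrow> b - a \<in> P"
  using uminus_in[of "a - b"] by simp

lemma diff_in_trans: "a - b \<in> P \<Longrightarrow> b - c \<in> P \<Longrightarrow> a - c \<in> P"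
  using add_in[of "a - b" "b - c"] by simp

lemma sum_in: "(\<And>i. i \<in> I \<Longrightarrow> f i \<in> P) \<Longrightarrow> sum f I \<in> P"
  by (induction I rule: infinite_finite_induct) (auto simp: zero_in add_in)

lemma prime_ideal_iff: "a * b \<in> P \<longleftrightarrow> a \<in> P \<or> b \<in> P"
  using prime_ideal mult_in mult_in' by blast

lemma diff_in_left_iff: "a - b \<in> P \<Longrightarrow> a \<in> P \<longleftrightarrow> b \<in> P"
  using add_in[of "a - b" b] diff_in[of a "a - b"] by auto

lemma of_int_in_iff: "of_int z \<in> P \<longleftrightarrow> int p dvd z"
proof
  assume "int p dvd z"
  then obtain y where "z = int p * y" by blast
  then show "of_int z \<in> P" using mult_in'[OF p_in, of "of_int y"] by simp
next
  assume z: "of_int z \<in> P"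
  show "int p dvd z"
  proof (rule ccontr)
    assume "\<not> int p dvd z"
    then have "coprime z (int p)"
      using p_prime by (meson prime_imp_coprime coprime_commute prime_nat_int_transfer)
    then obtain u v where uv: "u * z + v * int p = 1"
      using bezout_int[of z "int p"] by auto
    have "of_int u * of_int z + of_int v * of_nat p \<in> P"
      by (intro add_in mult_in z p_in)
    also have "of_int u * of_int z + of_int v * of_nat p = (of_int (u * z + v * int p) :: 'a)"
      by simp
    finally show False using one_notin by (simp add: uv)
  qed
qed

definition rep :: "'a \<Rightarrow> 'a" where "rep a = (SOME c. c \<in> C \<and> a - c \<in> P)"

lemma rep: "rep a \<in> C" "a - rep a \<in> P"
  using someI_ex[of "\<lambda>c. c \<in> C \<and> a - c \<in> P"] rep_exists[of a]
  unfolding rep_def by auto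

lemma rep_eqI: "c \<in> C \<Longrightarrow> a - c \<in> P \<Longrightarrow> rep a = c"
  using rep[of a] rep_unique diff_in_trans diff_in_sym by meson

lemma rep_eq_iff: "rep a = rep b \<longleftrightarrow> a - b \<in> P"
  using rep rep_eqI diff_in_trans diff_in_sym by metis

lemma C_nonempty: "C \<noteq> {}" using rep(1) by auto

definition chars :: "('a \<Rightarrow> complex) set" where
  "chars = {\<xi>. (\<forall>a b. \<xi> (a + b) = \<xi> a * \<xi> b) \<and> (\<forall>a\<in>P. \<xi> a = 1)}"

lemma char_add: "\<xi> \<in> chars \<Longrightarrow> \<xi> (a + b) = \<xi> a * \<xi> b"
  and char_P: "\<xi> \<in> chars \<Longrightarrow> a \<in> P \<Longrightarrow> \<xi> a = 1"
  and char_0: "\<xi> \<in> chars \<Longrightarrow> \<xi> 0 = 1"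
  by (auto simp: chars_def zero_in)

lemma char_cong: "\<xi> \<in> chars \<Longrightarrow> a - b \<in> P \<Longrightarrow> \<xi> a = \<xi> b"
  using char_add[of \<xi> "a - b" b] char_P[of \<xi> "a - b"] by simp

lemma char_of_nat_mult: "\<xi> \<in> chars \<Longrightarrow> \<xi> (of_nat k * a) = \<xi> a ^ k"
  by (induction k) (auto simp: char_0 char_add algebra_simps)

lemma char_sum: "\<xi> \<in> chars \<Longrightarrow> \<xi> (sum f I) = (\<Prod>i\<in>I. \<xi> (f i))"
  by (induction I rule: infinite_finite_induct) (auto simp: char_0 char_add)

lemma char_power_p: "\<xi> \<in> chars \<Longrightarrow> \<xi> a ^ p = 1"
  using char_of_nat_mult[of \<xi> p a] char_P[of \<xi> "of_nat p * a"] mult_in'[OF p_in] by simp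

lemma norm_char: "\<xi> \<in> chars \<Longrightarrow> cmod (\<xi> a) = 1"
  using char_power_p[of \<xi> a] p_odd
  by (metis norm_ge_zero norm_one norm_power power_eq_1_iff gr_implies_not0 le_zero_eq norm_one zero_neq_one)

lemma char_uminus: "\<xi> \<in> chars \<Longrightarrow> \<xi> (- a) = cnj (\<xi> a)"
proof -
  assume c: "\<xi> \<in> chars"
  have "\<xi> (- a) * \<xi> a = 1" using char_add[OF c, of "-a" a] char_0[OF c] by simp
  moreover have "cnj (\<xi> a) * \<xi> a = 1"
    using norm_char[OF c, of a] by (simp add: complex_norm_square[symmetric] mult.commute)
  ultimately show ?thesis using norm_char[OF c, of a]
    by (metis mult_cancel_right norm_zero zero_neq_one)
qed

definition cmul :: "('a \<Rightarrow> complex) \<Rightarrow> ('a \<Rightarrow> complex) \<Rightarrow> 'a \<Rightarrow> complex" (infixl \<open>\<diamondop>\<close> 70)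
  where "\<xi> \<diamondop> \<psi> = (\<lambda>a. \<xi> a * \<psi> a)"

lemma cmul_apply [simp]: "(\<xi> \<diamondop> \<psi>) a = \<xi> a * \<psi> a"
  by (simp add: cmul_def)

lemma cmul_in: "\<xi> \<in> chars \<Longrightarrow> \<psi> \<in> chars \<Longrightarrow> \<xi> \<diamondop> \<psi> \<in> chars"
  by (auto simp: chars_def algebra_simps)

lemma cmul_left_cancel: "\<phi> \<in> chars \<Longrightarrow> \<phi> \<diamondop> \<xi> = \<phi> \<diamondop> \<psi> \<longleftrightarrow> \<xi> = \<psi>"
proof -
  assume "\<phi> \<in> chars"
  then have "\<phi> a \<noteq> 0" for a using norm_char[of \<phi> a] by auto
  then show ?thesis by (auto simp: fun_eq_iff)
qed

lemma one_char: "(\<lambda>_. 1) \<in> chars"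
  by (auto simp: chars_def)

lemma cnj_char: "\<xi> \<in> chars \<Longrightarrow> (\<lambda>a. cnj (\<xi> a)) \<in> chars"
  by (auto simp: chars_def)

lemma power_char: "\<xi> \<in> chars \<Longrightarrow> (\<lambda>a. \<xi> a ^ k) \<in> chars"
  by (auto simp: chars_def power_mult_distrib)

lemma finite_chars: "finite chars"
proof -
  have "finite {z :: complex. z ^ p = 1}"
    using p_odd by (intro finite_roots_unity) auto
  then have "finite (PiE C (\<lambda>_. {z :: complex. z ^ p = 1}))"
    using fin_C by (intro finite_PiE) auto
  moreover have "(\<lambda>\<xi>. restrict \<xi> C) ` chars \<subseteq> PiE C (\<lambda>_. {z :: complex. z ^ p = 1})"
    using char_power_p by auto
  moreover have "inj_on (\<lambda>\<xi>. restrict \<xi> C) chars"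
  proof (rule inj_onI, rule ext)
    fix \<xi> \<psi> a assume c: "\<xi> \<in> chars" "\<psi> \<in> chars" and eq: "restrict \<xi> C = restrict \<psi> C"
    have "\<xi> (rep a) = \<psi> (rep a)" using fun_cong[OF eq, of "rep a"] rep(1)[of a] by simp
    then show "\<xi> a = \<psi> a" using char_cong c rep(2)[of a] by metis
  qed
  ultimately show ?thesis by (meson finite_imageD finite_subset)
qed

lemma card_chars_pos: "card chars > 0"
  using finite_chars one_char by (auto simp: card_gt_0_iff)

text \<open>A difference of two exponents below the prime \<^term>\<open>p\<close> is invertible modulo \<^term>\<open>p\<close>.\<close>

lemma prime_root_of_unity_powers_inj:
  fixes z :: complex
  assumes "z ^ p = 1" "z \<noteq> 1" shows "inj_on (\<lambda>j. z ^ j) {..<p}"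
proof -
  have main: False if eq: "z ^ i = z ^ j" and ij: "i < j" "j < p" for i j
  proof -
    have nz: "z \<noteq> 0" using assms(1) p_odd by (auto simp: power_0_left split: if_splits)
    have "z ^ i * z ^ (j - i) = z ^ i * 1" using eq ij by (metis le_add_diff_inverse less_imp_le mult.right_neutral power_add)
    then have one: "z ^ (j - i) = 1" using nz by (metis mult_cancel_left power_not_zero)
    have "coprime (j - i) p"
      using ij p_prime by (intro coprime_commute[THEN iffD1, OF prime_imp_coprime]) (auto dest: dvd_imp_le)
    then obtain u v where uv: "(j - i) * u = p * v + 1"
      using bezout_nat[of "j - i" p] ij by auto
    have "z ^ ((j - i) * u) = 1" using one by (simp add: power_mult)
    moreover have "z ^ (p * v + 1) = z" using assms(1) by (simp add: power_mult)
    ultimately show False using uv assms(2) by metis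
  qed
  show ?thesis
  proof (rule inj_onI)
    fix i j assume "i \<in> {..<p}" "j \<in> {..<p}" "z ^ i = z ^ j"
    then show "i = j" using main[of i j] main[of j i] by (metis lessThan_iff linorder_neqE_nat)
  qed
qed

text \<open>A largest additive subgroup containing the ideal but not \<open>a\<close>
  has index \<^term>\<open>p\<close>, with the multiples of \<open>a\<close> as coset representatives, so the
  coset number modulo \<^term>\<open>p\<close> defines a character.\<close>

lemma exists_nontrivial_char:
  assumes "a \<notin> P" shows "\<exists>\<xi>\<in>chars. \<xi> a \<noteq> 1"
proof -
  define G where "G S \<longleftrightarrow> P \<subseteq> S \<and> a \<notin> S \<and> (\<forall>x\<in>S. \<forall>y\<in>S. x - y \<in> S)" for S
  have GP: "G P" using assms diff_in by (auto simp: G_def)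
  have "\<exists>S. G S \<and> (\<forall>S'. G S' \<longrightarrow> card (S' \<inter> C) \<le> card (S \<inter> C))"
  proof (rule ex_has_greatest_nat[where P = G and k = P and b = "Suc (card C)", OF GP])
    show "\<forall>y. G y \<longrightarrow> card (y \<inter> C) < Suc (card C)"
      using fin_C by (auto simp: less_Suc_eq_le intro: card_mono)
  qed
  then obtain S where S: "G S" and max: "\<And>S'. G S' \<Longrightarrow> card (S' \<inter> C) \<le> card (S \<inter> C)" by blast
  have S0: "0 \<in> S" and SP: "x \<in> P \<Longrightarrow> x \<in> S" and Sd: "x \<in> S \<Longrightarrow> y \<in> S \<Longrightarrow> x - y \<in> S" and Sa: "a \<notin> S" for x y
    using S zero_in by (auto simp: G_def)
  have Sadd: "x + y \<in> S" if "x \<in> S" "y \<in> S" for x y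
    using Sd[of x "0 - y"] Sd[OF S0, of y] that by simp
  have Smul: "of_int z * x \<in> S" if "x \<in> S" for z x
  proof -
    have nat: "of_nat k * x \<in> S" for k
      by (induction k) (auto simp: S0 Sadd that algebra_simps)
    show ?thesis
    proof (cases "z \<ge> 0")
      case True
      then show ?thesis using nat[of "nat z"] by simp
    next
      case False
      then have "of_int z * x = 0 - of_nat (nat (- z)) * x" by simp
      then show ?thesis using Sd[OF S0 nat] by metis
    qed
  qed
  have ker: "of_int z * a \<in> S \<longleftrightarrow> int p dvd z" for z
  proof
    assume "int p dvd z"
    then have "(of_int z :: 'a) \<in> P" by (simp add: of_int_in_iff)
    then show "of_int z * a \<in> S" using SP mult_in' by blast
  next
    assume zS: "of_int z * a \<in> S"
    show "int p dvd z"
    proof (rule ccontr)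
      assume "\<not> int p dvd z"
      then have "coprime z (int p)"
        using p_prime by (meson prime_imp_coprime coprime_commute prime_nat_int_transfer)
      then obtain u v where uv: "u * z + v * int p = 1"
        using bezout_int[of z "int p"] by auto
      have "of_int u * (of_int z * a) + (of_int v * a) * of_nat p \<in> S"
        by (intro Sadd Smul zS SP mult_in p_in)
      also have "of_int u * (of_int z * a) + (of_int v * a) * of_nat p = of_int (u * z + v * int p) * a"
        by (simp add: algebra_simps)
      finally show False using Sa by (simp add: uv)
    qed
  qed
  have cover: "\<exists>z. b - of_int z * a \<in> S" for b
  proof (cases "b \<in> S")
    case True then show ?thesis by (intro exI[of _ 0]) simp
  next
    case False
    define S' where "S' = {x. \<exists>z s. s \<in> S \<and> x = s + of_int z * b}"
    have "P \<subseteq> S'" using SP by (force simp: S'_def intro: exI[of _ 0])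
    have "S \<subseteq> S'" by (force simp: S'_def intro: exI[of _ 0])
    have "b \<in> S'" using S0 by (force simp: S'_def intro: exI[of _ 1])
    have "rep b \<in> S'" 
    proof -
      have "rep b - b \<in> S" using SP rep(2)[of b] diff_in_sym by blast
      moreover have "rep b = (rep b - b) + of_int 1 * b" by simp
      ultimately show ?thesis unfolding S'_def by blast
    qed
    have "rep b \<notin> S" using Sadd[of "rep b" "b - rep b"] SP[OF rep(2)[of b]] False by auto
    have "S \<inter> C \<subset> S' \<inter> C"
      using \<open>S \<subseteq> S'\<close> \<open>rep b \<in> S'\<close> \<open>rep b \<notin> S\<close> rep(1)[of b] by blast
    then have "card (S \<inter> C) < card (S' \<inter> C)" using fin_C by (intro psubset_card_mono) auto
    then have "\<not> G S'" using max[of S'] by auto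
    moreover have "x - y \<in> S'" if xy: "x \<in> S'" "y \<in> S'" for x y
    proof -
      obtain z s z' s' where "s \<in> S" "s' \<in> S" "x = s + of_int z * b" "y = s' + of_int z' * b"
        using xy by (auto simp: S'_def)
      then have "s - s' \<in> S" "x - y = (s - s') + of_int (z - z') * b"
        by (auto simp: Sd algebra_simps)
      then show ?thesis unfolding S'_def by blast
    qed
    ultimately have "a \<in> S'" using \<open>P \<subseteq> S'\<close> by (auto simp: G_def)
    then obtain s z where sz: "s \<in> S" "a = s + of_int z * b" by (auto simp: S'_def)
    have "\<not> int p dvd z"
    proof
      assume "int p dvd z"
      then have "of_int z * b \<in> S" using SP mult_in' of_int_in_iff by blast
      then show False using sz Sa Sadd by auto
    qed
    then have "coprime z (int p)"
      using p_prime by (meson prime_imp_coprime coprime_commute prime_nat_int_transfer)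
    then obtain u v where uv: "u * z + v * int p = 1"
      using bezout_int[of z "int p"] by auto
    have "b - of_int u * a = of_int (u * z + v * int p) * b - of_int u * a" by (simp add: uv)
    also have "\<dots> = (of_int v * b) * of_nat p - of_int u * s" by (simp add: sz(2) algebra_simps)
    also have "\<dots> \<in> S" by (intro Sd SP mult_in p_in Smul sz)
    finally show ?thesis by blast
  qed
  define e where "e b = (SOME z. b - of_int z * a \<in> S)" for b
  have e: "b - of_int (e b) * a \<in> S" for b
    unfolding e_def by (rule someI_ex[OF cover])
  have e_cong: "int p dvd e b - z" if "b - of_int z * a \<in> S" for b z
  proof -
    have "(b - of_int z * a) - (b - of_int (e b) * a) \<in> S" using Sd that e by blast
    then have "of_int (e b - z) * a \<in> S" by (simp add: algebra_simps)
    then show ?thesis using ker[of "e b - z"] by blast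
  qed
  have w_int: "cis (2 * pi * of_int (y + int p * x) / p) = cis (2 * pi * of_int y / p)" for x y
  proof -
    have "2 * pi * of_int (y + int p * x) / p = 2 * pi * of_int y / p + 2 * pi * of_int x"
      using p_odd by (simp add: field_simps)
    then show ?thesis by (simp add: cis_mult[symmetric] cis_multiple_2pi)
  qed
  define \<xi> where "\<xi> b = cis (2 * pi * of_int (e b) / p)" for b
  have \<xi>I: "\<xi> b = cis (2 * pi * of_int z / p)" if bz: "b - of_int z * a \<in> S" for b z
  proof -
    obtain x where "e b = z + int p * x" using e_cong[OF bz] by (metis dvdE diff_eq_eq add.commute)
    then show ?thesis using w_int[of z x] by (simp add: \<xi>_def)
  qed
  have "\<xi> \<in> chars"
  proof -
    have "\<xi> (b + c) = \<xi> b * \<xi> c" for b c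
    proof -
      have "(b - of_int (e b) * a) + (c - of_int (e c) * a) \<in> S" using Sadd e by blast
      then have "(b + c) - of_int (e b + e c) * a \<in> S" by (simp add: algebra_simps)
      from \<xi>I[OF this] show ?thesis
        by (simp add: \<xi>_def cis_mult algebra_simps add_divide_distrib)
    qed
    moreover have "\<xi> b = 1" if "b \<in> P" for b
      using \<xi>I[of b 0] SP[OF that] by simp
    ultimately show ?thesis by (auto simp: chars_def)
  qed
  moreover have "\<xi> a \<noteq> 1"
  proof
    assume "\<xi> a = 1"
    moreover have "\<xi> a = cis (2 * pi / p)" using \<xi>I[of a 1] S0 by simp
    ultimately have "cos (2 * pi / p) = 1" by (metis Re_complex_of_real cis.sel(1) of_real_1)
    then obtain x :: int where "2 * pi / p = of_int x * 2 * pi" using cos_one_2pi_int by auto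
    then have "real_of_int (int p * x) = 1" using p_odd by (simp add: field_simps)
    then have "int p * x = 1" by linarith
    then have "p = 1" using zmult_eq_1_iff[of "int p" x] by auto
    with p_odd show False by simp
  qed
  ultimately show ?thesis by blast
qed

text \<open>The sum is invariant under multiplication by the value of any member of the group.\<close>

lemma sum_char_subgroup:
  assumes H: "H \<subseteq> chars" "\<And>\<xi> \<psi>. \<xi> \<in> H \<Longrightarrow> \<psi> \<in> H \<Longrightarrow> \<xi> \<diamondop> \<psi> \<in> H"
    and \<psi>: "\<psi> \<in> H" "\<psi> a \<noteq> 1"
  shows "(\<Sum>\<xi>\<in>H. \<xi> a) = 0"
proof -
  have fin: "finite H" using H(1) finite_chars finite_subset by blast
  have inj: "inj_on (\<lambda>\<xi>. \<psi> \<diamondop> \<xi>) H"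
    using cmul_left_cancel \<psi>(1) H(1) by (auto simp: inj_on_def)
  have "(\<lambda>\<xi>. \<psi> \<diamondop> \<xi>) ` H = H"
    using endo_inj_surj[OF fin _ inj] H(2) \<psi>(1) by blast
  then have "(\<Sum>\<xi>\<in>H. \<xi> a) = (\<Sum>\<xi>\<in>(\<lambda>\<xi>. \<psi> \<diamondop> \<xi>) ` H. \<xi> a)" by simp
  also have "\<dots> = (\<Sum>\<xi>\<in>H. \<psi> a * \<xi> a)" using inj by (simp add: sum.reindex)
  also have "\<dots> = \<psi> a * (\<Sum>\<xi>\<in>H. \<xi> a)" by (simp add: sum_distrib_left)
  finally show ?thesis using \<psi>(2) by simp
qed

lemma sum_chars: "(\<Sum>\<xi>\<in>chars. \<xi> a) = (if a \<in> P then of_nat (card chars) else 0)"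
proof (cases "a \<in> P")
  case True
  then show ?thesis by (simp add: char_P)
next
  case False
  then obtain \<psi> where "\<psi> \<in> chars" "\<psi> a \<noteq> 1" using exists_nontrivial_char by blast
  then show ?thesis using sum_char_subgroup[OF subset_refl cmul_in] False by simp
qed

lemma sum_char_over_reps:
  assumes "\<xi> \<in> chars" "\<xi> b \<noteq> 1" shows "(\<Sum>c\<in>C. \<xi> c) = 0"
proof -
  have inj: "inj_on (\<lambda>c. rep (c + b)) C"
    by (rule inj_onI) (auto simp: rep_eq_iff intro: rep_unique)
  have "(\<lambda>c. rep (c + b)) ` C = C"
    by (rule endo_inj_surj[OF fin_C _ inj]) (use rep in auto)
  then have "(\<Sum>c\<in>C. \<xi> c) = (\<Sum>c\<in>(\<lambda>c. rep (c + b)) ` C. \<xi> c)" by simp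
  also have "\<dots> = (\<Sum>c\<in>C. \<xi> (rep (c + b)))" using inj by (simp add: sum.reindex)
  also have "\<dots> = (\<Sum>c\<in>C. \<xi> b * \<xi> c)"
    using char_cong[OF assms(1) rep(2)] char_add[OF assms(1)] by (metis mult.commute)
  also have "\<dots> = \<xi> b * (\<Sum>c\<in>C. \<xi> c)" by (simp add: sum_distrib_left)
  finally show ?thesis using assms(2) by simp
qed

text \<open>Sum the character table by rows and by columns.\<close>

lemma card_chars: "card chars = card C"
proof -
  have "(\<Sum>c\<in>C. \<Sum>\<xi>\<in>chars. \<xi> c) = (\<Sum>c\<in>C. if c = rep 0 then of_nat (card chars) else 0)"
  proof (rule sum.cong[OF refl])
    fix c assume "c \<in> C"
    then have "c \<in> P \<longleftrightarrow> c = rep 0"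
      using rep_eqI[of c 0] rep[of 0] uminus_in[of c] uminus_in[of "- c"] by auto
    then show "(\<Sum>\<xi>\<in>chars. \<xi> c) = (if c = rep 0 then of_nat (card chars) else 0)"
      by (simp add: sum_chars)
  qed
  also have "\<dots> = of_nat (card chars)" using rep(1) fin_C by simp
  finally have 1: "(\<Sum>c\<in>C. \<Sum>\<xi>\<in>chars. \<xi> c) = of_nat (card chars)" .
  have "(\<Sum>\<xi>\<in>chars. \<Sum>c\<in>C. \<xi> c) = (\<Sum>\<xi>\<in>chars. if \<xi> = (\<lambda>_. 1) then of_nat (card C) else 0)"
  proof (rule sum.cong[OF refl])
    fix \<xi> assume c: "\<xi> \<in> chars"
    show "(\<Sum>c\<in>C. \<xi> c) = (if \<xi> = (\<lambda>_. 1) then of_nat (card C) else 0)"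
    proof (cases "\<xi> = (\<lambda>_. 1)")
      case False
      then obtain b where "\<xi> b \<noteq> 1" by blast
      then show ?thesis using sum_char_over_reps[OF c] False by simp
    qed simp
  qed
  also have "\<dots> = of_nat (card C)" using one_char finite_chars by simp
  finally have "(of_nat (card C) :: complex) = of_nat (card chars)"
    using 1 sum.swap[of "\<lambda>c \<xi>. \<xi> c" chars C] by simp
  then show ?thesis by simp
qed

section \<open>Concentration of signed sums\<close>

definition signs :: "'i set \<Rightarrow> ('i \<Rightarrow> int) set" where
  "signs J = PiE J (\<lambda>_. {-1, 1})"

text \<open>An upper bound for the concentration function of the random signed sum, stated by counting sign
  vectors because later arguments split them according to their entries.\<close>

definition conc :: "'i set \<Rightarrow> ('i \<Rightarrow> 'a) \<Rightarrow> real \<Rightarrow> bool" where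
  "conc J v b \<longleftrightarrow>
     (\<forall>a. real (card {x \<in> signs J. (\<Sum>i\<in>J. of_int (x i) * v i) - a \<in> P}) \<le> b * 2 ^ card J)"

lemma finite_signs: "finite J \<Longrightarrow> finite (signs J)"
  by (auto simp: signs_def intro: finite_PiE)

lemma card_signs: "finite J \<Longrightarrow> card (signs J) = 2 ^ card J"
  by (simp add: signs_def card_PiE numeral_2_eq_2)

lemma conc_mono_bound: "conc J v b \<Longrightarrow> b \<le> b' \<Longrightarrow> conc J v b'"
  unfolding conc_def by (meson mult_right_mono order_trans zero_le_numeral zero_le_power)

text \<open>Condition on the signs outside \<open>J\<close>.\<close>

lemma conc_superset:
  assumes "finite S" "J \<subseteq> S" "conc J v b"
  shows "conc S v b"
  unfolding conc_def
proof
  fix a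
  have finJ: "finite J" using assms finite_subset by blast
  define Y where "Y y = {x \<in> signs J. (\<Sum>i\<in>J. of_int (x i) * v i) - (a - (\<Sum>i\<in>S-J. of_int (y i) * v i)) \<in> P}" for y
  let ?A = "{x \<in> signs S. (\<Sum>i\<in>S. of_int (x i) * v i) - a \<in> P}"
  let ?h = "\<lambda>x. (restrict x (S - J), restrict x J)"
  have "card ?A \<le> card (Sigma (signs (S - J)) Y)"
  proof (rule card_inj_on_le[of ?h])
    show "inj_on ?h ?A"
    proof (rule inj_onI)
      fix x y assume xy: "x \<in> ?A" "y \<in> ?A" "?h x = ?h y"
      have "x i = y i" if "i \<in> S" for i
        using xy(3) that by (cases "i \<in> J") (auto dest: fun_cong[of _ _ i] simp: restrict_def)
      then show "x = y" using xy(1,2) by (intro PiE_ext[of x S "\<lambda>_. {-1, 1}" y]) (auto simp: signs_def)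
    qed
    show "?h ` ?A \<subseteq> Sigma (signs (S - J)) Y"
    proof (rule image_subsetI)
      fix x assume x: "x \<in> ?A"
      have "(\<Sum>i\<in>S. of_int (x i) * v i) = (\<Sum>i\<in>S-J. of_int (x i) * v i) + (\<Sum>i\<in>J. of_int (x i) * v i)"
        using assms by (simp add: sum.subset_diff)
      then have "(\<Sum>i\<in>J. of_int (x i) * v i) - (a - (\<Sum>i\<in>S-J. of_int (x i) * v i)) \<in> P"
        using x by (simp add: algebra_simps)
      moreover have "restrict x (S - J) \<in> signs (S - J)" "restrict x J \<in> signs J"
        using x assms(2) by (auto simp: signs_def PiE_iff)
      ultimately show "?h x \<in> Sigma (signs (S - J)) Y" by (auto simp: Y_def)
    qed
    show "finite (Sigma (signs (S - J)) Y)"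
      using assms finJ by (auto simp: Y_def finite_signs)
  qed
  also have "card (Sigma (signs (S - J)) Y) = (\<Sum>y\<in>signs (S - J). card (Y y))"
    using assms finJ by (intro card_SigmaI) (auto simp: Y_def finite_signs)
  finally have "real (card ?A) \<le> (\<Sum>y\<in>signs (S - J). real (card (Y y)))"
    by (simp flip: of_nat_sum)
  also have "\<dots> \<le> (\<Sum>y\<in>signs (S - J). b * 2 ^ card J)"
    using assms(3) unfolding Y_def conc_def by (intro sum_mono) blast
  also have "\<dots> = b * (2 ^ card (S - J) * 2 ^ card J)"
    using assms by (simp add: card_signs)
  also have "\<dots> = b * 2 ^ card S"
    using assms finJ by (simp add: card_Diff_subset card_mono flip: power_add)
  finally show "real (card ?A) \<le> b * 2 ^ card S" .
qed

lemma conc_half: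
  assumes "finite S" "i \<in> S" "v i \<notin> P"
  shows "conc S v (1 / 2)"
proof -
  have two: "\<not> (2 * v i \<in> P)"
  proof -
    have "\<not> int p dvd 2" using p_odd by (auto dest: zdvd_imp_le)
    then have "(of_int 2 :: 'a) \<notin> P" by (simp only: of_int_in_iff not_False_eq_True)
    then show ?thesis using assms(3) prime_ideal[of 2 "v i"] by auto
  qed
  have "card {x \<in> signs {i}. (\<Sum>i\<in>{i}. of_int (x i) * v i) - a \<in> P} \<le> 1" (is "card ?A \<le> 1") for a
  proof -
    have "x = y" if xy: "x \<in> ?A" "y \<in> ?A" for x y
    proof -
      have d: "of_int (x i) * v i - of_int (y i) * v i \<in> P"
        using diff_in_trans[of "of_int (x i) * v i" a "of_int (y i) * v i"]
          diff_in_sym[of "of_int (y i) * v i" a] xy by simp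
      have pm: "x i = -1 \<or> x i = 1" "y i = -1 \<or> y i = 1" using xy by (auto simp: signs_def PiE_iff)
      have "x i = y i"
      proof (rule ccontr)
        assume "x i \<noteq> y i"
        then consider "x i = 1" "y i = -1" | "x i = -1" "y i = 1" using pm by linarith
        then show False
        proof cases
          case 1
          then have "2 * v i \<in> P" using d by simp
          then show False using two by blast
        next
          case 2
          then have "- (2 * v i) \<in> P" using d by simp
          then show False using two uminus_in[of "- (2 * v i)"] by simp
        qed
      qed
      then show ?thesis using xy by (intro PiE_ext[of x "{i}" "\<lambda>_. {-1, 1}" y]) (auto simp: signs_def)
    qed
    then show ?thesis using card_le_Suc0_iff_eq[of ?A] finite_signs[of "{i}"] by auto
  qed
  then have "conc {i} v (1 / 2)" by (simp add: conc_def)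
  then show ?thesis using conc_superset[OF assms(1), of "{i}"] assms(2) by simp
qed

text \<open>The square of this quantity is twice the sum of \<open>1 - Re (\<xi> (v i))\<close>, which governs the size of the
  cosine product; written as a Euclidean norm it satisfies the triangle inequality.\<close>

definition dev :: "'i set \<Rightarrow> ('i \<Rightarrow> 'a) \<Rightarrow> ('a \<Rightarrow> complex) \<Rightarrow> real" where
  "dev J v \<xi> = L2_set (\<lambda>i. cmod (1 - \<xi> (v i))) J"

lemma dev_nonneg: "dev J v \<xi> \<ge> 0"
  by (simp add: dev_def)

lemma dev_one: "dev J v (\<lambda>_. 1) = 0"
  by (simp add: dev_def L2_set_def)

lemma dev_mult_le:
  assumes "\<xi> \<in> chars" "\<psi> \<in> chars"
  shows "dev J v (\<xi> \<diamondop> \<psi>) \<le> dev J v \<xi> + dev J v \<psi>"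
proof -
  have "cmod (1 - \<xi> a * \<psi> a) \<le> cmod (1 - \<xi> a) + cmod (1 - \<psi> a)" for a
  proof -
    have "1 - \<xi> a * \<psi> a = (1 - \<xi> a) + \<xi> a * (1 - \<psi> a)" by (simp add: algebra_simps)
    also have "cmod \<dots> \<le> cmod (1 - \<xi> a) + cmod (\<xi> a * (1 - \<psi> a))" by (rule norm_triangle_ineq)
    finally show ?thesis using norm_char[OF assms(1)] by (simp add: norm_mult)
  qed
  then have "dev J v (\<xi> \<diamondop> \<psi>) \<le> L2_set (\<lambda>i. cmod (1 - \<xi> (v i)) + cmod (1 - \<psi> (v i))) J"
    unfolding dev_def by (intro L2_set_mono) auto
  also have "\<dots> \<le> dev J v \<xi> + dev J v \<psi>"
    unfolding dev_def by (rule L2_set_triangle_ineq)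
  finally show ?thesis .
qed

lemma dev_cnj: "dev J v (\<lambda>a. cnj (\<xi> a)) = dev J v \<xi>"
proof -
  have "cmod (1 - cnj z) = cmod (1 - z)" for z by (metis complex_cnj_diff complex_cnj_one complex_mod_cnj)
  then show ?thesis by (simp add: dev_def)
qed

lemma norm_one_minus_sq:
  assumes "cmod z = 1" shows "(cmod (1 - z))\<^sup>2 = 2 - 2 * Re z"
proof -
  have sq: "(Re z)\<^sup>2 + (Im z)\<^sup>2 = 1" using assms by (simp add: cmod_def)
  have "(cmod (1 - z))\<^sup>2 = (1 - Re z)\<^sup>2 + (Im z)\<^sup>2" by (simp add: cmod_power2)
  also have "\<dots> = 1 - 2 * Re z + ((Re z)\<^sup>2 + (Im z)\<^sup>2)" by (simp add: power2_eq_square algebra_simps)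
  finally show ?thesis using sq by simp
qed

lemma dev_sq:
  assumes "\<xi> \<in> chars" shows "(dev J v \<xi>)\<^sup>2 = (\<Sum>i\<in>J. 2 - 2 * Re (\<xi> (v i)))"
proof -
  have "(dev J v \<xi>)\<^sup>2 = (\<Sum>i\<in>J. (cmod (1 - \<xi> (v i)))\<^sup>2)"
    unfolding dev_def L2_set_def by (intro real_sqrt_pow2 sum_nonneg) simp
  then show ?thesis using norm_one_minus_sq[OF norm_char[OF assms]] by simp
qed

text \<open>The characters form a group of odd exponent \<^term>\<open>p\<close>.\<close>

lemma bij_square_chars: "bij_betw (\<lambda>\<xi> a. \<xi> a ^ 2) chars chars"
proof -
  obtain h where h: "p = 2 * h + 1" using p_prime p_odd prime_odd_nat by (metis oddE)
  have inv: "\<xi> a = (\<xi> a ^ 2) ^ (h + 1)" if "\<xi> \<in> chars" for \<xi> a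
  proof -
    have "(\<xi> a ^ 2) ^ (h + 1) = \<xi> a * \<xi> a ^ p" by (simp add: h power_mult power2_eq_square)
    then show ?thesis using char_power_p[OF that, of a] by simp
  qed
  have "inj_on (\<lambda>\<xi> a. \<xi> a ^ 2) chars"
  proof (rule inj_onI, rule ext)
    fix \<xi> \<psi> a assume "\<xi> \<in> chars" "\<psi> \<in> chars" "(\<lambda>a. \<xi> a ^ 2) = (\<lambda>a. \<psi> a ^ 2)"
    then show "\<xi> a = \<psi> a" using inv by metis
  qed
  moreover from this have "(\<lambda>\<xi> a. \<xi> a ^ 2) ` chars = chars"
    by (intro endo_inj_surj finite_chars) (auto intro: power_char)
  ultimately show ?thesis by (simp add: bij_betw_def)
qed

lemma Re_le_exp:
  assumes "cmod z = 1" shows "\<bar>Re z\<bar> \<le> exp (- (cmod (1 - z ^ 2))\<^sup>2 / 8)"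
proof -
  have z: "(Re z)\<^sup>2 + (Im z)\<^sup>2 = 1" using assms by (simp add: cmod_def)
  have "(cmod (1 - z ^ 2))\<^sup>2 = 2 - 2 * Re (z ^ 2)"
    using assms by (intro norm_one_minus_sq) (simp add: norm_power)
  also have "Re (z ^ 2) = 2 * (Re z)\<^sup>2 - 1" using z by (simp add: power2_eq_square)
  finally have e: "- (cmod (1 - z ^ 2))\<^sup>2 / 8 = ((Re z)\<^sup>2 - 1) / 2" by simp
  have "\<bar>Re z\<bar>\<^sup>2 \<le> exp ((Re z)\<^sup>2 - 1)" using exp_ge_add_one_self[of "(Re z)\<^sup>2 - 1"] by simp
  also have "\<dots> = (exp (((Re z)\<^sup>2 - 1) / 2))\<^sup>2" by (simp flip: exp_double)
  finally show ?thesis unfolding e by (rule power2_le_imp_le) simp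
qed

text \<open>Expand the indicator of the ideal in characters; every sign contributes one cosine factor.
  Replacing each character by its square, a permutation in odd characteristic, removes the factor
  two that the cosine estimate leaves in the argument.\<close>

lemma conc_fourier:
  assumes "finite J"
  shows "conc J v ((\<Sum>\<xi>\<in>chars. exp (- (dev J v \<xi>)\<^sup>2 / 8)) / card chars)"
  unfolding conc_def
proof
  fix a
  let ?A = "{x \<in> signs J. (\<Sum>i\<in>J. of_int (x i) * v i) - a \<in> P}"
  have fin: "finite (signs J)" using assms by (rule finite_signs)
  have term_eq: "(\<Sum>x\<in>signs J. \<xi> ((\<Sum>i\<in>J. of_int (x i) * v i) - a)) = \<xi> (- a) * (\<Prod>i\<in>J. complex_of_real (2 * Re (\<xi> (v i))))"
    if c: "\<xi> \<in> chars" for \<xi>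
  proof -
    have "(\<Sum>x\<in>signs J. \<xi> ((\<Sum>i\<in>J. of_int (x i) * v i) - a)) = \<xi> (- a) * (\<Sum>x\<in>signs J. \<Prod>i\<in>J. \<xi> (of_int (x i) * v i))"
      using char_add[OF c, of _ "- a"] by (simp add: char_sum[OF c] sum_distrib_left mult.commute)
    also have "(\<Sum>x\<in>signs J. \<Prod>i\<in>J. \<xi> (of_int (x i) * v i)) = (\<Prod>i\<in>J. \<Sum>y\<in>{-1, 1}. \<xi> (of_int y * v i))"
      unfolding signs_def using assms by (intro prod_sum_PiE[symmetric]) auto
    also have "\<dots> = (\<Prod>i\<in>J. complex_of_real (2 * Re (\<xi> (v i))))"
      by (intro prod.cong refl) (simp add: char_uminus[OF c] complex_add_cnj add.commute)
    finally show ?thesis .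
  qed
  have "of_nat (card ?A) * of_nat (card chars) = (\<Sum>x\<in>signs J. \<Sum>\<xi>\<in>chars. \<xi> ((\<Sum>i\<in>J. of_int (x i) * v i) - a))"
    using fin by (simp add: sum_chars sum.If_cases Int_def)
  also have "\<dots> = (\<Sum>\<xi>\<in>chars. \<Sum>x\<in>signs J. \<xi> ((\<Sum>i\<in>J. of_int (x i) * v i) - a))"
    by (rule sum.swap)
  also have "\<dots> = (\<Sum>\<xi>\<in>chars. \<xi> (- a) * (\<Prod>i\<in>J. complex_of_real (2 * Re (\<xi> (v i)))))"
    using term_eq by simp
  finally have eq: "of_nat (card ?A) * of_nat (card chars) = \<dots>" .
  have "real (card ?A) * real (card chars) = cmod (of_nat (card ?A) * of_nat (card chars))"
    by (simp add: norm_mult)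
  also have "\<dots> \<le> (\<Sum>\<xi>\<in>chars. cmod (\<xi> (- a) * (\<Prod>i\<in>J. complex_of_real (2 * Re (\<xi> (v i))))))"
    unfolding eq by (rule norm_sum)
  also have "\<dots> = (\<Sum>\<xi>\<in>chars. \<Prod>i\<in>J. 2 * \<bar>Re (\<xi> (v i))\<bar>)"
    by (intro sum.cong refl) (simp add: norm_mult norm_char prod_norm[symmetric] abs_mult)
  also have "\<dots> \<le> (\<Sum>\<xi>\<in>chars. \<Prod>i\<in>J. 2 * exp (- (cmod (1 - \<xi> (v i) ^ 2))\<^sup>2 / 8))"
  proof (intro sum_mono prod_mono conjI)
    fix \<xi> i assume "\<xi> \<in> chars"
    then show "2 * \<bar>Re (\<xi> (v i))\<bar> \<le> 2 * exp (- (cmod (1 - \<xi> (v i) ^ 2))\<^sup>2 / 8)"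
      using Re_le_exp[OF norm_char] by simp
  qed simp
  also have "\<dots> = 2 ^ card J * (\<Sum>\<xi>\<in>chars. exp (- (dev J v (\<lambda>a. \<xi> a ^ 2))\<^sup>2 / 8))"
    using assms by (simp add: prod.distrib sum_distrib_left exp_sum[symmetric] dev_def L2_set_def
        sum_nonneg sum_negf sum_divide_distrib[symmetric])
  also have "(\<Sum>\<xi>\<in>chars. exp (- (dev J v (\<lambda>a. \<xi> a ^ 2))\<^sup>2 / 8)) = (\<Sum>\<xi>\<in>chars. exp (- (dev J v \<xi>)\<^sup>2 / 8))"
    by (rule sum.reindex_bij_betw[OF bij_square_chars])
  finally show "real (card ?A) \<le> (\<Sum>\<xi>\<in>chars. exp (- (dev J v \<xi>)\<^sup>2 / 8)) / card chars * 2 ^ card J"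
    using card_chars_pos by (simp add: field_simps)
qed

definition near :: "'i set \<Rightarrow> ('i \<Rightarrow> 'a) \<Rightarrow> real \<Rightarrow> ('a \<Rightarrow> complex) set" where
  "near J v c = {\<xi> \<in> chars. dev J v \<xi> \<le> c}"

lemma finite_near: "finite (near J v c)"
  by (simp add: near_def finite_chars)

text \<open>Only characters close to trivial contribute noticeably.\<close>

lemma conc_near:
  assumes "finite J" "c \<ge> 0"
  shows "conc J v (card (near J v c) / card chars + exp (- c\<^sup>2 / 8))"
proof (rule conc_mono_bound[OF conc_fourier[OF assms(1)]])
  have "(\<Sum>\<xi>\<in>chars. exp (- (dev J v \<xi>)\<^sup>2 / 8)) \<le> (\<Sum>\<xi>\<in>chars. (if \<xi> \<in> near J v c then 1 else 0) + exp (- c\<^sup>2 / 8))"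
  proof (rule sum_mono)
    fix \<xi> assume "\<xi> \<in> chars"
    then show "exp (- (dev J v \<xi>)\<^sup>2 / 8) \<le> (if \<xi> \<in> near J v c then 1 else 0) + exp (- c\<^sup>2 / 8)"
      using assms(2) by (auto simp: near_def add_increasing2 intro!: power_mono)
  qed
  also have "\<dots> = card (near J v c) + card chars * exp (- c\<^sup>2 / 8)"
    using finite_chars by (simp add: sum.distrib near_def sum.If_cases Int_def conj_commute)
  finally show "(\<Sum>\<xi>\<in>chars. exp (- (dev J v \<xi>)\<^sup>2 / 8)) / card chars \<le> card (near J v c) / card chars + exp (- c\<^sup>2 / 8)"
    using card_chars_pos by (simp add: field_simps)
qed

definition sols :: "'i set \<Rightarrow> ('i \<Rightarrow> 'a) \<Rightarrow> nat \<Rightarrow> (nat \<Rightarrow> 'i \<times> int) set" where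
  "sols J v k = {F \<in> PiE {..<2 * k} (\<lambda>_. J \<times> {-1, 1}). (\<Sum>j<2 * k. of_int (snd (F j)) * v (fst (F j))) \<in> P}"

lemma finite_sols: "finite J \<Longrightarrow> finite (sols J v k)"
proof -
  assume "finite J"
  then have "finite (PiE {..<2 * k} (\<lambda>_. J \<times> {-1, 1 :: int}))" by (intro finite_PiE) auto
  then show ?thesis unfolding sols_def by simp
qed

text \<open>The number of additive relations is a moment of the character sums, to which every
  character close to trivial contributes substantially.\<close>

lemma card_near_le_sols:
  fixes L :: real
  assumes "finite J" "L \<ge> 0" "L\<^sup>2 \<le> card J"
  shows "card (near J v L) * real (card J) ^ (2 * k) \<le> card chars * card (sols J v k)"
proof -
  have fin: "finite (PiE {..<2 * k} (\<lambda>_. J \<times> {-1, 1::int}))"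
    using assms(1) by (intro finite_PiE) auto
  define S where "S \<xi> = (\<Sum>i\<in>J. 2 * Re (\<xi> (v i)))" for \<xi>
  have expand: "complex_of_real (S \<xi> ^ (2 * k)) =
      (\<Sum>F\<in>PiE {..<2 * k} (\<lambda>_. J \<times> {-1, 1}). \<xi> (\<Sum>j<2 * k. of_int (snd (F j)) * v (fst (F j))))"
    if c: "\<xi> \<in> chars" for \<xi>
  proof -
    have "complex_of_real (S \<xi>) = (\<Sum>i\<in>J. \<Sum>e\<in>{-1, 1}. \<xi> (of_int e * v i))"
      unfolding S_def by (simp add: char_uminus[OF c] complex_add_cnj add.commute)
    also have "\<dots> = (\<Sum>y\<in>J \<times> {-1, 1}. \<xi> (of_int (snd y) * v (fst y)))"
      by (simp only: sum.cartesian_product split_def)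
    finally have "complex_of_real (S \<xi>) ^ (2 * k) = (\<Prod>j<2 * k. \<Sum>y\<in>J \<times> {-1, 1}. \<xi> (of_int (snd y) * v (fst y)))"
      by simp
    also have "\<dots> = (\<Sum>F\<in>PiE {..<2 * k} (\<lambda>_. J \<times> {-1, 1}). \<Prod>j<2 * k. \<xi> (of_int (snd (F j)) * v (fst (F j))))"
      using assms(1) by (intro prod_sum_PiE) auto
    finally show ?thesis by (simp add: char_sum[OF c])
  qed
  have "complex_of_real (\<Sum>\<xi>\<in>chars. S \<xi> ^ (2 * k)) =
      (\<Sum>F\<in>PiE {..<2 * k} (\<lambda>_. J \<times> {-1, 1}). \<Sum>\<xi>\<in>chars. \<xi> (\<Sum>j<2 * k. of_int (snd (F j)) * v (fst (F j))))"
    using sum.swap[of "\<lambda>F \<xi>. \<xi> (\<Sum>j<2 * k. of_int (snd (F j)) * v (fst (F j)))" chars "PiE {..<2 * k} (\<lambda>_. J \<times> {-1, 1})"]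
    by (simp only: of_real_sum expand cong: sum.cong)
  also have "\<dots> = complex_of_real (card chars * card (sols J v k))"
    using fin by (simp add: sum_chars sum.If_cases Int_def sols_def)
  finally have moment: "(\<Sum>\<xi>\<in>chars. S \<xi> ^ (2 * k)) = card chars * card (sols J v k)"
    by (simp only: of_real_eq_iff)
  have "card (near J v L) * real (card J) ^ (2 * k) = (\<Sum>\<xi>\<in>near J v L. real (card J) ^ (2 * k))"
    by simp
  also have "\<dots> \<le> (\<Sum>\<xi>\<in>near J v L. S \<xi> ^ (2 * k))"
  proof (intro sum_mono power_mono)
    fix \<xi> assume x: "\<xi> \<in> near J v L"
    then have "(dev J v \<xi>)\<^sup>2 \<le> L\<^sup>2" using dev_nonneg by (auto simp: near_def intro!: power_mono)
    then have "2 * real (card J) - S \<xi> \<le> card J"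
      using assms(3) dev_sq[of \<xi> J v] x by (simp add: near_def S_def sum_subtractf)
    then show "real (card J) \<le> S \<xi>" by simp
  qed simp
  also have "\<dots> \<le> (\<Sum>\<xi>\<in>chars. S \<xi> ^ (2 * k))"
    using finite_chars by (intro sum_mono2) (auto simp: near_def)
  finally show ?thesis using moment by simp
qed

text \<open>A finite set of characters that is closed under multiplication is a group, so that inverses need
  not be adjoined to obtain the generated group.\<close>

inductive_set gen :: "('a \<Rightarrow> complex) set \<Rightarrow> ('a \<Rightarrow> complex) set" for A where
  one: "(\<lambda>_. 1) \<in> gen A"
| step: "\<psi> \<in> gen A \<Longrightarrow> \<phi> \<in> A \<Longrightarrow> \<psi> \<diamondop> \<phi> \<in> gen A"

lemma cmul_assoc: "(a \<diamondop> b) \<diamondop> c = a \<diamondop> (b \<diamondop> c)"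
  by (simp add: fun_eq_iff)

lemma cmul_one: "a \<diamondop> (\<lambda>_. 1) = a" "(\<lambda>_. 1) \<diamondop> a = a"
  by (simp_all add: fun_eq_iff)

lemma gen_subset: "A \<subseteq> chars \<Longrightarrow> gen A \<subseteq> chars"
proof
  fix x assume A: "A \<subseteq> chars"
  assume "x \<in> gen A" then show "x \<in> chars"
    using A by induction (auto intro: one_char cmul_in)
qed

lemma subset_gen: "A \<subseteq> gen A"
  using gen.step[OF gen.one] by (auto simp: cmul_one)

lemma gen_mult: "\<psi> \<in> gen A \<Longrightarrow> \<xi> \<in> gen A \<Longrightarrow> \<xi> \<diamondop> \<psi> \<in> gen A"
  by (induction rule: gen.induct) (auto simp: cmul_one cmul_assoc[symmetric] intro: gen.step)

text \<open>Walking to a far point of the generated group in small steps visits every distance along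
  the way; translates of the small ball by points at well separated distances are disjoint.
  This does the work of a sumset inequality of Cauchy-Davenport type, in a group that may have
  many subgroups.\<close>

lemma near_growth:
  assumes "c > 0" "\<xi> \<in> gen (near J v (2 * c))" "dev J v \<xi> > L" "4 * c * real m \<le> L"
  shows "m * card (near J v c) \<le> card (near J v L)"
proof -
  have sub: "gen (near J v (2 * c)) \<subseteq> chars" by (intro gen_subset) (auto simp: near_def)
  \<comment> \<open>A single multiplication by a generator increases the distance by at most \<open>2 * c\<close>.\<close>
  have visit: "\<exists>\<phi>\<in>chars. r < dev J v \<phi> \<and> dev J v \<phi> \<le> r + 2 * c"
    if "\<psi> \<in> gen (near J v (2 * c))" "r < dev J v \<psi>" "r \<ge> 0" for \<psi> r
    using that
  proof induction
    case one then show ?case by (simp add: dev_one)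
  next
    case (step \<psi> \<phi>)
    have in_chars: "\<psi> \<in> chars" "\<phi> \<in> chars" using step sub by (auto simp: near_def)
    show ?case
    proof (cases "r < dev J v \<psi>")
      case True then show ?thesis using step by blast
    next
      case False
      then have "dev J v (\<psi> \<diamondop> \<phi>) \<le> r + 2 * c"
        using dev_mult_le[OF in_chars, of J v] step(2) by (auto simp: near_def)
      then show ?thesis using step cmul_in[OF in_chars] by blast
    qed
  qed
  have "\<forall>a<m. \<exists>\<phi>\<in>chars. 4 * c * real a < dev J v \<phi> \<and> dev J v \<phi> \<le> 4 * c * real a + 2 * c"
  proof (intro allI impI)
    fix a assume a: "a < m"
    have "4 * c * real a \<le> 4 * c * real m" using a assms(1) by simp
    then have "4 * c * real a < dev J v \<xi>" using assms by linarith
    then show "\<exists>\<phi>\<in>chars. 4 * c * real a < dev J v \<phi> \<and> dev J v \<phi> \<le> 4 * c * real a + 2 * c"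
      using visit[OF assms(2)] assms(1) by simp
  qed
  then obtain \<phi> where \<phi>: "\<And>a. a < m \<Longrightarrow> \<phi> a \<in> chars"
      "\<And>a. a < m \<Longrightarrow> 4 * c * real a < dev J v (\<phi> a)"
      "\<And>a. a < m \<Longrightarrow> dev J v (\<phi> a) \<le> 4 * c * real a + 2 * c"
    by metis
  let ?h = "\<lambda>(a, \<xi>). \<phi> a \<diamondop> \<xi>"
  have not_less: False
    if ab: "b < a" "a < m" and x: "\<xi> \<in> near J v c" "\<eta> \<in> near J v c" and eq: "\<phi> a \<diamondop> \<xi> = \<phi> b \<diamondop> \<eta>" for a b \<xi> \<eta>
  proof -
    have cx: "\<xi> \<in> chars" "\<eta> \<in> chars" "dev J v \<xi> \<le> c" "dev J v \<eta> \<le> c" using x by (auto simp: near_def)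
    have "\<phi> a = \<phi> b \<diamondop> (\<eta> \<diamondop> (\<lambda>x. cnj (\<xi> x)))"
    proof
      fix y
      have "\<xi> y * cnj (\<xi> y) = 1" using norm_char[OF cx(1), of y] by (simp add: complex_norm_square[symmetric])
      moreover have "\<phi> a y * \<xi> y = \<phi> b y * \<eta> y" using fun_cong[OF eq, of y] by simp
      ultimately show "\<phi> a y = (\<phi> b \<diamondop> (\<eta> \<diamondop> (\<lambda>x. cnj (\<xi> x)))) y"
        by (metis cmul_apply mult.assoc mult.right_neutral)
    qed
    then have "dev J v (\<phi> a) \<le> dev J v (\<phi> b) + dev J v (\<eta> \<diamondop> (\<lambda>x. cnj (\<xi> x)))"
      using dev_mult_le \<phi>(1) ab cx cmul_in cnj_char by (metis order.strict_trans)
    also have "dev J v (\<eta> \<diamondop> (\<lambda>x. cnj (\<xi> x))) \<le> dev J v \<eta> + dev J v \<xi>"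
      using dev_mult_le[OF cx(2) cnj_char[OF cx(1)]] by (simp add: dev_cnj)
    finally have "dev J v (\<phi> a) \<le> dev J v (\<phi> b) + 2 * c" using cx by linarith
    then have "4 * c * real a < 4 * c * real b + 4 * c"
      using \<phi>(2)[of a] \<phi>(3)[of b] ab by linarith
    then have "4 * c * real a < 4 * c * (real b + 1)" by (simp add: algebra_simps)
    then have "real a < real b + 1" using assms(1) by simp
    then show False using ab by linarith
  qed
  have "card ({..<m} \<times> near J v c) \<le> card (near J v L)"
  proof (rule card_inj_on_le[of ?h])
    show "inj_on ?h ({..<m} \<times> near J v c)"
    proof (rule inj_onI)
      fix x y assume "x \<in> {..<m} \<times> near J v c" "y \<in> {..<m} \<times> near J v c" "?h x = ?h y"
      then obtain a \<xi> b \<eta> where xy: "x = (a, \<xi>)" "y = (b, \<eta>)" and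
        h: "a \<in> {..<m}" "b \<in> {..<m}" "\<xi> \<in> near J v c" "\<eta> \<in> near J v c" "\<phi> a \<diamondop> \<xi> = \<phi> b \<diamondop> \<eta>"
        by auto
      then have "a = b" using not_less[of a b \<eta> \<xi>] not_less[of b a \<xi> \<eta>] by (metis lessThan_iff linorder_neqE_nat)
      then show "x = y" using h cmul_left_cancel[OF \<phi>(1)] xy by auto
    qed
    show "?h ` ({..<m} \<times> near J v c) \<subseteq> near J v L"
    proof clarsimp
      fix a \<xi> assume a: "a < m" and x: "\<xi> \<in> near J v c"
      have "dev J v (\<phi> a \<diamondop> \<xi>) \<le> (4 * c * real a + 2 * c) + c"
        using dev_mult_le[OF \<phi>(1)[OF a], of \<xi> J v] \<phi>(3)[OF a] x by (auto simp: near_def)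
      also have "\<dots> \<le> 4 * c * (real a + 1)" using assms(1) by (simp add: algebra_simps)
      also have "\<dots> \<le> 4 * c * real m" using a assms(1) by (intro mult_left_mono) auto
      finally show "\<phi> a \<diamondop> \<xi> \<in> near J v L"
        using assms(4) cmul_in[OF \<phi>(1)[OF a]] x by (auto simp: near_def)
    qed
  qed (rule finite_near)
  then show ?thesis by (simp add: card_cartesian_product)
qed

text \<open>If a group of characters stays close to trivial on \<open>v\<close>, averaging over it shows that it is
  exactly trivial on most entries.\<close>

lemma card_nontrivial_entries:
  fixes L :: real
  assumes "finite J" and H: "H \<subseteq> near J v L" "H \<noteq> {}"
    and mult: "\<And>\<xi> \<psi>. \<xi> \<in> H \<Longrightarrow> \<psi> \<in> H \<Longrightarrow> \<xi> \<diamondop> \<psi> \<in> H"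
  shows "2 * card {i \<in> J. \<exists>\<xi>\<in>H. \<xi> (v i) \<noteq> 1} \<le> L\<^sup>2"
proof -
  have Hc: "H \<subseteq> chars" using H(1) by (auto simp: near_def)
  have finH: "finite H" using Hc finite_chars finite_subset by blast
  let ?B = "{i \<in> J. \<exists>\<xi>\<in>H. \<xi> (v i) \<noteq> 1}"
  have "card H * (2 * real (card ?B)) = (\<Sum>i\<in>?B. 2 * real (card H))" by simp
  also have "\<dots> = (\<Sum>i\<in>?B. \<Sum>\<xi>\<in>H. 2 - 2 * Re (\<xi> (v i)))"
  proof (rule sum.cong[OF refl])
    fix i assume "i \<in> ?B"
    then obtain \<psi> where "\<psi> \<in> H" "\<psi> (v i) \<noteq> 1" by blast
    then have "(\<Sum>\<xi>\<in>H. \<xi> (v i)) = 0" using sum_char_subgroup[OF Hc mult] by blast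
    then have "(\<Sum>\<xi>\<in>H. Re (\<xi> (v i))) = 0" by (simp flip: Re_sum)
    then show "2 * real (card H) = (\<Sum>\<xi>\<in>H. 2 - 2 * Re (\<xi> (v i)))"
      by (simp add: sum_subtractf flip: sum_distrib_left)
  qed
  also have "\<dots> \<le> (\<Sum>i\<in>J. \<Sum>\<xi>\<in>H. 2 - 2 * Re (\<xi> (v i)))"
  proof (intro sum_mono2 assms(1) sum_nonneg)
    fix i \<xi> assume "\<xi> \<in> H"
    then have "Re (\<xi> (v i)) \<le> 1" using norm_char[of \<xi> "v i"] complex_Re_le_cmod[of "\<xi> (v i)"] Hc by auto
    then show "0 \<le> 2 - 2 * Re (\<xi> (v i))" by simp
  qed auto
  also have "\<dots> = (\<Sum>\<xi>\<in>H. (dev J v \<xi>)\<^sup>2)"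
    unfolding sum.swap[of _ H J] using Hc by (intro sum.cong refl dev_sq[symmetric]) auto
  also have "\<dots> \<le> (\<Sum>\<xi>\<in>H. L\<^sup>2)"
    using H(1) dev_nonneg by (intro sum_mono power_mono) (auto simp: near_def)
  finally have "card H * (2 * real (card ?B)) \<le> card H * L\<^sup>2" by simp
  then show ?thesis using finH H(2) by (simp add: card_gt_0_iff)
qed

definition annih :: "'i set \<Rightarrow> ('i \<Rightarrow> 'a) \<Rightarrow> ('a \<Rightarrow> complex) set" where
  "annih J v = {\<xi> \<in> chars. \<forall>i\<in>J. \<xi> (v i) = 1}"

text \<open>The first \<^term>\<open>p\<close> powers of a character that is trivial on the smaller index set, but not on
  the larger one, represent different cosets.\<close>

lemma card_annih_psubset:
  assumes "\<xi> \<in> chars" "B \<subseteq> J"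
    and "\<And>i. i \<in> B \<Longrightarrow> \<xi> (v i) = 1" and "i \<in> J" "\<xi> (v i) \<noteq> 1"
  shows "p * card (annih J v) \<le> card (annih B v)"
proof -
  let ?h = "\<lambda>(j, \<psi>). (\<lambda>a. \<xi> a ^ j) \<diamondop> \<psi>"
  have "card ({..<p} \<times> annih J v) \<le> card (annih B v)"
  proof (rule card_inj_on_le[of ?h])
    show "inj_on ?h ({..<p} \<times> annih J v)"
    proof (rule inj_onI)
      fix x y assume "x \<in> {..<p} \<times> annih J v" "y \<in> {..<p} \<times> annih J v" "?h x = ?h y"
      then obtain j \<psi> l \<eta> where xy: "x = (j, \<psi>)" "y = (l, \<eta>)" and
        h: "j \<in> {..<p}" "l \<in> {..<p}" "\<psi> \<in> annih J v" "\<eta> \<in> annih J v"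
          "(\<lambda>a. \<xi> a ^ j) \<diamondop> \<psi> = (\<lambda>a. \<xi> a ^ l) \<diamondop> \<eta>"
        by auto
      have "\<xi> (v i) ^ j = \<xi> (v i) ^ l"
        using fun_cong[OF h(5), of "v i"] h(3,4) assms(4) by (auto simp: annih_def)
      then have "j = l" using prime_root_of_unity_powers_inj[OF char_power_p[OF assms(1)] assms(5)] h(1,2)
        by (auto dest: inj_onD)
      then show "x = y" using h(5) cmul_left_cancel[OF power_char[OF assms(1)]] xy by auto
    qed
    show "?h ` ({..<p} \<times> annih J v) \<subseteq> annih B v"
      using assms(2,3) power_char[OF assms(1)] by (auto simp: annih_def subset_iff intro: cmul_in)
    show "finite (annih B v)" using finite_chars by (simp add: annih_def)
  qed
  then show ?thesis by (simp add: card_cartesian_product)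
qed

text \<open>As long as neither alternative holds, discard the few entries on which the group generated
  by the almost trivial characters is not trivial. The annihilator of the remaining entries is
  larger by a factor of at least \<^term>\<open>p\<close>, so this happens at most \<open>e\<close> times.\<close>

lemma growth_or_annihilation:
  assumes "finite J" "\<And>i. i \<in> J \<Longrightarrow> v i \<notin> P" "card chars \<le> p ^ e * card (annih J v)"
    and "real e * s < card J" "L\<^sup>2 = 2 * s" "L \<ge> 0"
  shows "\<exists>J'\<subseteq>J. J' \<noteq> {} \<and> card J - real e * s \<le> card J' \<and>
     ((\<exists>\<xi>\<in>gen (near J' v c). dev J' v \<xi> > L) \<or> near J' v c \<subseteq> annih J' v)"
  using assms(1-4)
proof (induction e arbitrary: J)
  case 0
  have fin: "finite (annih J v)" by (simp add: annih_def finite_chars)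
  have "annih J v = chars"
    using 0(3) finite_chars by (intro card_seteq) (auto simp: annih_def)
  then show ?case using 0 by (intro exI[of _ J]) (auto simp: near_def)
next
  case (Suc e)
  let ?H = "gen (near J v c)"
  have s0: "s \<ge> 0" using assms(5) by (metis mult_nonneg_nonneg zero_le_mult_iff zero_le_power2 not_numeral_le_zero)
  have Hc: "?H \<subseteq> chars" by (intro gen_subset) (auto simp: near_def)
  show ?case
  proof (cases "(\<exists>\<xi>\<in>?H. dev J v \<xi> > L) \<or> near J v c \<subseteq> annih J v")
    case True
    have "J \<noteq> {}" using Suc.prems(4) s0 by (auto simp: mult_less_0_iff)
    moreover have "card J - real (Suc e) * s \<le> card J" using s0 by simp
    ultimately show ?thesis using True by blast
  next
    case False
    then obtain \<psi> where \<psi>: "\<psi> \<in> near J v c" "\<psi> \<notin> annih J v" by blast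
    then obtain i where i: "i \<in> J" "\<psi> (v i) \<noteq> 1" by (auto simp: annih_def near_def)
    define B where "B = {i \<in> J. \<forall>\<xi>\<in>?H. \<xi> (v i) = 1}"
    have "B \<subseteq> J" and finB: "finite B" using Suc.prems(1) by (auto simp: B_def)
    have HL: "?H \<subseteq> near J v L" using False Hc by (force simp: near_def)
    have "2 * real (card {i \<in> J. \<exists>\<xi>\<in>?H. \<xi> (v i) \<noteq> 1}) \<le> 2 * s"
      using card_nontrivial_entries[OF Suc.prems(1) HL] gen.one gen_mult assms(5) by fastforce
    moreover have "{i \<in> J. \<exists>\<xi>\<in>?H. \<xi> (v i) \<noteq> 1} = J - B" by (auto simp: B_def)
    ultimately have "real (card (J - B)) \<le> s" by simp
    then have cB: "real (card J) - s \<le> card B"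
      using \<open>B \<subseteq> J\<close> finB Suc.prems(1) by (simp add: card_Diff_subset card_mono of_nat_diff)
    have "\<psi> \<in> ?H" using \<psi>(1) subset_gen by blast
    then have "p * card (annih J v) \<le> card (annih B v)"
      using Hc i by (intro card_annih_psubset[OF _ \<open>B \<subseteq> J\<close>]) (auto simp: B_def)
    then have "p ^ e * (p * card (annih J v)) \<le> p ^ e * card (annih B v)" by simp
    moreover have "card chars \<le> p ^ e * (p * card (annih J v))" using Suc.prems(3) by (simp add: mult_ac)
    ultimately have "card chars \<le> p ^ e * card (annih B v)" by (rule le_trans[rotated])
    moreover have "real e * s < card B" using Suc.prems(4) cB by (simp add: algebra_simps)
    ultimately obtain J' where J': "J' \<subseteq> B" "J' \<noteq> {}" "card B - real e * s \<le> card J'"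
        "(\<exists>\<xi>\<in>gen (near J' v c). dev J' v \<xi> > L) \<or> near J' v c \<subseteq> annih J' v"
      using Suc.IH[OF finB] Suc.prems(2) \<open>B \<subseteq> J\<close> by blast
    have "card J - real (Suc e) * s \<le> card J'" using J'(3) cB by (simp add: algebra_simps)
    then show ?thesis using J' \<open>B \<subseteq> J\<close> by blast
  qed
qed

lemma sols_mono: "J' \<subseteq> J \<Longrightarrow> sols J' v k \<subseteq> sols J v k"
  using PiE_mono[of "{..<2 * k}" "\<lambda>_. J' \<times> {-1, 1 :: int}" "\<lambda>_. J \<times> {-1, 1}"]
  unfolding sols_def by blast

text \<open>An inequality of Halasz type. Pass to entries for which one of the two alternatives holds. In
  the first one, the characters very close to trivial are fewer by a factor \<open>m\<close> than those
  counted by the moment estimate; in the second one they form the annihilator of a nonzero subgroup,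
  whose density is at most \<open>1 / p\<close>.\<close>

lemma halasz:
  assumes J: "finite J" "J \<noteq> {}" "\<And>i. i \<in> J \<Longrightarrow> v i \<notin> P"
    and d: "card C \<le> p ^ d"
    and s: "s \<ge> 0" "real d * s \<le> card J / 2" "s \<le> card J / 4"
    and c: "c > 0" "m > 0" "4 * c * real m \<le> sqrt (2 * s)"
  shows "conc J v (16 ^ k * (card (sols J v k) / (2 * card J) ^ (2 * k)) / m + 1 / p + exp (- c\<^sup>2 / 8))"
proof -
  define L where "L = sqrt (2 * s)"
  have L: "L\<^sup>2 = 2 * s" "L \<ge> 0" using s(1) by (auto simp: L_def)
  have cJ: "card J > 0" using J by (simp add: card_gt_0_iff)
  have "annih J v \<noteq> {}" using one_char by (auto simp: annih_def)
  then have "card (annih J v) \<ge> 1" using finite_chars by (simp add: annih_def Suc_le_eq card_gt_0_iff)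
  then have ch: "card chars \<le> p ^ d * card (annih J v)"
    using d unfolding card_chars by (metis le_trans mult.right_neutral mult_le_mono2)
  have "real d * s < card J" using s(2) cJ by linarith
  from growth_or_annihilation[OF J(1,3) ch this L, of "2 * c"] obtain J' where
    J': "J' \<subseteq> J" "J' \<noteq> {}" "card J - real d * s \<le> card J'"
      "(\<exists>\<xi>\<in>gen (near J' v (2 * c)). dev J' v \<xi> > L) \<or> near J' v (2 * c) \<subseteq> annih J' v" by blast
  have finJ': "finite J'" using J' J finite_subset by blast
  have half: "card J \<le> 2 * card J'" using J'(3) s(2) by linarith
  have cJ': "card J' > 0" using half cJ by linarith
  define r where "r = card (sols J v k) / (2 * card J) ^ (2 * k)"
  have r0: "r \<ge> 0" by (simp add: r_def)
  have X: "real (card chars) > 0" using card_chars_pos by simp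
  have "card (near J' v c) / card chars \<le> 16 ^ k * r / m + 1 / p"
    using J'(4)
  proof
    assume "\<exists>\<xi>\<in>gen (near J' v (2 * c)). dev J' v \<xi> > L"
    then have "m * card (near J' v c) \<le> card (near J' v L)"
      using near_growth[OF c(1)] c(3) by (auto simp: L_def)
    then have 1: "real m * card (near J' v c) \<le> card (near J' v L)" by (metis of_nat_le_iff of_nat_mult)
    have "L\<^sup>2 \<le> card J'" using L s(3) half by linarith
    then have "card (near J' v L) * real (card J') ^ (2 * k) \<le> card chars * card (sols J' v k)"
      using card_near_le_sols[OF finJ' L(2)] by blast
    also have "\<dots> \<le> real (card chars) * real (card (sols J v k))"
      using card_mono[OF finite_sols[OF J(1), of v k] sols_mono[OF J'(1), of v k]] by (simp add: mult_left_mono)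
    also have "real (card (sols J v k)) = r * (2 * real (card J)) ^ (2 * k)"
      using cJ by (simp add: r_def)
    also have "real (card chars) * \<dots> \<le> card chars * (r * (2 * (2 * real (card J'))) ^ (2 * k))"
      using half r0 by (intro mult_left_mono power_mono) auto
    also have "(2 * (2 * real (card J'))) ^ (2 * k) = 16 ^ k * real (card J') ^ (2 * k)"
      by (simp add: power_mult power_mult_distrib)
    finally have "card (near J' v L) * real (card J') ^ (2 * k) \<le> (card chars * (16 ^ k * r)) * real (card J') ^ (2 * k)"
      by (simp add: mult_ac)
    then have "real (card (near J' v L)) \<le> card chars * (16 ^ k * r)" using cJ' by simp
    with 1 have "real m * card (near J' v c) \<le> card chars * (16 ^ k * r)" by linarith
    then have "card (near J' v c) / card chars \<le> 16 ^ k * r / m"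
      using X c(2) by (simp add: field_simps)
    moreover have "(0 :: real) \<le> 1 / p" by simp
    ultimately show ?thesis by linarith
  next
    assume sub: "near J' v (2 * c) \<subseteq> annih J' v"
    have "near J' v c \<subseteq> annih J' v" using sub c(1) by (auto simp: near_def)
    then have 1: "card (near J' v c) \<le> card (annih J' v)"
      using finite_chars by (intro card_mono) (auto simp: annih_def)
    obtain i where i: "i \<in> J'" using J' by blast
    have "v i \<notin> P" using J(3) i J'(1) by blast
    from exists_nontrivial_char[OF this] obtain \<xi> where \<xi>: "\<xi> \<in> chars" "\<xi> (v i) \<noteq> 1" by blast
    have "p * card (annih J' v) \<le> card (annih {} v)"
      using \<xi> i by (intro card_annih_psubset[of \<xi> "{}" J' v i]) auto
    also have "annih {} v = chars" by (simp add: annih_def)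
    finally have "p * card (near J' v c) \<le> card chars" using 1 by (meson le_trans mult_le_mono2)
    then have "real p * card (near J' v c) \<le> card chars" by (metis of_nat_le_iff of_nat_mult)
    then have "card (near J' v c) / card chars \<le> 1 / p" using X p_odd by (simp add: field_simps)
    moreover have "0 \<le> 16 ^ k * r / m" using r0 by simp
    ultimately show ?thesis by linarith
  qed
  then have "conc J' v (16 ^ k * r / m + 1 / p + exp (- c\<^sup>2 / 8))"
    using c(1) by (intro conc_mono_bound[OF conc_near[OF finJ', of c]]) auto
  then show ?thesis using conc_superset[OF J(1) J'(1)] by (simp add: r_def)
qed

end

section \<open>Counting vectors with many additive relations\<close>

lemma restrict_in_PiE: "v \<in> PiE I (\<lambda>_. A) \<Longrightarrow> S \<subseteq> I \<Longrightarrow> restrict v S \<in> PiE S (\<lambda>_. A)"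
  by (rule restrict_PiE_iff[THEN iffD2]) (auto simp: PiE_iff)

lemma surjection_from_initial_segment:
  assumes "finite S" "S \<noteq> {}" "card S \<le> s"
  obtains f where "f \<in> PiE {..<s} (\<lambda>_. S)" "f ` {..<s} = S"
proof -
  obtain g where g: "bij_betw g {..<card S} S"
    using assms(1) by (metis atLeast0LessThan ex_bij_betw_nat_finite)
  obtain x where x: "x \<in> S" using assms(2) by blast
  define f where "f = restrict (\<lambda>j. if j < card S then g j else x) {..<s}"
  have "g j \<in> S" if "j < card S" for j using bij_betwE[OF g] that by auto
  then have f: "f \<in> PiE {..<s} (\<lambda>_. S)" using x by (auto simp: f_def)
  moreover have "S \<subseteq> f ` {..<s}"
  proof
    fix y assume "y \<in> S"
    then obtain j where "j < card S" "y = g j" using g by (auto simp: bij_betw_def)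
    then show "y \<in> f ` {..<s}" using assms(3) by (intro image_eqI[of _ _ j]) (auto simp: f_def)
  qed
  ultimately show ?thesis using that by blast
qed

lemma card_nonempty_small_subsets:
  assumes "finite N"
  shows "card {S. S \<subseteq> N \<and> S \<noteq> {} \<and> card S \<le> s} \<le> card N ^ s"
proof -
  have "{S. S \<subseteq> N \<and> S \<noteq> {} \<and> card S \<le> s} \<subseteq> (\<lambda>f. f ` {..<s}) ` PiE {..<s} (\<lambda>_. N)"
  proof clarify
    fix S assume S: "S \<subseteq> N" "S \<noteq> {}" "card S \<le> s"
    then obtain f where "f \<in> PiE {..<s} (\<lambda>_. S)" "f ` {..<s} = S"
      using surjection_from_initial_segment assms finite_subset by metis
    then show "S \<in> (\<lambda>f. f ` {..<s}) ` PiE {..<s} (\<lambda>_. N)"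
      using PiE_mono[of "{..<s}" "\<lambda>_. S" "\<lambda>_. N"] S(1) by (metis image_eqI subsetD)
  qed
  then have "card {S. S \<subseteq> N \<and> S \<noteq> {} \<and> card S \<le> s} \<le> card (PiE {..<s} (\<lambda>_. N))"
    using assms by (meson card_image_le card_mono finite_PiE finite_imageI finite_lessThan le_trans)
  then show ?thesis by (simp add: card_PiE)
qed

definition signed_tuples :: "'i set \<Rightarrow> nat \<Rightarrow> (nat \<Rightarrow> 'i \<times> int) set" where
  "signed_tuples J k = PiE {..<2 * k} (\<lambda>_. J \<times> {-1, 1})"

lemma finite_signed_tuples: "finite J \<Longrightarrow> finite (signed_tuples J k)"
  unfolding signed_tuples_def by (intro finite_PiE) auto

lemma card_signed_tuples: "finite J \<Longrightarrow> card (signed_tuples J k) = (2 * card J) ^ (2 * k)"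
proof -
  assume "finite J"
  moreover have "card {-1, 1 :: int} = 2" by simp
  then have "card (J \<times> {-1, 1 :: int}) = 2 * card J"
    by (simp only: card_cartesian_product mult.commute)
  ultimately show ?thesis by (simp only: signed_tuples_def card_PiE finite_lessThan prod_constant card_lessThan)
qed

lemma signed_tuplesD:
  assumes "F \<in> signed_tuples J k" "j < 2 * k"
  shows "fst (F j) \<in> J" "snd (F j) = -1 \<or> snd (F j) = 1"
  using assms by (force simp: signed_tuples_def PiE_iff)+

text \<open>The coefficient with which the entry of index \<open>l\<close> occurs in the signed sum encoded by \<open>F\<close>.\<close>

definition net_coeff :: "nat \<Rightarrow> (nat \<Rightarrow> 'i \<times> int) \<Rightarrow> 'i \<Rightarrow> int" where
  "net_coeff k F l = (\<Sum>j\<in>{j\<in>{..<2 * k}. fst (F j) = l}. snd (F j))"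

lemma net_coeff_nonzero_in:
  assumes "F \<in> signed_tuples J k" "net_coeff k F l \<noteq> 0" shows "l \<in> J"
proof -
  have "{j\<in>{..<2 * k}. fst (F j) = l} \<noteq> {}"
    using assms(2) unfolding net_coeff_def by (metis sum.empty)
  then show ?thesis using signed_tuplesD[OF assms(1)] by auto
qed

lemma abs_net_coeff_le:
  assumes "F \<in> signed_tuples J k" shows "\<bar>net_coeff k F l\<bar> \<le> 2 * int k"
proof -
  have "\<bar>net_coeff k F l\<bar> \<le> (\<Sum>j\<in>{j\<in>{..<2 * k}. fst (F j) = l}. \<bar>snd (F j)\<bar>)"
    unfolding net_coeff_def by (rule sum_abs)
  also have "\<dots> \<le> (\<Sum>j\<in>{j\<in>{..<2 * k}. fst (F j) = l}. 1)"
  proof (rule sum_mono)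
    fix j assume "j \<in> {j\<in>{..<2 * k}. fst (F j) = l}"
    then show "\<bar>snd (F j)\<bar> \<le> 1" using signed_tuplesD(2)[OF assms, of j] by auto
  qed
  also have "\<dots> \<le> (\<Sum>j<2 * k. 1)" by (intro sum_mono2) auto
  finally show ?thesis by simp
qed

text \<open>In a relation that cancels formally every index occurs at least twice, so it is determined by
  \<open>k\<close> indices, a pattern and the signs.\<close>

lemma card_cancelling_tuples:
  assumes "finite J" "J \<noteq> {}"
  shows "card {F \<in> signed_tuples J k. \<forall>l. net_coeff k F l = 0} \<le> card J ^ k * k ^ (2 * k) * 2 ^ (2 * k)"
proof -
  let ?D = "PiE {..<k} (\<lambda>_. J) \<times> PiE {..<2 * k} (\<lambda>_. {..<k}) \<times> PiE {..<2 * k} (\<lambda>_. {-1, 1 :: int})"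
  let ?\<phi> = "\<lambda>(g, h, e). restrict (\<lambda>j. (g (h j), e j)) {..<2 * k}"
  have finD: "finite ?D" using assms(1) by (intro finite_cartesian_product finite_PiE) auto
  have "{F \<in> signed_tuples J k. \<forall>l. net_coeff k F l = 0} \<subseteq> ?\<phi> ` ?D"
  proof clarify
    fix F assume F: "F \<in> signed_tuples J k" and cancel: "\<forall>l. net_coeff k F l = 0"
    define V where "V = (\<lambda>j. fst (F j)) ` {..<2 * k}"
    define fib where "fib l = {j\<in>{..<2 * k}. fst (F j) = l}" for l
    have VJ: "V \<subseteq> J" "finite V" using signed_tuplesD[OF F] by (auto simp: V_def)
    have fib2: "2 \<le> card (fib l)" if l: "l \<in> V" for l
    proof (rule ccontr)
      assume "\<not> 2 \<le> card (fib l)"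
      moreover have "card (fib l) \<noteq> 0" using l by (auto simp: fib_def V_def)
      ultimately have "card (fib l) = 1" by linarith
      then obtain j where j: "fib l = {j}" by (auto simp: card_1_singleton_iff)
      have "net_coeff k F l = (\<Sum>j\<in>fib l. snd (F j))" by (simp only: net_coeff_def fib_def)
      then have "net_coeff k F l = snd (F j)" by (simp add: j)
      moreover have "j < 2 * k" using j by (auto simp: fib_def)
      ultimately show False using cancel signed_tuplesD[OF F, of j] by auto
    qed
    have "2 * card V = (\<Sum>l\<in>V. 2)" by simp
    also have "\<dots> \<le> (\<Sum>l\<in>V. card (fib l))" using fib2 by (rule sum_mono)
    also have "\<dots> = card (\<Union>l\<in>V. fib l)"
      using VJ by (intro card_UN_disjoint[symmetric]) (auto simp: fib_def)
    also have "\<dots> \<le> card {..<2 * k}" by (intro card_mono) (auto simp: fib_def)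
    finally have cV: "card V \<le> k" by simp
    obtain g where g: "g \<in> PiE {..<k} (\<lambda>_. J)" "V \<subseteq> g ` {..<k}"
    proof (cases "V = {}")
      case True
      obtain x where "x \<in> J" using assms(2) by blast
      then show ?thesis using that[of "restrict (\<lambda>_. x) {..<k}"] True by auto
    next
      case False
      then obtain f where "f \<in> PiE {..<k} (\<lambda>_. V)" "f ` {..<k} = V"
        using surjection_from_initial_segment VJ cV by metis
      then show ?thesis using that[of f] VJ(1) by (auto simp: PiE_iff)
    qed
    have "\<forall>j\<in>{..<2 * k}. \<exists>i<k. g i = fst (F j)" using g(2) by (force simp: V_def)
    then obtain h where h: "\<And>j. j < 2 * k \<Longrightarrow> h j < k \<and> g (h j) = fst (F j)" by (metis lessThan_iff)
    show "F \<in> ?\<phi> ` ?D"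
    proof (rule image_eqI[of _ _ "(g, restrict h {..<2 * k}, restrict (\<lambda>j. snd (F j)) {..<2 * k})"])
      show "F = ?\<phi> (g, restrict h {..<2 * k}, restrict (\<lambda>j. snd (F j)) {..<2 * k})"
        using F h by (auto simp: signed_tuples_def fun_eq_iff PiE_iff extensional_def)
      show "(g, restrict h {..<2 * k}, restrict (\<lambda>j. snd (F j)) {..<2 * k}) \<in> ?D"
        using g(1) h signed_tuplesD[OF F] by auto
    qed
  qed
  then have "card {F \<in> signed_tuples J k. \<forall>l. net_coeff k F l = 0} \<le> card ?D"
    using finD by (meson card_image_le card_mono finite_imageI le_trans)
  also have "\<dots> = card J ^ k * k ^ (2 * k) * 2 ^ (2 * k)"
  proof -
    have "card {-1, 1 :: int} = 2" by simp
    then show ?thesis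
      by (simp only: card_cartesian_product card_PiE finite_lessThan prod_constant card_lessThan mult.assoc)
  qed
  finally show ?thesis .
qed

context finite_residue_field
begin

definition relations :: "'i set \<Rightarrow> ('i \<Rightarrow> 'a) \<Rightarrow> nat \<Rightarrow> (nat \<Rightarrow> 'i \<times> int) set" where
  "relations J v k = {F \<in> sols J v k. \<exists>l. net_coeff k F l \<noteq> 0}"

definition rel_density :: "'i set \<Rightarrow> ('i \<Rightarrow> 'a) \<Rightarrow> nat \<Rightarrow> real" where
  "rel_density J v k = card (relations J v k) / (2 * card J) ^ (2 * k)"

lemma sols_subset: "sols J v k \<subseteq> signed_tuples J k"
  by (auto simp: sols_def signed_tuples_def)

lemma relations_subset: "relations J v k \<subseteq> signed_tuples J k"
  using sols_subset[of J v k] by (auto simp: relations_def)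

lemma relations_cong:
  assumes "\<And>i. i \<in> J \<Longrightarrow> v i = w i" shows "relations J v k = relations J w k"
proof -
  have "(\<Sum>j<2 * k. of_int (snd (F j)) * v (fst (F j))) = (\<Sum>j<2 * k. of_int (snd (F j)) * w (fst (F j)))"
    if "F \<in> PiE {..<2 * k} (\<lambda>_. J \<times> {-1, 1})" for F
    using that assms by (intro sum.cong refl) (force simp: PiE_iff)
  then show ?thesis unfolding relations_def sols_def by (auto cong: conj_cong)
qed

lemma rel_density_cong: "(\<And>i. i \<in> J \<Longrightarrow> v i = w i) \<Longrightarrow> rel_density J v k = rel_density J w k"
  using relations_cong[of J v w k] by (simp add: rel_density_def)

lemma rel_density_nonneg: "rel_density J v k \<ge> 0"
  by (simp add: rel_density_def)

lemma rel_density_le_1: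
  assumes "finite J" "J \<noteq> {}" shows "rel_density J v k \<le> 1"
proof -
  have "card (relations J v k) \<le> (2 * card J) ^ (2 * k)"
    using card_mono[OF finite_signed_tuples[OF assms(1)] relations_subset[of J v k]]
    by (simp add: card_signed_tuples assms(1))
  then have "real (card (relations J v k)) \<le> real ((2 * card J) ^ (2 * k))" by (simp only: of_nat_le_iff)
  then show ?thesis using assms by (simp add: rel_density_def card_gt_0_iff divide_le_eq)
qed

text \<open>Formally cancelling tuples are solutions for every vector; they are excluded from
  \<^const>\<open>relations\<close> because they say nothing about the entries, and they are rare.\<close>

lemma sols_density_le:
  assumes "finite J" "J \<noteq> {}"
  shows "card (sols J v k) / (2 * card J) ^ (2 * k) \<le> rel_density J v k + k ^ (2 * k) / card J ^ k"
proof -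
  let ?T = "{F \<in> signed_tuples J k. \<forall>l. net_coeff k F l = 0}"
  have J: "real (card J) > 0" using assms by (simp add: card_gt_0_iff)
  have "sols J v k \<subseteq> relations J v k \<union> ?T" using sols_subset[of J v k] by (auto simp: relations_def)
  then have "card (sols J v k) \<le> card (relations J v k \<union> ?T)"
    using finite_signed_tuples[OF assms(1)] relations_subset[of J v k]
    by (intro card_mono finite_UnI) (auto intro: finite_subset)
  also have "\<dots> \<le> card (relations J v k) + card ?T" by (rule card_Un_le)
  also have "card ?T \<le> card J ^ k * k ^ (2 * k) * 2 ^ (2 * k)"
    by (rule card_cancelling_tuples[OF assms])
  finally have "real (card (sols J v k)) \<le> real (card (relations J v k) + card J ^ k * k ^ (2 * k) * 2 ^ (2 * k))"
    by (simp only: of_nat_le_iff add_le_cancel_left)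
  then have "card (sols J v k) / (2 * card J) ^ (2 * k)
      \<le> rel_density J v k + real (card J) ^ k * real k ^ (2 * k) * 2 ^ (2 * k) / (2 * card J) ^ (2 * k)"
    using J by (simp add: rel_density_def divide_simps)
  also have "real (card J) ^ k * real k ^ (2 * k) * 2 ^ (2 * k) / (2 * card J) ^ (2 * k)
      = k ^ (2 * k) / card J ^ k"
  proof -
    have "real (card J) ^ (2 * k) = real (card J) ^ k * real (card J) ^ k"
      by (simp add: mult_2 power_add)
    then show ?thesis using J by (simp add: power_mult_distrib field_simps)
  qed
  finally show ?thesis by simp
qed

text \<open>The minimum over all large index sets serves two opposite purposes: the concentration can be
  estimated on the set where it is attained, and it bounds the density of relations from below on
  every set that occurs while entries are removed.\<close>

definition min_density :: "nat \<Rightarrow> nat \<Rightarrow> 'i set \<Rightarrow> ('i \<Rightarrow> 'a) \<Rightarrow> real" where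
  "min_density k s I v = Min ((\<lambda>J. rel_density J v k) ` {J. J \<subseteq> I \<and> s \<le> card J})"

lemma min_density_finite: "finite I \<Longrightarrow> finite ((\<lambda>J. rel_density J v k) ` {J. J \<subseteq> I \<and> s \<le> card J})"
  by (intro finite_imageI) (auto intro: finite_subset[of _ "Pow I"])

lemma min_density_le:
  "finite I \<Longrightarrow> J \<subseteq> I \<Longrightarrow> s \<le> card J \<Longrightarrow> min_density k s I v \<le> rel_density J v k"
  unfolding min_density_def using min_density_finite by (intro Min_le) auto

lemma min_density_attained:
  assumes "finite I" "s \<le> card I"
  obtains J where "J \<subseteq> I" "s \<le> card J" "min_density k s I v = rel_density J v k"
proof -
  have "min_density k s I v \<in> (\<lambda>J. rel_density J v k) ` {J. J \<subseteq> I \<and> s \<le> card J}"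
    unfolding min_density_def using assms by (intro Min_in min_density_finite) auto
  then show ?thesis using that by blast
qed

lemma min_density_nonneg: "finite I \<Longrightarrow> s \<le> card I \<Longrightarrow> min_density k s I v \<ge> 0"
  by (metis min_density_attained rel_density_nonneg)

lemma min_density_antimono:
  assumes "finite I" "I' \<subseteq> I" "s \<le> card I'"
  shows "min_density k s I v \<le> min_density k s I' v"
proof -
  obtain J where J: "J \<subseteq> I'" "s \<le> card J" "min_density k s I' v = rel_density J v k"
    using min_density_attained finite_subset[OF assms(2,1)] assms(3) by metis
  then show ?thesis using min_density_le[OF assms(1), of J s k v] assms(2) by auto
qed

lemma min_density_cong:
  assumes "\<And>i. i \<in> I \<Longrightarrow> v i = w i" shows "min_density k s I v = min_density k s I w"
proof -
  have "(\<lambda>J. rel_density J v k) ` {J. J \<subseteq> I \<and> s \<le> card J} = (\<lambda>J. rel_density J w k) ` {J. J \<subseteq> I \<and> s \<le> card J}"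
    using assms by (intro image_cong refl rel_density_cong) blast
  then show ?thesis by (simp add: min_density_def)
qed

text \<open>Subtracting the two relations leaves \<open>v l - w l\<close>, multiplied by the net coefficient, which is
  nonzero and at most \<open>2 * k\<close> in absolute value, hence invertible modulo \<^term>\<open>p\<close>.\<close>

lemma relation_determines_entry:
  assumes "2 * k < p" "F \<in> relations I v k" "F \<in> relations I w k" "net_coeff k F l \<noteq> 0"
    and "\<And>i. i \<in> I - {l} \<Longrightarrow> v i = w i"
  shows "v l - w l \<in> P"
proof -
  have F: "F \<in> signed_tuples I k" using assms(2) relations_subset[of I v k] by blast
  have "(\<Sum>j<2 * k. of_int (snd (F j)) * v (fst (F j))) - (\<Sum>j<2 * k. of_int (snd (F j)) * w (fst (F j))) \<in> P"
    using assms(2,3) by (intro diff_in) (auto simp: relations_def sols_def)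
  also have "(\<Sum>j<2 * k. of_int (snd (F j)) * v (fst (F j))) - (\<Sum>j<2 * k. of_int (snd (F j)) * w (fst (F j)))
      = (\<Sum>j<2 * k. if fst (F j) = l then of_int (snd (F j)) * (v l - w l) else 0)"
    unfolding sum_subtractf[symmetric]
  proof (rule sum.cong[OF refl])
    fix j assume "j \<in> {..<2 * k}"
    then have "fst (F j) \<in> I" using signed_tuplesD[OF F] by simp
    then show "of_int (snd (F j)) * v (fst (F j)) - of_int (snd (F j)) * w (fst (F j))
        = (if fst (F j) = l then of_int (snd (F j)) * (v l - w l) else 0)"
      using assms(5)[of "fst (F j)"] by (auto simp: algebra_simps)
  qed
  also have "\<dots> = of_int (net_coeff k F l) * (v l - w l)"
    by (simp add: net_coeff_def sum.If_cases Int_def sum_distrib_right)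
  finally have "of_int (net_coeff k F l) * (v l - w l) \<in> P" .
  moreover have "(of_int (net_coeff k F l) :: 'a) \<notin> P"
  proof
    assume "(of_int (net_coeff k F l) :: 'a) \<in> P"
    then have "int p dvd \<bar>net_coeff k F l\<bar>" by (simp add: of_int_in_iff)
    then have "int p \<le> \<bar>net_coeff k F l\<bar>" using assms(4) by (intro zdvd_imp_le) auto
    then show False using abs_net_coeff_le[OF F, of l] assms(1) by linarith
  qed
  ultimately show ?thesis using prime_ideal by blast
qed

text \<open>Remove one entry at a time: a relation makes an entry redundant, and a factor
  \<^const>\<open>min_density\<close> pays for the choice of the relation, so that the sum does not increase with
  \<open>t\<close>. The choice of the removed entry costs nothing, because the relation determines it.\<close>

lemma sum_min_density_le:
  assumes "finite I" "2 * k < p" "card I = s + t"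
  shows "(\<Sum>v\<in>PiE I (\<lambda>_. C). min_density k s I v ^ t) \<le> real (card C) ^ s"
  using assms(1,3)
proof (induction t arbitrary: I)
  case 0
  then show ?case by (simp add: card_PiE)
next
  case (Suc t)
  let ?V = "PiE I (\<lambda>_. C)"
  have finV: "finite ?V" using Suc fin_C by (intro finite_PiE) auto
  have cI: "card I > 0" using Suc by simp
  have each: "(\<Sum>v\<in>{v\<in>?V. F \<in> relations I v k}. min_density k s I v ^ t) \<le> real (card C) ^ s"
    if F: "F \<in> signed_tuples I k" for F
  proof (cases "\<exists>l. net_coeff k F l \<noteq> 0")
    case False
    then have empty: "{v\<in>?V. F \<in> relations I v k} = {}" by (auto simp: relations_def)
    show ?thesis unfolding empty by simp
  next
    case True
    then obtain l where l: "net_coeff k F l \<noteq> 0" by blast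
    have lI: "l \<in> I" using net_coeff_nonzero_in[OF F l] .
    let ?W = "{v\<in>?V. F \<in> relations I v k}" and ?r = "\<lambda>v. restrict v (I - {l})"
    have card': "card (I - {l}) = s + t" using lI Suc by simp
    have inj: "inj_on ?r ?W"
    proof (rule inj_onI)
      fix v w assume vw: "v \<in> ?W" "w \<in> ?W" "?r v = ?r w"
      have off: "v i = w i" if "i \<in> I - {l}" for i
        using fun_cong[OF vw(3), of i] that by simp
      have "v l - w l \<in> P"
        using relation_determines_entry[of k F I v w l, OF assms(2) _ _ l off] vw by simp
      then have "v l = w l" using vw lI by (intro rep_unique) (auto simp: PiE_iff)
      then have "v i = w i" if "i \<in> I" for i using off that by (cases "i = l") auto
      then show "v = w" using vw by (intro PiE_ext[of v I "\<lambda>_. C" w]) auto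
    qed
    have "(\<Sum>v\<in>?W. min_density k s I v ^ t) \<le> (\<Sum>v\<in>?W. min_density k s (I - {l}) (?r v) ^ t)"
    proof (intro sum_mono power_mono)
      fix v assume "v \<in> ?W"
      have "min_density k s I v \<le> min_density k s (I - {l}) v"
        using Suc.prems(1) card' by (intro min_density_antimono) auto
      also have "\<dots> = min_density k s (I - {l}) (?r v)" by (rule min_density_cong) simp
      finally show "min_density k s I v \<le> min_density k s (I - {l}) (?r v)" .
      show "0 \<le> min_density k s I v" using Suc.prems by (intro min_density_nonneg) auto
    qed
    also have "\<dots> = (\<Sum>v\<in>?r ` ?W. min_density k s (I - {l}) v ^ t)"
      using inj by (simp add: sum.reindex)
    also have "\<dots> \<le> (\<Sum>v\<in>PiE (I - {l}) (\<lambda>_. C). min_density k s (I - {l}) v ^ t)"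
    proof (intro sum_mono2)
      show "finite (PiE (I - {l}) (\<lambda>_. C))" using Suc.prems(1) fin_C by (intro finite_PiE) auto
      show "?r ` ?W \<subseteq> PiE (I - {l}) (\<lambda>_. C)"
        by (intro image_subsetI restrict_in_PiE[of _ I]) auto
      show "0 \<le> min_density k s (I - {l}) v ^ t" for v
        using Suc.prems(1) card' by (intro zero_le_power min_density_nonneg) auto
    qed
    also have "\<dots> \<le> real (card C) ^ s" using Suc.IH[of "I - {l}"] Suc.prems(1) card' by simp
    finally show ?thesis .
  qed
  have "(\<Sum>v\<in>?V. min_density k s I v ^ Suc t)
      \<le> (\<Sum>v\<in>?V. rel_density I v k * min_density k s I v ^ t)"
    using Suc.prems
    by (intro sum_mono) (auto intro!: mult_right_mono min_density_le zero_le_power min_density_nonneg)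
  also have "\<dots> = (\<Sum>v\<in>?V. \<Sum>F\<in>signed_tuples I k. if F \<in> relations I v k then min_density k s I v ^ t else 0)
      / (2 * card I) ^ (2 * k)"
  proof -
    have "rel_density I v k * min_density k s I v ^ t
        = (\<Sum>F\<in>signed_tuples I k. if F \<in> relations I v k then min_density k s I v ^ t else 0) / (2 * card I) ^ (2 * k)" for v
    proof -
      have "signed_tuples I k \<inter> {F. F \<in> relations I v k} = relations I v k"
        using relations_subset[of I v k] by blast
      then show ?thesis using finite_signed_tuples[OF Suc.prems(1)]
        by (simp add: rel_density_def sum.If_cases)
    qed
    then show ?thesis by (simp add: sum_divide_distrib)
  qed
  also have "\<dots> = (\<Sum>F\<in>signed_tuples I k. \<Sum>v\<in>{v\<in>?V. F \<in> relations I v k}. min_density k s I v ^ t)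
      / (2 * card I) ^ (2 * k)"
    using finV by (subst sum.swap) (simp add: sum.inter_filter)
  also have "\<dots> \<le> (\<Sum>F\<in>signed_tuples I k. real (card C) ^ s) / (2 * card I) ^ (2 * k)"
    using each by (intro divide_right_mono sum_mono) auto
  also have "\<dots> = real (card C) ^ s"
    using cI Suc.prems(1) by (auto simp: card_signed_tuples)
  finally show ?case .
qed

definition bad_vectors :: "'i set \<Rightarrow> real \<Rightarrow> ('i \<Rightarrow> 'a) set" where
  "bad_vectors N \<rho> = {w \<in> PiE N (\<lambda>_. C). (\<exists>i\<in>N. w i \<notin> P) \<and> \<not> conc N w \<rho>}"

text \<open>The entropy of the vectors with concentration above the threshold \<open>\<rho>\<close> is too small to
  compensate for the probability that one of them is orthogonal to \<open>M\<close> independent rows. Vectors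
  of large support are treated by the weighted count, where the gain of order \<open>1 / m\<close> in each row
  has to beat the \<open>2 ^ card N\<close> choices of the support; those of small support are few.\<close>

lemma bad_vectors_sum:
  fixes N :: "'i set" and \<rho> \<sigma> c :: real
  defines "Bad \<equiv> bad_vectors N \<rho>"
  assumes N: "finite N" "card N \<le> Suc M" and s: "s \<ge> 1" and k: "2 * k < p" and d: "card C \<le> p ^ d"
    and \<sigma>: "\<sigma> \<ge> 0" "real d * \<sigma> \<le> s / 2" "\<sigma> \<le> s / 4"
    and c: "c > 0" "m > 0" "4 * c * real m \<le> sqrt (2 * \<sigma>)"
    and \<rho>: "16 ^ k * (k ^ (2 * k) / s ^ k) / m + 1 / p + exp (- c\<^sup>2 / 8) \<le> \<rho> / 2"
  obtains \<beta> where "\<And>w. w \<in> Bad \<Longrightarrow> \<beta> w \<ge> 0" "\<And>w. w \<in> Bad \<Longrightarrow> conc N w (\<beta> w)"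
    "(\<Sum>w\<in>Bad. \<beta> w ^ M) \<le> 2 ^ card N * (2 * 16 ^ k / m) ^ M * real (card C) ^ s
        + card N ^ s * real (card C) ^ s * (1 / 2) ^ M"
proof -
  note Bad_def = Bad_def[unfolded bad_vectors_def]
  define supp where "supp w = {i \<in> N. w i \<notin> P}" for w :: "'i \<Rightarrow> 'a"
  define A where "A = 2 * 16 ^ k / real m"
  define \<beta> where "\<beta> w = (if s \<le> card (supp w) then A * min_density k s (supp w) w else 1 / 2)" for w :: "'i \<Rightarrow> 'a"
  define \<delta> where "\<delta> = 16 ^ k * (k ^ (2 * k) / s ^ k) / m + 1 / p + exp (- c\<^sup>2 / 8)"
  have \<delta>\<rho>: "\<delta> \<le> \<rho> / 2" using \<rho> by (simp add: \<delta>_def)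
  have A0: "A \<ge> 0" by (simp add: A_def)
  have supp: "supp w \<subseteq> N" "finite (supp w)" for w using N(1) by (auto simp: supp_def)
  have "finite (PiE N (\<lambda>_. C))" using N(1) fin_C by (intro finite_PiE) auto
  then have finBad: "finite Bad" unfolding Bad_def by simp
  have "conc N w (\<beta> w)" if w: "w \<in> Bad" for w
  proof (cases "s \<le> card (supp w)")
    case False
    then show ?thesis using w N(1) conc_half by (auto simp: \<beta>_def Bad_def)
  next
    case True
    obtain J where J: "J \<subseteq> supp w" "s \<le> card J" "min_density k s (supp w) w = rel_density J w k"
      using min_density_attained[OF supp(2) True] by blast
    have Jf: "finite J" "J \<noteq> {}" using J s supp(2) finite_subset by (blast, auto)
    have base: "conc J w (16 ^ k * (card (sols J w k) / (2 * card J) ^ (2 * k)) / m + 1 / p + exp (- c\<^sup>2 / 8))"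
      using J Jf d \<sigma> c by (intro halasz) (auto simp: supp_def)
    have "card (sols J w k) / (2 * card J) ^ (2 * k) \<le> rel_density J w k + k ^ (2 * k) / s ^ k"
    proof -
      have "real (k ^ (2 * k)) / real (card J) ^ k \<le> real (k ^ (2 * k)) / real s ^ k"
      proof (intro divide_left_mono)
        show "real s ^ k \<le> real (card J) ^ k" using J(2) by (intro power_mono) auto
        have "real s > 0" "real (card J) > 0" using J(2) s by auto
        then show "0 < real (card J) ^ k * real s ^ k" by simp
      qed simp
      then have "rel_density J w k + real k ^ (2 * k) / real (card J ^ k) \<le> rel_density J w k + k ^ (2 * k) / s ^ k"
        by simp
      with sols_density_le[OF Jf, of w k] show ?thesis by (rule order_trans)
    qed
    then have "16 ^ k * (card (sols J w k) / (2 * card J) ^ (2 * k)) / m + 1 / p + exp (- c\<^sup>2 / 8)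
        \<le> 16 ^ k * (rel_density J w k + k ^ (2 * k) / s ^ k) / m + 1 / p + exp (- c\<^sup>2 / 8)"
      by (intro add_right_mono divide_right_mono mult_left_mono) auto
    also have "\<dots> = A / 2 * rel_density J w k + \<delta>"
      by (simp add: A_def \<delta>_def algebra_simps add_divide_distrib)
    finally have "conc J w (A / 2 * rel_density J w k + \<delta>)" by (rule conc_mono_bound[OF base])
    then have conc1: "conc N w (A / 2 * rel_density J w k + \<delta>)"
      using conc_superset N(1) J(1) supp(1) by (meson subset_trans)
    then have "\<not> A / 2 * rel_density J w k + \<delta> \<le> \<rho>"
      using w conc_mono_bound by (auto simp: Bad_def)
    then have "A / 2 * rel_density J w k + \<delta> \<le> A * rel_density J w k"
      using \<delta>\<rho> by (simp add: field_simps)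
    then show ?thesis using conc_mono_bound[OF conc1] True J(3) by (simp add: \<beta>_def)
  qed
  moreover have "\<beta> w \<ge> 0" for w
    using A0 min_density_nonneg[OF supp(2)] by (simp add: \<beta>_def)
  moreover have "(\<Sum>w\<in>Bad. \<beta> w ^ M) \<le> 2 ^ card N * A ^ M * real (card C) ^ s
        + card N ^ s * real (card C) ^ s * (1 / 2) ^ M"
  proof -
    let ?h = "\<lambda>w. (supp w, restrict w (supp w))"
    have injh: "inj_on ?h Bad"
    proof (rule inj_onI)
      fix v w assume vw: "v \<in> Bad" "w \<in> Bad" "?h v = ?h w"
      have "v i = w i" if i: "i \<in> N" for i
      proof (cases "i \<in> supp v")
        case True
        then show ?thesis using vw(3) by (auto dest: fun_cong[of _ _ i])
      next
        case False
        then have "v i - w i \<in> P" using vw(3) i by (intro diff_in) (auto simp: supp_def)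
        then show ?thesis using vw i by (intro rep_unique) (auto simp: Bad_def PiE_iff)
      qed
      then show "v = w" using vw by (intro PiE_ext[of v N "\<lambda>_. C" w]) (auto simp: Bad_def)
    qed
    let ?D = "{w \<in> Bad. s \<le> card (supp w)}" and ?L = "{w \<in> Bad. \<not> s \<le> card (supp w)}"
    let ?PD = "{S. S \<subseteq> N \<and> s \<le> card S}" and ?PL = "{S. S \<subseteq> N \<and> S \<noteq> {} \<and> card S \<le> s}"
    have finP: "finite ?PD" "finite ?PL" using N(1) by (auto intro: finite_subset[of _ "Pow N"])
    have finS: "finite S" if "S \<subseteq> N" for S using that N(1) finite_subset by blast
    have "(\<Sum>w\<in>?D. \<beta> w ^ M) \<le> (\<Sum>w\<in>?D. A ^ M * min_density k s (supp w) (restrict w (supp w)) ^ (card (supp w) - s))"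
    proof (rule sum_mono)
      fix w assume w: "w \<in> ?D"
      obtain J where J: "J \<subseteq> supp w" "s \<le> card J" "min_density k s (supp w) w = rel_density J w k"
        using min_density_attained[OF supp(2), of s w k] w by auto
      then have "min_density k s (supp w) w \<le> 1"
        using rel_density_le_1[of J w k] s supp(2) finite_subset by fastforce
      moreover have "card (supp w) \<le> card N" using supp(1) N(1) by (simp add: card_mono)
      then have "card (supp w) - s \<le> M" using s N(2) by linarith
      ultimately have "min_density k s (supp w) w ^ M \<le> min_density k s (supp w) w ^ (card (supp w) - s)"
        using min_density_nonneg[OF supp(2)] w by (intro power_decreasing) auto
      moreover have "min_density k s (supp w) (restrict w (supp w)) = min_density k s (supp w) w"
        by (rule min_density_cong) simp
      ultimately show "\<beta> w ^ M \<le> A ^ M * min_density k s (supp w) (restrict w (supp w)) ^ (card (supp w) - s)"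
        using w A0 by (simp add: \<beta>_def power_mult_distrib mult_left_mono)
    qed
    also have "\<dots> = A ^ M * (\<Sum>(S, v)\<in>?h ` ?D. min_density k s S v ^ (card S - s))"
    proof -
      have "inj_on ?h ?D" using injh by (rule inj_on_subset) auto
      then show ?thesis by (simp add: sum.reindex sum_distrib_left)
    qed
    also have "\<dots> \<le> A ^ M * (\<Sum>(S, v)\<in>Sigma ?PD (\<lambda>S. PiE S (\<lambda>_. C)). min_density k s S v ^ (card S - s))"
    proof (intro mult_left_mono sum_mono2)
      show "finite (Sigma ?PD (\<lambda>S. PiE S (\<lambda>_. C)))"
        using finP finS fin_C by (intro finite_SigmaI finite_PiE) auto
      show "?h ` ?D \<subseteq> Sigma ?PD (\<lambda>S. PiE S (\<lambda>_. C))"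
      proof (rule image_subsetI)
        fix w assume w: "w \<in> ?D"
        then have "restrict w (supp w) \<in> PiE (supp w) (\<lambda>_. C)"
          using supp(1) by (intro restrict_in_PiE[of _ N]) (auto simp: Bad_def)
        then show "?h w \<in> Sigma ?PD (\<lambda>S. PiE S (\<lambda>_. C))" using w supp(1)[of w] by simp
      qed
    qed (use A0 finS in \<open>auto intro!: zero_le_power min_density_nonneg\<close>)
    also have "\<dots> = A ^ M * (\<Sum>S\<in>?PD. \<Sum>v\<in>PiE S (\<lambda>_. C). min_density k s S v ^ (card S - s))"
      using finP finS fin_C by (subst sum.Sigma) (auto intro: finite_PiE)
    also have "\<dots> \<le> A ^ M * (\<Sum>S\<in>?PD. real (card C) ^ s)"
      using A0 finS k by (intro mult_left_mono sum_mono sum_min_density_le) auto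
    also have "\<dots> \<le> A ^ M * (2 ^ card N * real (card C) ^ s)"
    proof -
      have "card ?PD \<le> card (Pow N)" using N(1) by (intro card_mono) auto
      then have "card ?PD \<le> 2 ^ card N" using N(1) by (simp add: card_Pow)
      then have "real (card ?PD) \<le> 2 ^ card N" by (metis of_nat_le_iff of_nat_numeral of_nat_power)
      then show ?thesis using A0 by (simp add: mult_left_mono mult_right_mono)
    qed
    finally have dense: "(\<Sum>w\<in>?D. \<beta> w ^ M) \<le> 2 ^ card N * A ^ M * real (card C) ^ s" by (simp add: mult_ac)
    have C1: "card C \<ge> 1" using C_nonempty fin_C by (simp add: Suc_le_eq card_gt_0_iff)
    have "card ?L \<le> card (Sigma ?PL (\<lambda>S. PiE S (\<lambda>_. C)))"
    proof (rule card_inj_on_le[of ?h])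
      show "inj_on ?h ?L" using injh by (rule inj_on_subset) auto
      show "?h ` ?L \<subseteq> Sigma ?PL (\<lambda>S. PiE S (\<lambda>_. C))"
      proof (rule image_subsetI)
        fix w assume "w \<in> ?L"
        then have "supp w \<noteq> {}" "supp w \<subseteq> N" "card (supp w) \<le> s" "w \<in> PiE N (\<lambda>_. C)"
          by (auto simp: Bad_def supp_def)
        then show "?h w \<in> Sigma ?PL (\<lambda>S. PiE S (\<lambda>_. C))" using restrict_in_PiE[of w N C "supp w"] by simp
      qed
      show "finite (Sigma ?PL (\<lambda>S. PiE S (\<lambda>_. C)))"
        using finP finS fin_C by (intro finite_SigmaI finite_PiE) auto
    qed
    also have "\<dots> = (\<Sum>S\<in>?PL. card C ^ card S)"
      using finP finS fin_C by (subst card_SigmaI) (auto simp: card_PiE intro: finite_PiE)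
    also have "\<dots> \<le> (\<Sum>S\<in>?PL. card C ^ s)"
      using C1 by (intro sum_mono power_increasing) auto
    also have "\<dots> \<le> card N ^ s * card C ^ s"
      using card_nonempty_small_subsets[OF N(1), of s] by simp
    finally have "real (card ?L) \<le> card N ^ s * real (card C) ^ s"
      by (simp only: of_nat_mult[symmetric] of_nat_power[symmetric] of_nat_le_iff)
    then have "(\<Sum>w\<in>?L. \<beta> w ^ M) \<le> card N ^ s * real (card C) ^ s * (1 / 2) ^ M"
      by (simp add: \<beta>_def mult_right_mono)
    moreover have "(\<Sum>w\<in>Bad. \<beta> w ^ M) = (\<Sum>w\<in>?D. \<beta> w ^ M) + (\<Sum>w\<in>?L. \<beta> w ^ M)"
    proof -
      have "Bad = ?D \<union> ?L" by auto
      then show ?thesis using finBad sum.union_disjoint[of ?D ?L "\<lambda>w. \<beta> w ^ M"] by auto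
    qed
    ultimately show ?thesis using dense by linarith
  qed
  ultimately show ?thesis using that[of \<beta>] by (auto simp: A_def)
qed

end

section \<open>Singularity of a shifted random matrix\<close>

context finite_residue_field
begin

lemma prod_diff_in:
  "(\<And>i. i \<in> I \<Longrightarrow> f i - g i \<in> P) \<Longrightarrow> prod f I - prod g I \<in> P"
proof (induction I rule: infinite_finite_induct)
  case (insert x F)
  have "f x * prod f F - g x * prod g F = prod f F * (f x - g x) + g x * (prod f F - prod g F)"
    by (simp add: algebra_simps)
  then show ?case using insert by (auto intro!: add_in mult_in)
qed (auto simp: zero_in)

lemma det_diff_in:
  assumes "A \<in> carrier_mat n n" "B \<in> carrier_mat n n"
    and "\<And>i j. i < n \<Longrightarrow> j < n \<Longrightarrow> A $$ (i, j) - B $$ (i, j) \<in> P"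
  shows "Determinant.det A - Determinant.det B \<in> P"
proof -
  have "(\<Prod>i = 0..<n. A $$ (i, q i)) - (\<Prod>i = 0..<n. B $$ (i, q i)) \<in> P" if "q permutes {0..<n}" for q
    using that assms(3) permutes_in_image[OF that] by (intro prod_diff_in) auto
  then have "(\<Sum>q\<in>{q. q permutes {0..<n}}. signof q * ((\<Prod>i = 0..<n. A $$ (i, q i)) - (\<Prod>i = 0..<n. B $$ (i, q i)))) \<in> P"
    by (intro sum_in mult_in) auto
  then show ?thesis
    by (simp add: det_def'[OF assms(1)] det_def'[OF assms(2)] sum_subtractf right_diff_distrib)
qed

text \<open>Linear algebra over the residue field reduces to the pigeonhole principle, because the
  field is finite.\<close>

lemma null_vector_of_not_inj:
  fixes a :: "'r \<Rightarrow> 'i \<Rightarrow> 'a"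
  assumes "\<not> inj_on (\<lambda>u. restrict (\<lambda>r. rep (\<Sum>i\<in>N. a r i * u i)) R) (PiE N (\<lambda>_. C))"
  shows "\<exists>w\<in>PiE N (\<lambda>_. C). (\<exists>i\<in>N. w i \<notin> P) \<and> (\<forall>r\<in>R. (\<Sum>i\<in>N. a r i * w i) \<in> P)"
proof -
  obtain u v where uv: "u \<in> PiE N (\<lambda>_. C)" "v \<in> PiE N (\<lambda>_. C)" "u \<noteq> v"
    and eq: "restrict (\<lambda>r. rep (\<Sum>i\<in>N. a r i * u i)) R = restrict (\<lambda>r. rep (\<Sum>i\<in>N. a r i * v i)) R"
    using assms by (auto simp: inj_on_def)
  define w where "w = restrict (\<lambda>i. rep (u i - v i)) N"
  obtain i where i: "i \<in> N" "u i \<noteq> v i" using uv by (meson PiE_ext)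
  have "u i - v i \<notin> P" using rep_unique uv i by (auto simp: PiE_iff)
  then have "w i \<notin> P" using rep(2)[of "u i - v i"] i diff_in_left_iff by (auto simp: w_def)
  moreover have "(\<Sum>i\<in>N. a r i * w i) \<in> P" if r: "r \<in> R" for r
  proof -
    have "(\<Sum>i\<in>N. a r i * u i) - (\<Sum>i\<in>N. a r i * v i) \<in> P"
      using fun_cong[OF eq, of r] r by (simp add: rep_eq_iff)
    moreover have "(\<Sum>i\<in>N. a r i * (w i - (u i - v i))) \<in> P"
    proof (intro sum_in mult_in)
      fix i assume "i \<in> N"
      then show "w i - (u i - v i) \<in> P" using diff_in_sym[OF rep(2)[of "u i - v i"]] by (simp add: w_def)
    qed
    ultimately have "((\<Sum>i\<in>N. a r i * u i) - (\<Sum>i\<in>N. a r i * v i)) + (\<Sum>i\<in>N. a r i * (w i - (u i - v i))) \<in> P"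
      by (rule add_in)
    then show ?thesis by (simp add: algebra_simps sum.distrib sum_subtractf)
  qed
  moreover have "w \<in> PiE N (\<lambda>_. C)" using rep(1) by (auto simp: w_def)
  ultimately show ?thesis using i by blast
qed

lemma card_C_ge_2: "card C \<ge> 2"
proof -
  have "rep 0 \<noteq> rep 1" using one_notin uminus_in[of "-1"] by (auto simp: rep_eq_iff)
  then have "card {rep 0, rep 1} = 2" by simp
  moreover have "card {rep 0, rep 1} \<le> card C" using rep(1) fin_C by (intro card_mono) auto
  ultimately show ?thesis by simp
qed

lemma null_vector_of_few_equations:
  fixes a :: "'r \<Rightarrow> 'i \<Rightarrow> 'a"
  assumes "finite N" "finite R" "card R < card N"
  shows "\<exists>w\<in>PiE N (\<lambda>_. C). (\<exists>i\<in>N. w i \<notin> P) \<and> (\<forall>r\<in>R. (\<Sum>i\<in>N. a r i * w i) \<in> P)"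
proof (rule null_vector_of_not_inj, rule pigeonhole)
  let ?T = "\<lambda>u. restrict (\<lambda>r. rep (\<Sum>i\<in>N. a r i * u i)) R"
  have "card (?T ` PiE N (\<lambda>_. C)) \<le> card (PiE R (\<lambda>_. C))"
    using rep(1) assms fin_C by (intro card_mono finite_PiE) auto
  also have "\<dots> < card (PiE N (\<lambda>_. C))"
    using assms card_C_ge_2 by (simp add: card_PiE power_strict_increasing)
  finally show "card (?T ` PiE N (\<lambda>_. C)) < card (PiE N (\<lambda>_. C))" .
qed

text \<open>If multiplication by the matrix were injective on row vectors modulo the ideal, it would be
  bijective, and the matrix would have a left inverse modulo the ideal.\<close>

lemma left_null_vector:
  assumes A: "A \<in> carrier_mat n n" and det: "Determinant.det A \<in> P"
  shows "\<exists>u. (\<exists>i<n. u i \<notin> P) \<and> (\<forall>j<n. (\<Sum>i<n. A $$ (i, j) * u i) \<in> P)"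
proof -
  let ?V = "PiE {..<n} (\<lambda>_. C)"
  let ?T = "\<lambda>u. restrict (\<lambda>j. rep (\<Sum>i<n. A $$ (i, j) * u i)) {..<n}"
  have "\<not> inj_on ?T ?V"
  proof
    assume inj: "inj_on ?T ?V"
    have "finite ?V" using fin_C by (intro finite_PiE) auto
    moreover have "?T ` ?V \<subseteq> ?V" by (intro image_subsetI restrict_PiE_iff[THEN iffD2] ballI rep(1))
    ultimately have surj: "?T ` ?V = ?V" using inj by (rule endo_inj_surj)
    have "\<exists>u\<in>?V. ?T u = restrict (\<lambda>j. rep (if j = l then 1 else 0)) {..<n}" for l
    proof -
      have "restrict (\<lambda>j. rep (if j = l then 1 else 0)) {..<n} \<in> ?T ` ?V"
        unfolding surj by (intro restrict_PiE_iff[THEN iffD2] ballI rep(1))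
      then obtain u where "u \<in> ?V" "restrict (\<lambda>j. rep (if j = l then 1 else 0)) {..<n} = ?T u"
        by (rule imageE)
      then show ?thesis by (intro bexI[of _ u]) (rule sym)
    qed
    then have "\<forall>l. \<exists>u. ?T u = restrict (\<lambda>j. rep (if j = l then 1 else 0)) {..<n}" by blast
    from choice[OF this] obtain u where u: "\<And>l. ?T (u l) = restrict (\<lambda>j. rep (if j = l then 1 else 0)) {..<n}" by blast
    define L where "L = Matrix.mat n n (\<lambda>(l, i). u l i)"
    have L: "L \<in> carrier_mat n n" by (simp add: L_def)
    have "(L * A) $$ (l, j) - 1\<^sub>m n $$ (l, j) \<in> P" if lj: "l < n" "j < n" for l j
    proof -
      have "rep (\<Sum>i<n. A $$ (i, j) * u l i) = rep (if j = l then 1 else 0)"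
        using fun_cong[OF u[of l], of j] lj by simp
      then have "(\<Sum>i<n. A $$ (i, j) * u l i) - (if j = l then 1 else 0) \<in> P" by (simp only: rep_eq_iff)
      moreover have "(L * A) $$ (l, j) = (\<Sum>i<n. A $$ (i, j) * u l i)"
        using lj A by (simp add: L_def scalar_prod_def atLeast0LessThan mult.commute)
      ultimately show ?thesis using lj by auto
    qed
    then have "Determinant.det (L * A) - Determinant.det (1\<^sub>m n) \<in> P"
      using L A by (intro det_diff_in) auto
    moreover have "Determinant.det (L * A) \<in> P" using det det_mult[OF L A] mult_in by simp
    ultimately have "1 \<in> P" using diff_in_left_iff by fastforce
    then show False using one_notin by blast
  qed
  from null_vector_of_not_inj[OF this] show ?thesis by auto
qed

lemma card_affine_hits_le:
  assumes "conc N w b" "\<gamma> \<notin> P" "b \<ge> 0"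
  shows "real (card {x \<in> signs N. \<gamma> * (\<Sum>i\<in>N. of_int (x i) * w i) + y \<in> P}) \<le> b * 2 ^ card N"
    (is "real (card ?S) \<le> _")
proof (cases "?S = {}")
  case True
  then show ?thesis using assms(3) by (simp only: card.empty) simp
next
  case False
  then obtain x0 where x0: "x0 \<in> ?S" by blast
  have "\<gamma> * (\<Sum>i\<in>N. of_int (x i) * w i) + y \<in> P
      \<longleftrightarrow> (\<Sum>i\<in>N. of_int (x i) * w i) - (\<Sum>i\<in>N. of_int (x0 i) * w i) \<in> P" for x :: "_ \<Rightarrow> int"
  proof -
    let ?s = "\<Sum>i\<in>N. of_int (x i) * w i" and ?t = "\<Sum>i\<in>N. of_int (x0 i) * w i"
    have t: "\<gamma> * ?t + y \<in> P" using x0 by simp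
    have eq: "(\<gamma> * ?s + y) - (\<gamma> * ?t + y) = \<gamma> * (?s - ?t)"
      by (simp only: add_diff_cancel_right right_diff_distrib)
    have "\<gamma> * ?s + y \<in> P \<longleftrightarrow> (\<gamma> * ?s + y) - (\<gamma> * ?t + y) \<in> P"
    proof
      assume "\<gamma> * ?s + y \<in> P"
      then show "(\<gamma> * ?s + y) - (\<gamma> * ?t + y) \<in> P" using t by (rule diff_in)
    next
      assume "(\<gamma> * ?s + y) - (\<gamma> * ?t + y) \<in> P"
      from diff_in_left_iff[OF this] t show "\<gamma> * ?s + y \<in> P" by (rule iffD2)
    qed
    then show ?thesis unfolding eq prime_ideal_iff using assms(2) by (simp only: simp_thms)
  qed
  then have "?S = {x \<in> signs N. (\<Sum>i\<in>N. of_int (x i) * w i) - (\<Sum>i\<in>N. of_int (x0 i) * w i) \<in> P}"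
    by blast
  then show ?thesis using assms(1) by (simp add: conc_def)
qed

text \<open>If the matrix is singular, some row lies in the span of the others, hence is orthogonal to
  every vector orthogonal to the others. Choose such a vector from the other rows alone. If it is
  well spread, the independent last row meets the condition with probability at most \<open>\<rho>\<close>;
  otherwise it is one of few vectors, each unlikely to be orthogonal to all the other rows.\<close>

lemma card_singular_le:
  fixes B :: "nat \<Rightarrow> nat \<Rightarrow> 'a" and \<gamma> :: 'a and n :: nat and \<rho> :: real
  defines "A \<equiv> \<lambda>r. Matrix.mat n n (\<lambda>(i, j). \<gamma> * of_int (r i j) + B i j)"
    and "\<Omega> \<equiv> PiE {..<n} (\<lambda>_. signs {..<n})"
    and "Bad \<equiv> bad_vectors {..<n} \<rho>"
  assumes \<gamma>: "\<gamma> \<notin> P" and n: "n > 0" and \<rho>: "\<rho> \<ge> 0"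
    and \<beta>: "\<And>w. w \<in> Bad \<Longrightarrow> \<beta> w \<ge> 0" "\<And>w. w \<in> Bad \<Longrightarrow> conc {..<n} w (\<beta> w)"
  shows "card {r \<in> \<Omega>. Determinant.det (A r) \<in> P} \<le> real n * ((\<Sum>w\<in>Bad. \<beta> w ^ (n - 1)) + \<rho>) * card \<Omega>"
proof -
  note Bad_def = Bad_def[unfolded bad_vectors_def]
  let ?V = "signs {..<n}"
  have finV: "finite ?V" "card ?V = 2 ^ n" by (auto simp: finite_signs card_signs)
  have fin\<Omega>: "finite \<Omega>" using finV by (auto simp: \<Omega>_def intro: finite_PiE)
  have "finite (PiE {..<n} (\<lambda>_. C))" using fin_C by (intro finite_PiE) auto
  then have finBad: "finite Bad" unfolding Bad_def by simp
  define val where "val l x w = (\<Sum>j<n. (\<gamma> * of_int (x j) + B l j) * w j)" for l :: nat and x :: "nat \<Rightarrow> int" and w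
  have val: "val l x w = \<gamma> * (\<Sum>j<n. of_int (x j) * w j) + (\<Sum>j<n. B l j * w j)" for l x w
    by (simp add: val_def distrib_right sum.distrib sum_distrib_left mult.assoc)
  have hits: "card {x \<in> ?V. val l x w \<in> P} \<le> b * 2 ^ n" if "conc {..<n} w b" "b \<ge> 0" for l w and b :: real
    unfolding val using card_affine_hits_le[OF that(1) \<gamma> that(2)] by simp
  \<comment> \<open>The selected vector depends on the rows other than the row of index \<open>i\<close> only.\<close>
  define K where "K i r = (SOME w. w \<in> PiE {..<n} (\<lambda>_. C) \<and> (\<exists>j\<in>{..<n}. w j \<notin> P) \<and>
      (\<forall>l\<in>{..<n} - {i}. val l (r l) w \<in> P))" for i :: nat and r :: "nat \<Rightarrow> nat \<Rightarrow> int"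
  have K: "K i r \<in> PiE {..<n} (\<lambda>_. C) \<and> (\<exists>j\<in>{..<n}. K i r j \<notin> P) \<and> (\<forall>l\<in>{..<n} - {i}. val l (r l) (K i r) \<in> P)"
    if "i < n" for i r
  proof -
    have "\<exists>w\<in>PiE {..<n} (\<lambda>_. C). (\<exists>j\<in>{..<n}. w j \<notin> P) \<and> (\<forall>l\<in>{..<n} - {i}. val l (r l) w \<in> P)"
      unfolding val_def using that by (intro null_vector_of_few_equations) auto
    then have "\<exists>w. w \<in> PiE {..<n} (\<lambda>_. C) \<and> (\<exists>j\<in>{..<n}. w j \<notin> P) \<and>
        (\<forall>l\<in>{..<n} - {i}. val l (r l) w \<in> P)" by blast
    from someI_ex[OF this] show ?thesis unfolding K_def .
  qed
  have K_restrict: "K i (restrict r ({..<n} - {i})) = K i r" for i r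
    unfolding K_def by (intro arg_cong[of _ _ Eps] ext) auto
  define E1 where "E1 i = (\<Union>w\<in>Bad. {r \<in> \<Omega>. \<forall>l\<in>{..<n} - {i}. val l (r l) w \<in> P})" for i
  define E2 where "E2 i = {r \<in> \<Omega>. K i r \<notin> Bad \<and> val i (r i) (K i r) \<in> P}" for i
  have cover: "{r \<in> \<Omega>. Determinant.det (A r) \<in> P} \<subseteq> (\<Union>i\<in>{..<n}. E1 i \<union> E2 i)"
  proof clarify
    fix r assume r: "r \<in> \<Omega>" and det: "Determinant.det (A r) \<in> P"
    have "A r \<in> carrier_mat n n" by (simp add: A_def)
    from left_null_vector[OF this det] obtain u i where u: "i < n" "u i \<notin> P"
      and null: "\<And>j. j < n \<Longrightarrow> (\<Sum>l<n. (\<gamma> * of_int (r l j) + B l j) * u l) \<in> P"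
      by (auto simp: A_def)
    let ?w = "K i r"
    have "(\<Sum>j<n. ?w j * (\<Sum>l<n. (\<gamma> * of_int (r l j) + B l j) * u l)) \<in> P"
      by (rule sum_in, rule mult_in, rule null) simp
    also have "(\<Sum>j<n. ?w j * (\<Sum>l<n. (\<gamma> * of_int (r l j) + B l j) * u l)) = (\<Sum>l<n. u l * val l (r l) ?w)"
      unfolding val_def sum_distrib_left by (subst sum.swap) (simp add: mult_ac)
    also have "\<dots> = u i * val i (r i) ?w + (\<Sum>l\<in>{..<n} - {i}. u l * val l (r l) ?w)"
      using u(1) by (simp add: sum.remove)
    finally have "u i * val i (r i) ?w + (\<Sum>l\<in>{..<n} - {i}. u l * val l (r l) ?w) \<in> P" .
    moreover have "(\<Sum>l\<in>{..<n} - {i}. u l * val l (r l) ?w) \<in> P"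
      using K[OF u(1)] by (intro sum_in mult_in) auto
    ultimately have "u i * val i (r i) ?w \<in> P" using diff_in by fastforce
    then have "val i (r i) ?w \<in> P" using u(2) by (simp add: prime_ideal_iff)
    then have "r \<in> E1 i \<union> E2 i" using r K[OF u(1), of r] by (auto simp: E1_def E2_def)
    then show "r \<in> (\<Union>i\<in>{..<n}. E1 i \<union> E2 i)" using u(1) by blast
  qed
  have \<Omega>: "real (card \<Omega>) = 2 ^ n * (2 ^ n) ^ (n - 1)"
    using n finV by (simp add: \<Omega>_def card_PiE power_Suc[symmetric])
  have E1: "card (E1 i) \<le> (\<Sum>w\<in>Bad. \<beta> w ^ (n - 1)) * card \<Omega>" if i: "i < n" for i
  proof -
    have "real (card {r \<in> \<Omega>. \<forall>l\<in>{..<n} - {i}. val l (r l) w \<in> P}) \<le> \<beta> w ^ (n - 1) * card \<Omega>" if w: "w \<in> Bad" for w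
    proof -
      let ?F = "\<lambda>l. if l = i then ?V else {x \<in> ?V. val l x w \<in> P}"
      have "{r \<in> \<Omega>. \<forall>l\<in>{..<n} - {i}. val l (r l) w \<in> P} \<subseteq> PiE {..<n} ?F"
        by (auto simp: \<Omega>_def PiE_iff extensional_def)
      then have "card {r \<in> \<Omega>. \<forall>l\<in>{..<n} - {i}. val l (r l) w \<in> P} \<le> card (PiE {..<n} ?F)"
        using finV by (intro card_mono finite_PiE) auto
      also have "\<dots> = card ?V * (\<Prod>l\<in>{..<n} - {i}. card {x \<in> ?V. val l x w \<in> P})"
        using i by (simp add: card_PiE prod.remove[of "{..<n}" i])
      finally have "real (card {r \<in> \<Omega>. \<forall>l\<in>{..<n} - {i}. val l (r l) w \<in> P})
          \<le> real (card ?V * (\<Prod>l\<in>{..<n} - {i}. card {x \<in> ?V. val l x w \<in> P}))"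
        by (simp only: of_nat_le_iff)
      also have "\<dots> = 2 ^ n * (\<Prod>l\<in>{..<n} - {i}. real (card {x \<in> ?V. val l x w \<in> P}))"
        by (simp add: finV)
      also have "\<dots> \<le> 2 ^ n * (\<Prod>l\<in>{..<n} - {i}. \<beta> w * 2 ^ n)"
        using hits \<beta> w by (intro mult_left_mono prod_mono) auto
      also have "\<dots> = \<beta> w ^ (n - 1) * card \<Omega>"
        using i by (simp add: \<Omega> power_mult_distrib)
      finally show ?thesis .
    qed
    then have "(\<Sum>w\<in>Bad. real (card {r \<in> \<Omega>. \<forall>l\<in>{..<n} - {i}. val l (r l) w \<in> P})) \<le> (\<Sum>w\<in>Bad. \<beta> w ^ (n - 1) * card \<Omega>)"
      by (rule sum_mono)
    moreover have "real (card (E1 i)) \<le> (\<Sum>w\<in>Bad. real (card {r \<in> \<Omega>. \<forall>l\<in>{..<n} - {i}. val l (r l) w \<in> P}))"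
      unfolding E1_def using card_UN_le[OF finBad, of "\<lambda>w. {r \<in> \<Omega>. \<forall>l\<in>{..<n} - {i}. val l (r l) w \<in> P}"]
      by (simp only: of_nat_sum[symmetric] of_nat_le_iff)
    ultimately show ?thesis by (simp add: sum_distrib_right)
  qed
  have E2: "card (E2 i) \<le> \<rho> * card \<Omega>" if i: "i < n" for i
  proof -
    let ?R = "PiE ({..<n} - {i}) (\<lambda>_. ?V)"
    define S where "S r = (if K i r \<in> Bad then {} else {x \<in> ?V. val i x (K i r) \<in> P})" for r
    have finR: "finite ?R" "card ?R = (2 ^ n) ^ (n - 1)"
      using finV i by (auto simp: card_PiE intro: finite_PiE)
    have finS: "finite (S r)" for r using finV by (simp add: S_def)
    have S: "real (card (S r)) \<le> \<rho> * 2 ^ n" for r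
      using hits[of "K i r" \<rho> i] K[OF i, of r] \<rho> by (auto simp: S_def Bad_def)
    have "card (E2 i) \<le> card (Sigma ?R S)"
    proof (rule card_inj_on_le[of "\<lambda>r. (restrict r ({..<n} - {i}), r i)"])
      show "inj_on (\<lambda>r. (restrict r ({..<n} - {i}), r i)) (E2 i)"
      proof (rule inj_onI)
        fix r r' assume h: "r \<in> E2 i" "r' \<in> E2 i"
          "(restrict r ({..<n} - {i}), r i) = (restrict r' ({..<n} - {i}), r' i)"
        have "r l = r' l" if "l < n" for l
          using h(3) that by (cases "l = i") (auto dest: fun_cong[of _ _ l])
        then show "r = r'" using h(1,2)
          by (intro PiE_ext[of r "{..<n}" "\<lambda>_. ?V" r']) (auto simp: E2_def \<Omega>_def)
      qed
      show "(\<lambda>r. (restrict r ({..<n} - {i}), r i)) ` E2 i \<subseteq> Sigma ?R S"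
      proof (rule image_subsetI)
        fix r assume r: "r \<in> E2 i"
        then have "r \<in> PiE {..<n} (\<lambda>_. ?V)" by (simp add: E2_def \<Omega>_def)
        then have "restrict r ({..<n} - {i}) \<in> ?R" "r i \<in> ?V"
          using restrict_in_PiE[of r "{..<n}" ?V "{..<n} - {i}"] i by auto
        then show "(restrict r ({..<n} - {i}), r i) \<in> Sigma ?R S"
          using r by (simp add: E2_def S_def K_restrict)
      qed
      show "finite (Sigma ?R S)" using finR finS by (intro finite_SigmaI)
    qed
    also have "\<dots> = (\<Sum>r\<in>?R. card (S r))" using finR finS by (intro card_SigmaI) auto
    finally have "real (card (E2 i)) \<le> (\<Sum>r\<in>?R. real (card (S r)))"
      by (simp only: of_nat_sum[symmetric] of_nat_le_iff)
    also have "\<dots> \<le> (\<Sum>r\<in>?R. \<rho> * 2 ^ n)" using S by (rule sum_mono)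
    also have "\<dots> = \<rho> * card \<Omega>" by (simp add: \<Omega> finR)
    finally show ?thesis .
  qed
  have "card {r \<in> \<Omega>. Determinant.det (A r) \<in> P} \<le> card (\<Union>i\<in>{..<n}. E1 i \<union> E2 i)"
    using cover fin\<Omega> finBad by (intro card_mono) (auto simp: E1_def E2_def)
  also have "\<dots> \<le> (\<Sum>i<n. card (E1 i \<union> E2 i))" by (rule card_UN_le) simp
  also have "\<dots> \<le> (\<Sum>i<n. card (E1 i) + card (E2 i))" by (intro sum_mono card_Un_le)
  finally have "real (card {r \<in> \<Omega>. Determinant.det (A r) \<in> P}) \<le> (\<Sum>i<n. real (card (E1 i)) + real (card (E2 i)))"
    by (simp only: of_nat_sum[symmetric] of_nat_add[symmetric] of_nat_le_iff)
  also have "\<dots> \<le> (\<Sum>i<n. (\<Sum>w\<in>Bad. \<beta> w ^ (n - 1)) * card \<Omega> + \<rho> * card \<Omega>)"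
    using E1 E2 by (intro sum_mono add_mono) auto
  also have "\<dots> = real n * ((\<Sum>w\<in>Bad. \<beta> w ^ (n - 1)) + \<rho>) * card \<Omega>" by (simp add: algebra_simps)
  finally show ?thesis .
qed

end

section \<open>Products of random sign matrices\<close>

text \<open>Row by row, the uniform distribution allows the rows to be counted independently.\<close>

lemma random_sign_matrix_conv:
  "random_sign_matrix n = map_pmf (\<lambda>r. Matrix.mat n n (\<lambda>(i, j). r i j))
     (pmf_of_set (PiE {..<n} (\<lambda>_. PiE {..<n} (\<lambda>_. {-1, 1}))))"
proof -
  let ?\<Omega> = "PiE {..<n} (\<lambda>_. PiE {..<n} (\<lambda>_. {-1, 1 :: int}))"
  let ?D = "PiE_dflt ({..<n} \<times> {..<n}) 0 (\<lambda>_. {-1, 1 :: int})"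
  let ?h = "\<lambda>r (i, j). if i < n \<and> j < n then r i j else (0 :: int)"
  have bij: "bij_betw ?h ?\<Omega> ?D"
  proof (rule bij_betwI[of _ _ _ "\<lambda>f. restrict (\<lambda>i. restrict (\<lambda>j. f (i, j)) {..<n}) {..<n}"])
    show "?h \<in> ?\<Omega> \<rightarrow> ?D" by (auto simp: PiE_dflt_def PiE_iff)
    show "(\<lambda>f. restrict (\<lambda>i. restrict (\<lambda>j. f (i, j)) {..<n}) {..<n}) \<in> ?D \<rightarrow> ?\<Omega>"
      by (auto simp: PiE_dflt_def)
  next
    fix r assume "r \<in> ?\<Omega>"
    then show "restrict (\<lambda>i. restrict (\<lambda>j. ?h r (i, j)) {..<n}) {..<n} = r"
      by (auto simp: PiE_iff extensional_def fun_eq_iff)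
  next
    fix f assume "f \<in> ?D"
    then show "?h (restrict (\<lambda>i. restrict (\<lambda>j. f (i, j)) {..<n}) {..<n}) = f"
      by (auto simp: PiE_dflt_def fun_eq_iff)
  qed
  have fin: "finite ?\<Omega>" "?\<Omega> \<noteq> {}" by (auto intro!: finite_PiE simp: PiE_eq_empty_iff)
  have "Pi_pmf ({..<n} \<times> {..<n}) 0 (\<lambda>_. pmf_of_set {-1, 1 :: int}) = pmf_of_set ?D"
    by (intro Pi_pmf_of_set) auto
  also have "\<dots> = map_pmf ?h (pmf_of_set ?\<Omega>)"
    using bij fin by (intro map_pmf_of_set_bij_betw[symmetric])
  finally have "random_sign_matrix n = map_pmf (\<lambda>r. Matrix.mat n n (?h r)) (pmf_of_set ?\<Omega>)"
    by (simp add: random_sign_matrix_def map_pmf_comp)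
  moreover have "Matrix.mat n n (?h r) = Matrix.mat n n (\<lambda>(i, j). r i j)" for r
    by (intro eq_matI) auto
  ultimately show ?thesis by simp
qed

lemma random_sign_matrix_carrier: "M \<in> set_pmf (random_sign_matrix n) \<Longrightarrow> M \<in> carrier_mat n n"
  by (auto simp: random_sign_matrix_def)

text \<open>Condition on the tail of the list.\<close>

lemma prob_replicate_Suc_le:
  assumes "\<epsilon> \<ge> 0"
    and "\<And>xs. xs \<in> set_pmf (replicate_pmf m D) \<Longrightarrow> xs \<notin> F \<Longrightarrow> measure_pmf.prob D {x. x # xs \<in> E} \<le> \<epsilon>"
  shows "measure_pmf.prob (replicate_pmf (Suc m) D) E \<le> measure_pmf.prob (replicate_pmf m D) F + \<epsilon>"
proof -
  let ?R = "measure_pmf (replicate_pmf m D)"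
  have "replicate_pmf (Suc m) D = bind_pmf (replicate_pmf m D) (\<lambda>xs. map_pmf (\<lambda>x. x # xs) D)"
    by (simp add: bind_commute_pmf[of D] map_pmf_def)
  then have "emeasure (replicate_pmf (Suc m) D) E = (\<integral>\<^sup>+xs. emeasure (measure_pmf D) {x. x # xs \<in> E} \<partial>?R)"
    by (simp add: vimage_def)
  also have "\<dots> \<le> (\<integral>\<^sup>+xs. indicator F xs + ennreal \<epsilon> \<partial>?R)"
  proof (rule nn_integral_mono_AE, unfold AE_measure_pmf_iff, rule ballI)
    fix xs assume xs: "xs \<in> set_pmf (replicate_pmf m D)"
    show "emeasure (measure_pmf D) {x. x # xs \<in> E} \<le> indicator F xs + ennreal \<epsilon>"
    proof (cases "xs \<in> F")
      case True
      have "emeasure (measure_pmf D) {x. x # xs \<in> E} \<le> 1" by (rule measure_pmf.emeasure_le_1)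
      also have "(1 :: ennreal) \<le> 1 + ennreal \<epsilon>" by simp
      finally show ?thesis using True by simp
    next
      case False
      then show ?thesis using assms(2)[OF xs]
        by (simp add: measure_pmf.emeasure_eq_measure ennreal_leI)
    qed
  qed
  also have "\<dots> = ennreal (measure_pmf.prob (replicate_pmf m D) F + \<epsilon>)"
    using assms(1) by (simp add: nn_integral_add measure_pmf.emeasure_eq_measure ennreal_plus)
  finally have "ennreal (measure_pmf.prob (replicate_pmf (Suc m) D) E)
      \<le> ennreal (measure_pmf.prob (replicate_pmf m D) F + \<epsilon>)"
    by (simp only: measure_pmf.emeasure_eq_measure)
  then show ?thesis by (subst (asm) ennreal_le_iff) (use assms(1) in auto)
qed

context finite_residue_field
begin

lemma prob_singular_le:
  assumes \<gamma>: "\<gamma> \<notin> P" and n: "n > 0" and \<rho>: "\<rho> \<ge> 0" and B: "B \<in> carrier_mat n n"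
    and \<beta>: "\<And>w. w \<in> bad_vectors {..<n} \<rho> \<Longrightarrow> \<beta> w \<ge> 0" "\<And>w. w \<in> bad_vectors {..<n} \<rho> \<Longrightarrow> conc {..<n} w (\<beta> w)"
  shows "measure_pmf.prob (random_sign_matrix n) {M. Determinant.det (\<gamma> \<cdot>\<^sub>m map_mat of_int M + B) \<in> P}
    \<le> real n * ((\<Sum>w\<in>bad_vectors {..<n} \<rho>. \<beta> w ^ (n - 1)) + \<rho>)"
proof -
  let ?\<Omega> = "PiE {..<n} (\<lambda>_. signs {..<n})"
  have fin: "finite ?\<Omega>" "?\<Omega> \<noteq> {}"
    by (auto intro!: finite_PiE simp: PiE_eq_empty_iff finite_signs signs_def)
  have c: "real (card ?\<Omega>) > 0" using fin by (simp add: card_gt_0_iff)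
  have eq: "\<gamma> \<cdot>\<^sub>m map_mat of_int (Matrix.mat n n (\<lambda>(i, j). r i j)) + B
      = Matrix.mat n n (\<lambda>(i, j). \<gamma> * of_int (r i j) + B $$ (i, j))" for r :: "nat \<Rightarrow> nat \<Rightarrow> int"
    using B by (intro eq_matI) auto
  have "random_sign_matrix n = map_pmf (\<lambda>r. Matrix.mat n n (\<lambda>(i, j). r i j)) (pmf_of_set ?\<Omega>)"
    unfolding random_sign_matrix_conv signs_def ..
  then have "measure_pmf.prob (random_sign_matrix n) {M. Determinant.det (\<gamma> \<cdot>\<^sub>m map_mat of_int M + B) \<in> P}
      = real (card (?\<Omega> \<inter> {r. Determinant.det (Matrix.mat n n (\<lambda>(i, j). \<gamma> * of_int (r i j) + B $$ (i, j))) \<in> P})) / card ?\<Omega>"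
    using fin by (simp add: vimage_def eq measure_pmf_of_set)
  also have "\<dots> \<le> real n * ((\<Sum>w\<in>bad_vectors {..<n} \<rho>. \<beta> w ^ (n - 1)) + \<rho>) * card ?\<Omega> / card ?\<Omega>"
    using card_singular_le[OF \<gamma> n \<rho>, of \<beta> "\<lambda>i j. B $$ (i, j)"] \<beta>
    by (intro divide_right_mono) (auto simp: Int_def)
  finally show ?thesis using c by simp
qed

lemma replicate_carrier:
  "Ms \<in> set_pmf (replicate_pmf m (random_sign_matrix n)) \<Longrightarrow> mat_product n Ms \<in> carrier_mat n n"
proof (induction m arbitrary: Ms)
  case 0 then show ?case by (simp add: mat_product_def)
next
  case (Suc m)
  then show ?case using random_sign_matrix_carrier by (auto simp: mat_product_def) (meson mult_carrier_mat)
qed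

text \<open>Conditioning on all factors but the first one, with product \<open>A\<close>: unless \<open>A\<close> is
  singular, multiplying by its adjugate turns the event into the singularity of a shift of the
  first factor.\<close>

lemma prob_product_singular_le:
  fixes t :: 'a
  assumes \<epsilon>: "\<epsilon> \<ge> 0" and "m \<ge> 1 \<or> t = 0"
    and H: "\<And>\<gamma> B. \<gamma> \<notin> P \<Longrightarrow> B \<in> carrier_mat n n \<Longrightarrow>
      measure_pmf.prob (random_sign_matrix n) {M. Determinant.det (\<gamma> \<cdot>\<^sub>m map_mat of_int M + B) \<in> P} \<le> \<epsilon>"
  shows "measure_pmf.prob (replicate_pmf m (random_sign_matrix n))
      {Ms. Determinant.det (t \<cdot>\<^sub>m 1\<^sub>m n + (-1) \<cdot>\<^sub>m map_mat of_int (mat_product n Ms)) \<in> P} \<le> real m * \<epsilon>"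
  using assms(2)
proof (induction m arbitrary: t)
  case 0
  have "0 \<cdot>\<^sub>m 1\<^sub>m n + (-1) \<cdot>\<^sub>m map_mat of_int (1\<^sub>m n) = ((-1) \<cdot>\<^sub>m 1\<^sub>m n :: 'a mat)"
    by (intro eq_matI) auto
  then have "Determinant.det (0 \<cdot>\<^sub>m 1\<^sub>m n + (-1) \<cdot>\<^sub>m map_mat of_int (1\<^sub>m n) :: 'a mat) = (-1) ^ n" by simp
  moreover have "(-1) ^ n \<notin> P" using one_notin uminus_in[of "-1"] by (cases "even n") auto
  ultimately show ?case using 0 by (simp add: mat_product_def)
next
  case (Suc m)
  let ?D = "\<lambda>t A. Determinant.det (t \<cdot>\<^sub>m 1\<^sub>m n + (-1) \<cdot>\<^sub>m A :: 'a mat)"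
  let ?F = "{Ms. ?D 0 (map_mat of_int (mat_product n Ms)) \<in> P}" and ?E = "{Ms. ?D t (map_mat of_int (mat_product n Ms)) \<in> P}"
  have hom: "map_mat of_int (mat_product n (M # Ms)) = map_mat of_int M * (map_mat of_int (mat_product n Ms) :: 'a mat)"
    if "M \<in> carrier_mat n n" "mat_product n Ms \<in> carrier_mat n n" for M Ms
    using of_int_hom.mat_hom_mult[OF that] by (simp add: mat_product_def)
  have "measure_pmf.prob (replicate_pmf (Suc m) (random_sign_matrix n)) ?E
      \<le> measure_pmf.prob (replicate_pmf m (random_sign_matrix n)) ?F + \<epsilon>"
  proof (rule prob_replicate_Suc_le[OF \<epsilon>])
    fix Ms assume Ms: "Ms \<in> set_pmf (replicate_pmf m (random_sign_matrix n))" "Ms \<notin> ?F"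
    define A where "A = (map_mat of_int (mat_product n Ms) :: 'a mat)"
    have A: "A \<in> carrier_mat n n" "Determinant.det A \<notin> P"
    proof -
      show A: "A \<in> carrier_mat n n" using replicate_carrier[OF Ms(1)] by (simp add: A_def)
      then have "0 \<cdot>\<^sub>m 1\<^sub>m n + (-1) \<cdot>\<^sub>m A = (-1) \<cdot>\<^sub>m A" by (intro eq_matI) auto
      then have "?D 0 A = (-1) ^ n * Determinant.det A" using A by simp
      moreover have "?D 0 A \<notin> P" using Ms(2) by (simp only: A_def mem_Collect_eq not_False_eq_True)
      ultimately show "Determinant.det A \<notin> P" using mult_in by metis
    qed
    note adj = adj_mat[OF A(1)]
    let ?B = "t \<cdot>\<^sub>m adj_mat A"
    have "measure_pmf.prob (random_sign_matrix n) {M. M # Ms \<in> ?E}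
        \<le> measure_pmf.prob (random_sign_matrix n) {M. Determinant.det ((- Determinant.det A) \<cdot>\<^sub>m map_mat of_int M + ?B) \<in> P}"
    proof (rule measure_pmf.finite_measure_mono_AE, unfold AE_measure_pmf_iff, intro ballI impI)
      fix M assume M: "M \<in> set_pmf (random_sign_matrix n)" "M \<in> {M. M # Ms \<in> ?E}"
      define M' where "M' = (map_mat of_int M :: 'a mat)"
      have M': "M' \<in> carrier_mat n n" using random_sign_matrix_carrier[OF M(1)] by (simp add: M'_def)
      let ?N = "t \<cdot>\<^sub>m 1\<^sub>m n + (-1) \<cdot>\<^sub>m (M' * A)"
      have N: "?N \<in> carrier_mat n n" using M' A by auto
      have "Determinant.det ?N \<in> P"
        using M(2) unfolding A_def M'_def
        by (simp only: mem_Collect_eq hom[OF random_sign_matrix_carrier[OF M(1)] replicate_carrier[OF Ms(1)]])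
      then have "Determinant.det (?N * adj_mat A) \<in> P" using det_mult[OF N adj(1)] mult_in' by simp
      also have "?N * adj_mat A = t \<cdot>\<^sub>m adj_mat A + (-1) \<cdot>\<^sub>m (M' * (A * adj_mat A))"
      proof -
        have "?N * adj_mat A = (t \<cdot>\<^sub>m 1\<^sub>m n) * adj_mat A + ((-1) \<cdot>\<^sub>m (M' * A)) * adj_mat A"
          using M' A adj(1) by (intro add_mult_distrib_mat) auto
        also have "(t \<cdot>\<^sub>m 1\<^sub>m n) * adj_mat A = t \<cdot>\<^sub>m adj_mat A"
          using adj(1) by (simp add: mult_smult_assoc_mat[of _ n n _ n])
        also have "((-1) \<cdot>\<^sub>m (M' * A)) * adj_mat A = (-1) \<cdot>\<^sub>m ((M' * A) * adj_mat A)"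
          using M' A adj(1) by (intro mult_smult_assoc_mat[of _ n n]) auto
        also have "(M' * A) * adj_mat A = M' * (A * adj_mat A)"
          using M' A adj(1) by (intro assoc_mult_mat) auto
        finally show ?thesis .
      qed
      also have "M' * (A * adj_mat A) = Determinant.det A \<cdot>\<^sub>m M'"
        unfolding adj(2) using M' by (simp add: mult_smult_distrib[of _ n n _ n])
      also have "t \<cdot>\<^sub>m adj_mat A + (-1) \<cdot>\<^sub>m (Determinant.det A \<cdot>\<^sub>m M') = (- Determinant.det A) \<cdot>\<^sub>m M' + ?B"
        using M' adj(1) by (intro eq_matI) auto
      finally show "M \<in> {M. Determinant.det ((- Determinant.det A) \<cdot>\<^sub>m map_mat of_int M + ?B) \<in> P}"
        by (simp add: M'_def)
    qed simp
    also have "\<dots> \<le> \<epsilon>" using A(2) uminus_in[of "- Determinant.det A"] adj(1) by (intro H) auto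
    finally show "measure_pmf.prob (random_sign_matrix n) {M. M # Ms \<in> ?E} \<le> \<epsilon>" .
  qed
  then show ?case using Suc.IH[of 0] by (simp add: algebra_simps)
qed

end

section \<open>A prime in a polynomial range\<close>

lemma card_multiples:
  assumes "d > 0" shows "card {k \<in> {1..n}. d dvd k} = n div (d :: nat)"
proof -
  have "{k \<in> {1..n}. d dvd k} = (*) d ` {1..n div d}"
  proof (intro equalityI subsetI)
    fix k assume k: "k \<in> {k \<in> {1..n}. d dvd k}"
    then obtain q where q: "k = d * q" by blast
    then have "q \<le> n div d" "q \<ge> 1" using k assms by (auto simp: less_eq_div_iff_mult_less_eq mult.commute)
    then show "k \<in> (*) d ` {1..n div d}" using q by auto
  next
    fix k assume "k \<in> (*) d ` {1..n div d}"
    then obtain q where q: "k = d * q" "q \<in> {1..n div d}" by (rule imageE)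
    then have "q * d \<le> n" using assms by (simp add: less_eq_div_iff_mult_less_eq)
    then show "k \<in> {k \<in> {1..n}. d dvd k}" using q assms by (auto simp: mult.commute)
  qed
  moreover have "inj_on ((*) d) {1..n div d}" using assms by (auto simp: inj_on_def)
  ultimately show ?thesis by (simp add: card_image)
qed

text \<open>Legendre's formula, truncated where its terms vanish.\<close>

lemma multiplicity_fact:
  assumes "prime (q :: nat)" "n < q ^ Suc r"
  shows "multiplicity q (fact n) = (\<Sum>i = 1..r. n div q ^ i)"
proof -
  have q1: "q > 1" using assms(1) by (rule prime_gt_1_nat)
  have mult: "multiplicity q k = card {i \<in> {1..r}. q ^ i dvd k}" if k: "k \<in> {1..n}" for k
  proof -
    have le: "multiplicity q k \<le> r"
    proof (rule ccontr)
      assume "\<not> multiplicity q k \<le> r"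
      then have "q ^ Suc r dvd k" by (intro multiplicity_dvd') simp
      then have "q ^ Suc r \<le> k" using k by (intro dvd_imp_le) auto
      then show False using assms(2) k by simp
    qed
    have iff: "q ^ i dvd k \<longleftrightarrow> i \<le> multiplicity q k" for i
      using k q1 by (intro power_dvd_iff_le_multiplicity) auto
    have "{i \<in> {1..r}. q ^ i dvd k} = {1..multiplicity q k}" unfolding iff using le by auto
    then show ?thesis by simp
  qed
  have "multiplicity q (fact n) = (\<Sum>k\<in>{1..n}. multiplicity q k)"
    unfolding fact_prod using assms(1) by (simp add: prime_elem_multiplicity_prod_distrib)
  also have "\<dots> = (\<Sum>k\<in>{1..n}. \<Sum>i\<in>{1..r}. if q ^ i dvd k then 1 else 0)"
    using mult by (simp add: sum.If_cases Int_def)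
  also have "\<dots> = (\<Sum>i\<in>{1..r}. \<Sum>k\<in>{1..n}. if q ^ i dvd k then 1 else 0)"
    by (rule sum.swap)
  also have "\<dots> = (\<Sum>i\<in>{1..r}. card {k \<in> {1..n}. q ^ i dvd k})"
    by (simp add: sum.If_cases Int_def)
  also have "\<dots> = (\<Sum>i = 1..r. n div q ^ i)"
    using q1 by (intro sum.cong refl card_multiples) simp
  finally show ?thesis .
qed

text \<open>Each term of Legendre's formula contributes at most one, and only if the prime power is at
  most \<open>2 * n\<close>.\<close>

lemma prime_power_central_binomial_le:
  assumes "prime q" "n > 0"
  shows "q ^ multiplicity q ((2 * n) choose n) \<le> 2 * n"
proof -
  have q1: "q > 1" using assms(1) by (rule prime_gt_1_nat)
  obtain r where r: "q ^ r \<le> 2 * n" "2 * n < q ^ Suc r"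
    using ex_power_ivl1[of q "2 * n"] q1 assms(2) by auto
  have nz: "(2 * n choose n) \<noteq> 0" by simp
  have "fact n * fact n * (2 * n choose n) = (fact (2 * n) :: nat)"
    using binomial_fact_lemma[of n "2 * n"] by simp
  then have "multiplicity q (fact n * fact n * (2 * n choose n)) = multiplicity q (fact (2 * n) :: nat)"
    by simp
  then have "multiplicity q (fact n :: nat) + multiplicity q (fact n :: nat) + multiplicity q (2 * n choose n)
      = multiplicity q (fact (2 * n) :: nat)"
    using assms(1) by (simp add: prime_elem_multiplicity_mult_distrib)
  then have "2 * (\<Sum>i = 1..r. n div q ^ i) + multiplicity q (2 * n choose n) = (\<Sum>i = 1..r. (2 * n) div q ^ i)"
    using multiplicity_fact[OF assms(1), of n r] multiplicity_fact[OF assms(1), of "2 * n" r] r(2) by simp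
  moreover have "(\<Sum>i = 1..r. (2 * n) div q ^ i) \<le> (\<Sum>i = 1..r. 2 * (n div q ^ i) + 1)"
  proof (rule sum_mono)
    fix i
    have qi: "q ^ i > 0" using q1 by simp
    have "n < q ^ i * (n div q ^ i + 1)"
      using qi dividend_less_times_div[of "q ^ i" n] by simp
    then have "2 * n < (2 * (n div q ^ i) + 2) * q ^ i" by (simp add: algebra_simps)
    then have "(2 * n) div q ^ i < 2 * (n div q ^ i) + 2" using qi by (simp add: div_less_iff_less_mult)
    then show "(2 * n) div q ^ i \<le> 2 * (n div q ^ i) + 1" by simp
  qed
  then have "(\<Sum>i = 1..r. (2 * n) div q ^ i) \<le> 2 * (\<Sum>i = 1..r. n div q ^ i) + r"
    by (simp only: sum.distrib sum_distrib_left[symmetric]) simp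
  ultimately have "multiplicity q (2 * n choose n) \<le> r" by linarith
  then have "q ^ multiplicity q (2 * n choose n) \<le> q ^ r" using q1 by (intro power_increasing) auto
  then show ?thesis using r(1) by linarith
qed

lemma two_square_le_power: "y \<ge> 7 \<Longrightarrow> 2 * y ^ 2 \<le> (2 :: nat) ^ y"
proof (induction y rule: dec_induct)
  case (step y)
  have "7 * y \<le> y * y" using step(1) by (intro mult_right_mono) simp_all
  then have "2 * y + 1 \<le> y ^ 2" using step(1) unfolding power2_eq_square by linarith
  then show ?case using step by (simp add: power2_eq_square)
qed simp

text \<open>Chebyshev's argument: if all prime factors of a central binomial coefficient were small, it
  would be a product of few prime powers, each of moderate size.\<close>

lemma exists_prime_between:
  fixes y :: nat
  assumes "y \<ge> 7" shows "\<exists>q. prime q \<and> y < q \<and> q \<le> 2 * y ^ 2"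
proof (rule ccontr)
  assume no: "\<not> ?thesis"
  define N where "N = y ^ 2"
  have N: "N > 0" using assms by (simp add: N_def)
  let ?b = "2 * N choose N"
  have small: "q \<le> y" if q: "q \<in> prime_factors ?b" for q
  proof -
    have "prime q" "q dvd ?b" using q by (auto simp: in_prime_factors_iff)
    have "?b dvd fact (2 * N)" using binomial_fact_lemma[of N "2 * N"] by (metis dvd_triv_right le_add2 mult_2)
    then have "q dvd fact (2 * N)" using \<open>q dvd ?b\<close> dvd_trans by blast
    then have "q \<le> 2 * N" using \<open>prime q\<close> by (simp add: prime_dvd_fact_iff)
    then show ?thesis using no \<open>prime q\<close> by (auto simp: N_def not_less)
  qed
  have "?b = (\<Prod>q\<in>prime_factors ?b. q ^ multiplicity q ?b)"
    by (rule prime_factorization_nat) simp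
  also have "\<dots> \<le> (\<Prod>q\<in>prime_factors ?b. 2 * N)"
    using N by (intro prod_mono) (auto intro: prime_power_central_binomial_le)
  also have "\<dots> = (2 * N) ^ card (prime_factors ?b)" by simp
  also have "\<dots> \<le> (2 * N) ^ y"
  proof (intro power_increasing)
    have "prime_factors ?b \<subseteq> {1..y}" using small prime_ge_1_nat by (auto simp: in_prime_factors_iff)
    then show "card (prime_factors ?b) \<le> y" using card_mono[of "{1..y}"] by fastforce
  qed (use N in simp)
  finally have "real ?b \<le> real ((2 * N) ^ y)" by (simp only: of_nat_le_iff)
  moreover have "4 ^ N / (2 * real N) \<le> real ?b"
    using central_binomial_lower_bound[of N] N by simp
  ultimately have "4 ^ N / (2 * real N) \<le> real ((2 * N) ^ y)" by linarith
  then have "4 ^ N \<le> real ((2 * N) ^ y) * (2 * real N)" using N by (simp add: divide_le_eq)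
  also have "\<dots> = real ((2 * N) ^ Suc y)" by simp
  finally have "(4 :: nat) ^ N \<le> (2 * N) ^ Suc y" by (metis of_nat_le_iff of_nat_numeral of_nat_power)
  also have "\<dots> \<le> (2 ^ y) ^ Suc y"
    using two_square_le_power[OF assms] by (intro power_mono) (auto simp: N_def)
  also have "\<dots> = 2 ^ (y * Suc y)" by (simp only: power_mult)
  finally have "(2 :: nat) ^ (2 * N) \<le> 2 ^ (y * Suc y)" by (simp add: power_mult)
  then have "2 * N \<le> y * Suc y" by (simp only: power_increasing_iff one_less_numeral_iff semiring_norm)
  then have "y ^ 2 \<le> y" by (simp add: N_def power2_eq_square)
  then show False using assms by (simp add: power2_eq_square)
qed

section \<open>A finite residue field in which a given monic polynomial vanishes\<close>

text \<open>Consider the highest coefficient of \<open>v\<close> that is not divisible by \<open>p\<close>; as \<open>f\<close> is monic, it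
  survives in \<open>f * v\<close> modulo \<open>p\<close>, in positive degree.\<close>

lemma one_notin_ideal:
  fixes f u v :: "int poly"
  assumes "p > 1" "lead_coeff f = 1" "degree f \<ge> 1"
  shows "[:int p:] * u + f * v \<noteq> 1"
proof
  assume eq: "[:int p:] * u + f * v = 1"
  have fv: "int p dvd coeff (f * v) i - (if i = 0 then 1 else 0)" for i
  proof -
    have "f * v = 1 - [:int p:] * u" using eq by (simp add: algebra_simps)
    then have "coeff (f * v) i - (if i = 0 then 1 else 0) = - (int p * coeff u i)" by simp
    then show ?thesis by simp
  qed
  show False
  proof (cases "\<forall>i. int p dvd coeff v i")
    case True
    then have "int p dvd coeff (f * v) 0" by (simp add: coeff_mult)
    moreover have "int p dvd coeff (f * v) 0 - 1" using fv[of 0] by simp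
    ultimately have "int p dvd coeff (f * v) 0 - (coeff (f * v) 0 - 1)" by (rule dvd_diff)
    then have "int p dvd 1" by simp
    then show False using assms(1) by simp
  next
    case False
    define I where "I = {i. \<not> int p dvd coeff v i}"
    have "i \<le> degree v" if "i \<in> I" for i using that by (auto simp: I_def intro: le_degree)
    then have "finite I" by (meson finite_nat_set_iff_bounded_le)
    moreover have "I \<noteq> {}" using False by (auto simp: I_def)
    ultimately have m: "Max I \<in> I" "\<And>i. i \<in> I \<Longrightarrow> i \<le> Max I" by auto
    let ?d = "degree f" and ?m = "Max I"
    have "coeff (f * v) (?d + ?m) = (\<Sum>j\<le>?d + ?m. coeff f j * coeff v (?d + ?m - j))"
      by (rule coeff_mult)
    also have "\<dots> = coeff f ?d * coeff v ?m + (\<Sum>j\<in>{..?d + ?m} - {?d}. coeff f j * coeff v (?d + ?m - j))"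
      by (subst sum.remove[of _ ?d]) auto
    finally have c: "coeff (f * v) (?d + ?m) = coeff v ?m + (\<Sum>j\<in>{..?d + ?m} - {?d}. coeff f j * coeff v (?d + ?m - j))"
      using assms(2) by simp
    have rest: "int p dvd (\<Sum>j\<in>{..?d + ?m} - {?d}. coeff f j * coeff v (?d + ?m - j))"
    proof (rule dvd_sum)
      fix j assume j: "j \<in> {..?d + ?m} - {?d}"
      show "int p dvd coeff f j * coeff v (?d + ?m - j)"
      proof (cases "j > ?d")
        case True then show ?thesis by (simp add: coeff_eq_0)
      next
        case False
        then have "?d + ?m - j > ?m" using j by auto
        then have "?d + ?m - j \<notin> I" using m(2) by force
        then show ?thesis by (simp add: I_def)
      qed
    qed
    have "int p dvd coeff (f * v) (?d + ?m)" using fv[of "?d + ?m"] assms(3) by simp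
    then have "int p dvd coeff v ?m" unfolding c using rest by (simp only: dvd_add_left_iff)
    then show False using m(1) by (simp add: I_def)
  qed
qed

text \<open>Division by \<open>f\<close> and reduction of the coefficients leave at most \<open>p ^ degree f\<close> classes modulo
  the ideal generated by \<open>p\<close> and \<open>f\<close>. Among the finitely many ideals above it choose one with the
  largest number of representatives; it is maximal, hence prime.\<close>

lemma exists_residue_field:
  fixes f :: "int poly"
  assumes p: "prime p" "p > 2" and f: "lead_coeff f = 1" "degree f \<ge> 1"
  obtains P C where "finite_residue_field P C p" "f \<in> P" "card C \<le> p ^ degree f"
proof -
  define I where "I = {a. \<exists>u v. a = [:int p:] * u + f * v}"
  define D where "D = (\<lambda>h. \<Sum>i<degree f. monom (h i) i) ` PiE {..<degree f} (\<lambda>_. {0..<int p})"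
  have finD: "finite D" by (auto simp: D_def intro: finite_PiE)
  have "card D \<le> card (PiE {..<degree f} (\<lambda>_. {0..<int p}))"
    unfolding D_def by (intro card_image_le finite_PiE) auto
  then have cardD: "card D \<le> p ^ degree f" by (simp add: card_PiE)
  have cover: "\<exists>c\<in>D. a - c \<in> I" for a
  proof -
    obtain q r where qr: "pseudo_divmod a f = (q, r)" by force
    have f0: "f \<noteq> 0" using f by auto
    have a: "a = f * q + r" and r: "r = 0 \<or> degree r < degree f"
      using pseudo_divmod[OF f0 qr] f(1) by simp_all
    define h where "h = restrict (\<lambda>i. coeff r i mod int p) {..<degree f}"
    define c where "c = (\<Sum>i<degree f. monom (h i) i)"
    have "h \<in> PiE {..<degree f} (\<lambda>_. {0..<int p})" using p(2) by (auto simp: h_def)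
    then have "c \<in> D" by (auto simp: D_def c_def)
    have "r - c = [:int p:] * (\<Sum>i<degree f. monom (coeff r i div int p) i)"
    proof (rule poly_eqI)
      fix j
      have cs: "coeff (\<Sum>i<degree f. monom (g i) i) j = (if j < degree f then g j else 0)" for g :: "nat \<Rightarrow> int"
        by (simp add: coeff_sum)
      have "coeff r j = 0" if "\<not> j < degree f" using r that by (auto simp: coeff_eq_0)
      moreover have "coeff r j - coeff r j mod int p = int p * (coeff r j div int p)"
        by (simp add: minus_mod_eq_mult_div)
      ultimately show "coeff (r - c) j = coeff ([:int p:] * (\<Sum>i<degree f. monom (coeff r i div int p) i)) j"
        by (auto simp: c_def cs h_def)
    qed
    then have "a - c = [:int p:] * (\<Sum>i<degree f. monom (coeff r i div int p) i) + f * q" using a by simp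
    then have "a - c \<in> I" unfolding I_def by blast
    then show ?thesis using \<open>c \<in> D\<close> by blast
  qed
  define G where "G S \<longleftrightarrow> I \<subseteq> S \<and> 1 \<notin> S \<and> (\<forall>a\<in>S. \<forall>b\<in>S. a + b \<in> S) \<and> (\<forall>a\<in>S. \<forall>r. r * a \<in> S)" for S :: "int poly set"
  have "G I"
  proof -
    have "1 \<notin> I" using one_notin_ideal[of p f] f p(2) by (auto simp: I_def)
    moreover have "a + b \<in> I" if "a \<in> I" "b \<in> I" for a b
    proof -
      obtain u v u' v' where "a = [:int p:] * u + f * v" "b = [:int p:] * u' + f * v'"
        using \<open>a \<in> I\<close> \<open>b \<in> I\<close> unfolding I_def by blast
      then have "a + b = [:int p:] * (u + u') + f * (v + v')" by (simp add: algebra_simps smult_add_right)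
      then show ?thesis unfolding I_def by blast
    qed
    moreover have "r * a \<in> I" if "a \<in> I" for a r
    proof -
      obtain u v where "a = [:int p:] * u + f * v" using \<open>a \<in> I\<close> unfolding I_def by blast
      then have "r * a = [:int p:] * (r * u) + f * (r * v)" by (simp add: algebra_simps)
      then show ?thesis unfolding I_def by blast
    qed
    ultimately show ?thesis by (simp add: G_def)
  qed
  have "\<exists>S. G S \<and> (\<forall>S'. G S' \<longrightarrow> card (S' \<inter> D) \<le> card (S \<inter> D))"
  proof (rule ex_has_greatest_nat[where P = G and k = I and b = "Suc (card D)", OF \<open>G I\<close>])
    show "\<forall>y. G y \<longrightarrow> card (y \<inter> D) < Suc (card D)"
      using finD by (auto simp: less_Suc_eq_le intro: card_mono)
  qed
  then obtain P where GP: "G P" and max: "\<And>S'. G S' \<Longrightarrow> card (S' \<inter> D) \<le> card (P \<inter> D)" by blast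
  have P: "I \<subseteq> P" "1 \<notin> P" "\<And>a b. a \<in> P \<Longrightarrow> b \<in> P \<Longrightarrow> a + b \<in> P" "\<And>a r. a \<in> P \<Longrightarrow> r * a \<in> P"
    using GP by (auto simp: G_def)
  have Pdiff: "a - b \<in> P" if "a \<in> P" "b \<in> P" for a b
    using P(3)[OF that(1) P(4)[OF that(2), of "-1"]] by simp
  have P0: "0 \<in> P" using P(1) by (auto simp: I_def intro!: exI[of _ 0])
  have maximal: "S' = P" if S': "G S'" "P \<subseteq> S'" for S'
  proof -
    have "P \<inter> D = S' \<inter> D"
      using max[OF S'(1)] S'(2) finD by (intro card_seteq) auto
    moreover have "x \<in> P" if x: "x \<in> S'" for x
    proof -
      obtain c where c: "c \<in> D" "x - c \<in> I" using cover by blast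
      have "x - c \<in> S'" using c(2) P(1) S'(2) by blast
      then have "x + (-1) * (x - c) \<in> S'" using x S'(1) unfolding G_def by blast
      then have "c \<in> P" using c(1) \<open>P \<inter> D = S' \<inter> D\<close> by auto
      then have "(x - c) + c \<in> P" using P(1,3) c(2) by blast
      then show ?thesis by simp
    qed
    ultimately show ?thesis using S'(2) by blast
  qed
  have prime: "a \<in> P \<or> b \<in> P" if ab: "a * b \<in> P" for a b
  proof (rule ccontr)
    assume no: "\<not> (a \<in> P \<or> b \<in> P)"
    define S' where "S' = {s + r * a | s r. s \<in> P}"
    have sub: "P \<subseteq> S'"
    proof
      fix s assume "s \<in> P"
      moreover have "s = s + 0 * a" by simp
      ultimately show "s \<in> S'" unfolding S'_def by blast
    qed
    have "a = 0 + 1 * a" by simp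
    then have "a \<in> S'" using P0 unfolding S'_def by blast
    have "x + y \<in> S'" if "x \<in> S'" "y \<in> S'" for x y
    proof -
      obtain s r s' r' where "x = s + r * a" "y = s' + r' * a" "s \<in> P" "s' \<in> P"
        using \<open>x \<in> S'\<close> \<open>y \<in> S'\<close> by (auto simp: S'_def)
      then have "x + y = (s + s') + (r + r') * a" "s + s' \<in> P" using P(3) by (auto simp: algebra_simps)
      then show ?thesis unfolding S'_def by blast
    qed
    moreover have "r * x \<in> S'" if "x \<in> S'" for x r
    proof -
      obtain s t where st: "x = s + t * a" "s \<in> P" using \<open>x \<in> S'\<close> by (auto simp: S'_def)
      then have "r * x = r * s + (r * t) * a" by (simp add: algebra_simps)
      then show ?thesis using P(4)[OF st(2), of r] unfolding S'_def by blast
    qed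
    moreover have "S' \<noteq> P" using \<open>a \<in> S'\<close> no by blast
    moreover have "I \<subseteq> S'" using P(1) sub by (rule subset_trans)
    ultimately have "1 \<in> S'" using maximal[of S'] sub unfolding G_def by blast
    then obtain s r where sr: "s \<in> P" "1 = s + r * a" by (auto simp: S'_def)
    have "b = b * (s + r * a)" using sr(2) by simp
    also have "\<dots> = b * s + r * (a * b)" by (simp add: algebra_simps)
    also have "\<dots> \<in> P" using P(3,4) sr(1) ab by blast
    finally show False using no by blast
  qed
  define rp where "rp a = (SOME c. c \<in> D \<and> a - c \<in> P)" for a
  have rp: "rp a \<in> D" "a - rp a \<in> P" for a
    using someI_ex[of "\<lambda>c. c \<in> D \<and> a - c \<in> P"] cover[of a] P(1) unfolding rp_def by auto
  have rp_cong: "rp a = rp b" if ab: "a - b \<in> P" for a b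
  proof -
    have "a - c \<in> P \<longleftrightarrow> b - c \<in> P" for c
      using P(3)[OF ab, of "b - c"] Pdiff[OF _ ab, of "a - c"] by auto
    then show ?thesis by (simp add: rp_def)
  qed
  show ?thesis
  proof (rule that)
    show "finite_residue_field P (range rp) p"
    proof
      show "(of_nat p :: int poly) \<in> P"
      proof -
        have "of_nat p = [:int p:] * 1 + f * 0" by (simp add: of_nat_poly)
        then show ?thesis using P(1) unfolding I_def by blast
      qed
      show "finite (range rp)" using finD rp(1) by (meson finite_subset image_subsetI)
      show "\<exists>c\<in>range rp. a - c \<in> P" for a using rp(2) by blast
      fix c c' assume "c \<in> range rp" "c' \<in> range rp" "c - c' \<in> P"
      then obtain a b where ab: "c = rp a" "c' = rp b" by blast
      have "(a - rp a) + (rp a - rp b) \<in> P" using P(3) rp(2) \<open>c - c' \<in> P\<close> ab by blast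
      then have "a - b \<in> P" using Pdiff[of "a - rp b" "b - rp b"] rp(2) by simp
      then show "c = c'" using rp_cong ab by simp
    qed (use P P0 p prime in auto)
    show "f \<in> P"
    proof -
      have "f = [:int p:] * 0 + f * 1" by simp
      then show ?thesis using P(1) unfolding I_def by blast
    qed
    have "card (range rp) \<le> card D" using rp(1) finD by (intro card_mono) auto
    then show "card (range rp) \<le> p ^ degree f" using cardD by simp
  qed
qed

section \<open>Algebraic eigenvalues of small degree\<close>

lemma rat_poly_clear_denominators:
  fixes q :: "rat poly"
  shows "\<exists>c g. c > 0 \<and> map_poly of_int g = Polynomial.smult (of_int c) q"
proof -
  define c where "c = (\<Prod>i\<le>degree q. snd (quotient_of (coeff q i)))"
  have c0: "c > 0" unfolding c_def by (intro prod_pos) (simp add: quotient_of_denom_pos')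
  have "\<exists>k. of_int c * coeff q i = of_int k" for i
  proof (cases "i \<le> degree q")
    case True
    obtain a b where ab: "quotient_of (coeff q i) = (a, b)" by force
    have b: "b > 0" using quotient_of_denom_pos[OF ab] .
    have "c = b * (\<Prod>i\<in>{..degree q} - {i}. snd (quotient_of (coeff q i)))"
      unfolding c_def using True by (subst prod.remove[of _ i]) (auto simp: ab)
    moreover have "coeff q i = of_int a / of_int b" using quotient_of_div[OF ab] .
    ultimately have "of_int c * coeff q i = of_int ((\<Prod>i\<in>{..degree q} - {i}. snd (quotient_of (coeff q i))) * a)"
      using b by simp
    then show ?thesis by blast
  next
    case False
    then show ?thesis by (auto simp: coeff_eq_0 intro: exI[of _ 0])
  qed
  then obtain k where k: "\<And>i. of_int c * coeff q i = of_int (k i)" by metis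
  define g where "g = (\<Sum>i\<le>degree q. monom (k i) i)"
  have "map_poly of_int g = Polynomial.smult (of_int c) q"
  proof (rule poly_eqI)
    fix j
    have "coeff g j = (if j \<le> degree q then k j else 0)" by (simp add: g_def coeff_sum)
    then show "coeff (map_poly of_int g) j = coeff (Polynomial.smult (of_int c) q) j"
      using k[of j] by (cases "j \<le> degree q") (simp_all add: coeff_map_poly coeff_eq_0)
  qed
  then show ?thesis using c0 by blast
qed

abbreviation cpoly :: "int poly \<Rightarrow> complex poly" where "cpoly \<equiv> map_poly of_int"

lemma int_poly_of_algebraic:
  assumes "algebraic z"
  obtains g :: "int poly" where "g \<noteq> 0" "degree g = algebraic_degree z" "poly (cpoly g) z = 0"
    "\<And>q. q \<noteq> 0 \<Longrightarrow> poly (cpoly q) z = 0 \<Longrightarrow> degree g \<le> degree q"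
proof -
  have mp: "is_minimal_poly z (minimal_poly z)" by (rule is_minimal_poly_minimal_poly[OF assms])
  obtain c g where c: "c > 0" and g: "map_poly of_int g = Polynomial.smult (of_int c) (minimal_poly z)"
    using rat_poly_clear_denominators by blast
  have conv: "cpoly q = map_poly of_rat (map_poly of_int q :: rat poly)" for q
    by (intro poly_eqI) (simp add: coeff_map_poly)
  have deg: "degree (map_poly of_int q :: rat poly) = degree q" for q :: "int poly"
    by (intro degree_map_poly) simp
  have "degree g = algebraic_degree z"
    using deg[of g] c by (simp add: g algebraic_degree_def)
  moreover have "minimal_poly z \<noteq> 0" using mp by (auto simp: is_minimal_poly_def)
  then have "g \<noteq> 0" using g c by auto
  moreover have "poly (cpoly g) z = 0"
  proof -
    have "cpoly g = Polynomial.smult (of_int c) (map_poly of_rat (minimal_poly z))"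
      unfolding conv g by (intro poly_eqI) (simp add: coeff_map_poly of_rat_mult)
    then show ?thesis using mp by (simp add: is_minimal_poly_def)
  qed
  moreover have "degree g \<le> degree q" if "q \<noteq> 0" "poly (cpoly q) z = 0" for q
  proof -
    have "(map_poly of_int q :: rat poly) \<noteq> 0" using that(1) deg[of q]
      by (metis coeff_0 coeff_map_poly leading_coeff_0_iff of_int_0 of_int_eq_0_iff)
    then have "degree (minimal_poly z) \<le> degree (map_poly of_int q :: rat poly)"
      using mp that(2) unfolding is_minimal_poly_def conv by blast
    then show ?thesis using \<open>degree g = algebraic_degree z\<close> deg[of q] by (simp add: algebraic_degree_def)
  qed
  ultimately show ?thesis using that by blast
qed

text \<open>Pseudo-division of \<open>h\<close> by an integral multiple \<open>g\<close> of the minimal polynomial leaves no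
  remainder, by minimality of the degree. Comparing contents (Gauss's lemma) turns this into a
  factorization of \<open>h\<close> into primitive polynomials, whose leading coefficients are units because \<open>h\<close> is
  monic.\<close>

lemma monic_factor_of_algebraic_root:
  fixes h :: "int poly"
  assumes h: "lead_coeff h = 1" "poly (cpoly h) z = 0" and z: "algebraic z"
  obtains f where "lead_coeff f = 1" "1 \<le> degree f" "degree f = algebraic_degree z" "f dvd h"
proof -
  obtain g where g: "g \<noteq> 0" "degree g = algebraic_degree z" "poly (cpoly g) z = 0"
    and min: "\<And>q. q \<noteq> 0 \<Longrightarrow> poly (cpoly q) z = 0 \<Longrightarrow> degree g \<le> degree q"
    using int_poly_of_algebraic[OF z] by blast
  obtain q r where qr: "pseudo_divmod h g = (q, r)" by force
  define e where "e = coeff g (degree g) ^ (Suc (degree h) - degree g)"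
  have e: "Polynomial.smult e h = g * q + r" and r: "r = 0 \<or> degree r < degree g"
    using pseudo_divmod[OF g(1) qr] by (simp_all add: e_def)
  have e0: "e \<noteq> 0" using g(1) by (simp add: e_def)
  have "cpoly r = Polynomial.smult (of_int e) (cpoly h) - cpoly g * cpoly q"
  proof -
    have "r = Polynomial.smult e h - g * q" using e by simp
    then show ?thesis by (simp add: hom_distribs)
  qed
  then have "poly (cpoly r) z = 0" using h(2) g(3) by simp
  then have "r = 0" using min[of r] r by (metis not_le)
  with e have eq: "Polynomial.smult e h = g * q" by simp
  define a where "a = primitive_part g" define b where "b = primitive_part q"
  have "content h = 1"
  proof -
    have "content h dvd lead_coeff h" by (rule content_dvd_coeff)
    then show ?thesis using h(1) by (metis is_unit_content_iff)
  qed
  then have "\<bar>e\<bar> = content g * content q"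
    using arg_cong[OF eq, of content] by (simp add: content_mult)
  moreover have "g * q = Polynomial.smult (content g * content q) (a * b)"
    unfolding a_def b_def
    by (metis content_times_primitive_part mult_smult_left mult_smult_right smult_smult)
  ultimately have "Polynomial.smult e h = Polynomial.smult \<bar>e\<bar> (a * b)" using eq by simp
  then have "Polynomial.smult e h = Polynomial.smult e (Polynomial.smult (sgn e) (a * b))"
    by (simp add: abs_sgn mult.commute)
  then have "Polynomial.smult e (h - Polynomial.smult (sgn e) (a * b)) = 0"
    by (simp only: smult_diff_right diff_self)
  then have hab: "h = Polynomial.smult (sgn e) (a * b)"
    using e0 by (simp only: smult_eq_0_iff simp_thms right_minus_eq)
  have "lead_coeff a * (sgn e * lead_coeff b) = 1"
  proof -
    have "lead_coeff h = sgn e * (lead_coeff a * lead_coeff b)"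
      unfolding hab by (simp only: lead_coeff_smult lead_coeff_mult)
    then show ?thesis using h(1) by (simp only: mult.left_commute)
  qed
  then have la: "lead_coeff a = 1 \<or> lead_coeff a = -1"
    using zmult_eq_1_iff by blast
  define f where "f = Polynomial.smult (lead_coeff a) a"
  have lf: "lead_coeff f = 1" using la by (auto simp: f_def)
  have df: "degree f = algebraic_degree z" using la g(2) by (auto simp: f_def a_def)
  have "h = f * Polynomial.smult (sgn e * lead_coeff a) b"
  proof -
    have "lead_coeff a * lead_coeff a = 1" using la by auto
    then show ?thesis unfolding hab f_def
      by (simp only: mult_smult_left mult_smult_right smult_smult mult.assoc mult_1_right)
  qed
  then have "f dvd h" by (rule dvdI)
  moreover have "degree f \<ge> 1"
  proof (rule ccontr)
    assume "\<not> degree f \<ge> 1"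
    then have "degree g = 0" using df g(2) by simp
    then obtain x where x: "g = [:x:]" by (rule degree_eq_zeroE)
    then show False using g(1,3) by (simp add: map_poly_pCons)
  qed
  ultimately show ?thesis using that lf df by blast
qed

text \<open>Multiplication by a linear factor increases the largest coefficient by a factor of at most
  \<open>1 + R\<close>.\<close>

lemma norm_coeff_prod_linear_le:
  fixes R :: real
  assumes "\<And>a. a \<in> set as \<Longrightarrow> cmod a \<le> R" "R \<ge> 0"
  shows "cmod (coeff (\<Prod>a\<leftarrow>as. [:- a, 1:]) i) \<le> (1 + R) ^ length as"
  using assms(1)
proof (induction as arbitrary: i)
  case Nil
  then show ?case by (simp add: coeff_1)
next
  case (Cons a as)
  let ?q = "\<Prod>a\<leftarrow>as. [:- a, 1:]"
  have q: "cmod (coeff ?q i) \<le> (1 + R) ^ length as" for i using Cons by simp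
  have "coeff ([:- a, 1:] * ?q) i = - a * coeff ?q i + (if i = 0 then 0 else coeff ?q (i - 1))"
    by (cases i) (simp_all add: coeff_pCons)
  also have "cmod \<dots> \<le> cmod a * cmod (coeff ?q i) + cmod (if i = 0 then 0 else coeff ?q (i - 1))"
    by (rule order_trans[OF norm_triangle_ineq]) (simp add: norm_mult)
  also have "\<dots> \<le> R * (1 + R) ^ length as + (1 + R) ^ length as"
    using Cons.prems[of a] q assms(2) by (intro add_mono mult_mono) auto
  finally show ?case by (simp add: algebra_simps)
qed

text \<open>Consider an entry of largest modulus in an eigenvector.\<close>

lemma eigenvalue_norm_le:
  fixes A :: "complex mat"
  assumes A: "A \<in> carrier_mat n n" and W: "\<And>i j. i < n \<Longrightarrow> j < n \<Longrightarrow> cmod (A $$ (i, j)) \<le> W"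
    and ev: "eigenvalue A z"
  shows "cmod z \<le> real n * W"
proof -
  obtain v where v: "v \<in> carrier_vec n" "v \<noteq> 0\<^sub>v n" "A *\<^sub>v v = z \<cdot>\<^sub>v v"
    using ev A by (auto simp: eigenvalue_def eigenvector_def)
  obtain i0 where i0: "i0 < n" "vec_index v i0 \<noteq> 0" using v(1,2) by (metis carrier_vecD eq_vecI index_zero_vec)
  let ?S = "(\<lambda>i. cmod (vec_index v i)) ` {..<n}"
  have "Max ?S \<in> ?S" using i0 by (intro Max_in) auto
  then obtain i where "i < n" "Max ?S = cmod (vec_index v i)" by auto
  moreover have "cmod (vec_index v j) \<le> Max ?S" if "j < n" for j using that by (intro Max_ge) auto
  ultimately have i: "i < n" "\<And>j. j < n \<Longrightarrow> cmod (vec_index v j) \<le> cmod (vec_index v i)" by auto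
  have pos: "cmod (vec_index v i) > 0" using i(2)[OF i0(1)] i0(2) by (metis less_le_trans zero_less_norm_iff)
  have "z * vec_index v i = vec_index (A *\<^sub>v v) i" using v i(1) by simp
  also have "\<dots> = (\<Sum>j<n. A $$ (i, j) * vec_index v j)"
    using A v(1) i(1) by (simp add: scalar_prod_def atLeast0LessThan)
  finally have "cmod z * cmod (vec_index v i) = cmod (\<Sum>j<n. A $$ (i, j) * vec_index v j)"
    by (simp add: norm_mult[symmetric])
  also have "\<dots> \<le> (\<Sum>j<n. W * cmod (vec_index v i))"
  proof (rule order_trans[OF norm_sum], rule sum_mono)
    fix j assume "j \<in> {..<n}"
    then show "cmod (A $$ (i, j) * vec_index v j) \<le> W * cmod (vec_index v i)"
      unfolding norm_mult using W[of i j] i by (intro mult_mono) (auto intro: order_trans[OF norm_ge_zero])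
  qed
  finally have "cmod z * cmod (vec_index v i) \<le> (real n * W) * cmod (vec_index v i)" by simp
  then show ?thesis using pos by simp
qed

lemma mat_product_entry_le:
  assumes "\<And>M. M \<in> set Ms \<Longrightarrow> M \<in> carrier_mat n n"
    and "\<And>M i j. M \<in> set Ms \<Longrightarrow> i < n \<Longrightarrow> j < n \<Longrightarrow> \<bar>M $$ (i, j)\<bar> \<le> (1 :: int)"
  shows "mat_product n Ms \<in> carrier_mat n n \<and>
    (\<forall>i<n. \<forall>j<n. \<bar>mat_product n Ms $$ (i, j)\<bar> \<le> int n ^ length Ms)"
  using assms
proof (induction Ms)
  case Nil
  then show ?case by (auto simp: mat_product_def)
next
  case (Cons M Ms)
  define A where "A = mat_product n Ms"
  have A: "A \<in> carrier_mat n n" "\<And>i j. i < n \<Longrightarrow> j < n \<Longrightarrow> \<bar>A $$ (i, j)\<bar> \<le> int n ^ length Ms"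
    using Cons by (auto simp: A_def)
  have M: "M \<in> carrier_mat n n" "\<And>i j. i < n \<Longrightarrow> j < n \<Longrightarrow> \<bar>M $$ (i, j)\<bar> \<le> 1" using Cons.prems by auto
  have prod: "mat_product n (M # Ms) = M * A" by (simp add: mat_product_def A_def)
  have "\<bar>(M * A) $$ (i, j)\<bar> \<le> int n ^ length (M # Ms)" if ij: "i < n" "j < n" for i j
  proof -
    have "(M * A) $$ (i, j) = (\<Sum>l<n. M $$ (i, l) * A $$ (l, j))"
      using M(1) A(1) ij by (simp add: scalar_prod_def atLeast0LessThan)
    also have "\<bar>\<dots>\<bar> \<le> (\<Sum>l<n. 1 * int n ^ length Ms)"
    proof (rule order_trans[OF sum_abs], rule sum_mono)
      fix l assume "l \<in> {..<n}"
      then show "\<bar>M $$ (i, l) * A $$ (l, j)\<bar> \<le> 1 * int n ^ length Ms"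
        unfolding abs_mult using M(2)[of i l] A(2)[of l j] ij by (intro mult_mono) auto
    qed
    finally show ?thesis by simp
  qed
  then show ?case using M A by (auto simp: prod)
qed

definition factor_candidates :: "nat \<Rightarrow> int \<Rightarrow> int poly set" where
  "factor_candidates d H = {f. lead_coeff f = 1 \<and> 1 \<le> degree f \<and> degree f \<le> d \<and> (\<forall>i. \<bar>coeff f i\<bar> \<le> H)}"

lemma factor_candidates_card:
  assumes "H \<ge> 0"
  shows "finite (factor_candidates d H)" "card (factor_candidates d H) \<le> nat (2 * H + 1) ^ (d + 1)"
proof -
  let ?h = "\<lambda>f. restrict (coeff f) {..d}"
  have inj: "inj_on ?h (factor_candidates d H)"
  proof (rule inj_onI, rule poly_eqI)
    fix f g i assume fg: "f \<in> factor_candidates d H" "g \<in> factor_candidates d H" "?h f = ?h g"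
    show "coeff f i = coeff g i"
    proof (cases "i \<le> d")
      case True then show ?thesis using fun_cong[OF fg(3), of i] by simp
    next
      case False then show ?thesis using fg by (simp add: factor_candidates_def coeff_eq_0)
    qed
  qed
  have sub: "?h ` factor_candidates d H \<subseteq> PiE {..d} (\<lambda>_. {-H..H})"
  proof (intro image_subsetI restrict_PiE_iff[THEN iffD2] ballI)
    fix f i assume "f \<in> factor_candidates d H"
    then have "\<bar>coeff f i\<bar> \<le> H" by (simp add: factor_candidates_def)
    then show "coeff f i \<in> {-H..H}" by simp linarith
  qed
  have fin: "finite (PiE {..d} (\<lambda>_. {-H..H}))" by (intro finite_PiE) auto
  show "finite (factor_candidates d H)" using inj sub fin by (meson finite_imageD finite_subset)
  have "card (factor_candidates d H) \<le> card (PiE {..d} (\<lambda>_. {-H..H}))"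
    using inj sub fin by (rule card_inj_on_le)
  also have "\<dots> = nat (2 * H + 1) ^ (d + 1)" by (simp add: card_PiE algebra_simps)
  finally show "card (factor_candidates d H) \<le> nat (2 * H + 1) ^ (d + 1)" .
qed

text \<open>All eigenvalues are at most \<open>n ^ (m + 1)\<close> in modulus, so the possible minimal polynomials
  have polynomially bounded coefficients.\<close>

lemma exists_factor_candidate:
  fixes Ms :: "int mat list"
  assumes Ms: "\<And>M. M \<in> set Ms \<Longrightarrow> M \<in> carrier_mat n n"
      "\<And>M i j. M \<in> set Ms \<Longrightarrow> i < n \<Longrightarrow> j < n \<Longrightarrow> \<bar>M $$ (i, j)\<bar> \<le> 1"
    and z: "eigenvalue (map_mat of_int (mat_product n Ms) :: complex mat) z" "algebraic z" "algebraic_degree z \<le> d"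
  shows "\<exists>f \<in> factor_candidates d ((1 + int n ^ (length Ms + 1)) ^ d). f dvd char_poly (mat_product n Ms)"
proof -
  define A where "A = mat_product n Ms"
  define R where "R = real n ^ (length Ms + 1)"
  have A: "A \<in> carrier_mat n n" "\<And>i j. i < n \<Longrightarrow> j < n \<Longrightarrow> \<bar>A $$ (i, j)\<bar> \<le> int n ^ length Ms"
    using mat_product_entry_le[OF Ms] by (auto simp: A_def)
  let ?A = "map_mat of_int A :: complex mat"
  have Ac: "?A \<in> carrier_mat n n" using A by simp
  have cp: "char_poly ?A = cpoly (char_poly A)" by (rule of_int_hom.char_poly_hom[OF A(1)])
  have bound: "cmod x \<le> R" if "poly (char_poly ?A) x = 0" for x
  proof -
    have "eigenvalue ?A x" using eigenvalue_root_char_poly[OF Ac] that by simp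
    moreover have "cmod (?A $$ (i, j)) \<le> real n ^ length Ms" if "i < n" "j < n" for i j
    proof -
      have "real_of_int \<bar>A $$ (i, j)\<bar> \<le> real_of_int (int n ^ length Ms)"
        using A(2)[OF that] by (simp only: of_int_le_iff)
      then show ?thesis using that A(1) by simp
    qed
    ultimately have "cmod x \<le> real n * real n ^ length Ms" using eigenvalue_norm_le[OF Ac] by blast
    then show ?thesis by (simp add: R_def)
  qed
  have monic: "lead_coeff (char_poly A) = 1" using degree_monic_char_poly[OF A(1)] by simp
  have "poly (cpoly (char_poly A)) z = 0"
    using z(1) eigenvalue_root_char_poly[OF Ac] by (simp add: A_def[symmetric] cp)
  then obtain f where f: "lead_coeff f = 1" "1 \<le> degree f" "degree f = algebraic_degree z" "f dvd char_poly A"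
    using monic_factor_of_algebraic_root[OF monic _ z(2)] by blast
  have dc: "degree (cpoly f) = degree f" by (intro degree_map_poly) simp
  obtain as where as: "Polynomial.smult (coeff (cpoly f) (degree (cpoly f))) (\<Prod>a\<leftarrow>as. [:- a, 1:]) = cpoly f" "length as = degree (cpoly f)"
    using fundamental_theorem_algebra_factorized by blast
  have lin: "(\<Prod>a\<leftarrow>as. [:- a, 1:]) = cpoly f" using as(1) f(1) by (simp add: dc coeff_map_poly)
  have "\<bar>coeff f i\<bar> \<le> (1 + int n ^ (length Ms + 1)) ^ d" for i
  proof -
    have "cmod a \<le> R" if a: "a \<in> set as" for a
    proof (rule bound)
      have "[:- a, 1:] dvd cpoly f" unfolding lin[symmetric] using a by (intro prod_list_dvd) auto
      also have "cpoly f dvd cpoly (char_poly A)"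
        using f(4) by (auto simp: dvd_def of_int_poly_hom.hom_mult)
      finally show "poly (char_poly ?A) a = 0" by (simp add: cp dvd_iff_poly_eq_0)
    qed
    then have "cmod (coeff (cpoly f) i) \<le> (1 + R) ^ degree f"
      using norm_coeff_prod_linear_le[of as R i] lin as(2) dc by (simp add: R_def)
    also have "\<dots> \<le> (1 + R) ^ d" using f(3) z(3) by (intro power_increasing) (auto simp: R_def)
    finally have "real_of_int \<bar>coeff f i\<bar> \<le> real_of_int ((1 + int n ^ (length Ms + 1)) ^ d)"
      by (simp add: coeff_map_poly R_def)
    then show ?thesis by (simp only: of_int_le_iff)
  qed
  then have "f \<in> factor_candidates d ((1 + int n ^ (length Ms + 1)) ^ d)"
    using f z(3) by (simp add: factor_candidates_def)
  then show ?thesis using f(4) by (auto simp: A_def)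
qed

section \<open>Choice of the parameters\<close>

text \<open>The free parameters are expressed through \<open>u\<close>: index sets have at least \<open>u ^ 4\<close> elements, the
  small ball of characters has radius \<open>u\<close>, and the large one, of radius a multiple of \<open>u\<^sup>2\<close>, is
  wider by the factor that gives the saving \<open>u div (8 * d)\<close>.\<close>

lemma (in finite_residue_field) prob_shift_singular_le:
  fixes d u k n :: nat and \<rho> :: real
  assumes d: "card C \<le> p ^ d" "d \<ge> 1" and u: "u div (8 * d) > 0" and k: "2 * k < p" and n: "n > 0"
    and \<rho>: "16 ^ k * (k ^ (2 * k) / (u ^ 4) ^ k) / (u div (8 * d)) + 1 / p + exp (- (real u)\<^sup>2 / 8) \<le> \<rho> / 2"
    and \<gamma>: "\<gamma> \<notin> P" and B: "B \<in> carrier_mat n n"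
  shows "measure_pmf.prob (random_sign_matrix n) {M. Determinant.det (\<gamma> \<cdot>\<^sub>m map_mat of_int M + B) \<in> P}
    \<le> real n * (2 ^ n * (2 * 16 ^ k / (u div (8 * d))) ^ (n - 1) * real (card C) ^ (u ^ 4)
        + real n ^ (u ^ 4) * real (card C) ^ (u ^ 4) * (1 / 2) ^ (n - 1) + \<rho>)"
proof -
  define m where "m = u div (8 * d)"
  \<comment> \<open>The number of entries that may be discarded in each of the \<open>d\<close> steps.\<close>
  define \<sigma> where "\<sigma> = real (u ^ 4) / (4 * real d)"
  have m0: "m > 0" using u by (simp add: m_def)
  have u0: "u > 0" using u by (cases u) auto
  have d0: "real d \<ge> 1" using d(2) by simp
  have "m * (8 * d) \<le> u" by (simp add: m_def)
  then have "real (m * (8 * d)) \<le> real u" by (simp only: of_nat_le_iff)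
  then have m_le: "real m * (8 * real d) \<le> real u" by simp
  have \<sigma>: "\<sigma> \<ge> 0" "real d * \<sigma> \<le> real (u ^ 4) / 2" "\<sigma> \<le> real (u ^ 4) / 4"
  proof -
    show "\<sigma> \<ge> 0" by (simp add: \<sigma>_def)
    show "real d * \<sigma> \<le> real (u ^ 4) / 2" using d0 by (simp add: \<sigma>_def)
    show "\<sigma> \<le> real (u ^ 4) / 4" unfolding \<sigma>_def using d0 by (intro divide_left_mono) auto
  qed
  have "(4 * real u * real m)\<^sup>2 \<le> 2 * \<sigma>"
  proof -
    have "(4 * real u * real m)\<^sup>2 * (4 * (real d)\<^sup>2) = (real u)\<^sup>2 * (real m * (8 * real d))\<^sup>2"
      by (simp add: power2_eq_square)
    also have "\<dots> \<le> (real u)\<^sup>2 * (real u)\<^sup>2"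
      using m_le by (intro mult_left_mono power_mono) auto
    also have "\<dots> = 2 * \<sigma> * (2 * real d)" using d0 by (simp add: \<sigma>_def power2_eq_square power4_eq_xxxx)
    also have "\<dots> \<le> 2 * \<sigma> * (4 * (real d)\<^sup>2)"
      using d0 \<sigma>(1) by (intro mult_left_mono) (auto simp: power2_eq_square)
    finally show ?thesis using d0 by simp
  qed
  then have c: "4 * real u * real m \<le> sqrt (2 * \<sigma>)" by (rule real_le_rsqrt)
  let ?Bad = "bad_vectors {..<n} \<rho>"
  have \<rho>0: "\<rho> \<ge> 0"
  proof -
    have "0 \<le> \<rho> / 2" by (rule order_trans[OF _ \<rho>]) (intro add_nonneg_nonneg; simp)
    then show ?thesis by simp
  qed
  have Nn: "card {..<n} \<le> Suc (n - 1)" by simp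
  have s1: "1 \<le> u ^ 4" using u0 by simp
  obtain \<beta> where \<beta>: "\<And>w. w \<in> ?Bad \<Longrightarrow> \<beta> w \<ge> 0" "\<And>w. w \<in> ?Bad \<Longrightarrow> conc {..<n} w (\<beta> w)"
    "(\<Sum>w\<in>?Bad. \<beta> w ^ (n - 1)) \<le> 2 ^ card {..<n} * (2 * 16 ^ k / m) ^ (n - 1) * real (card C) ^ (u ^ 4)
        + card {..<n} ^ (u ^ 4) * real (card C) ^ (u ^ 4) * (1 / 2) ^ (n - 1)"
    by (rule bad_vectors_sum[of "{..<n}" "n - 1" "u ^ 4" k d \<sigma> "real u" m \<rho>])
      (use Nn s1 k d(1) \<sigma> u0 m0 c \<rho> in \<open>auto simp: m_def\<close>)
  have "measure_pmf.prob (random_sign_matrix n) {M. Determinant.det (\<gamma> \<cdot>\<^sub>m map_mat of_int M + B) \<in> P}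
      \<le> real n * ((\<Sum>w\<in>?Bad. \<beta> w ^ (n - 1)) + \<rho>)"
    using \<beta>(1,2) by (intro prob_singular_le \<gamma> n \<rho>0 B) auto
  also have "\<dots> \<le> real n * (2 ^ n * (2 * 16 ^ k / m) ^ (n - 1) * real (card C) ^ (u ^ 4)
        + real n ^ (u ^ 4) * real (card C) ^ (u ^ 4) * (1 / 2) ^ (n - 1) + \<rho>)"
    using \<beta>(3) by (intro mult_left_mono add_right_mono) auto
  finally show ?thesis by (simp add: m_def)
qed

text \<open>The contribution of the bad vectors of large support: the saving in each of the \<open>n - 1\<close> rows is
  of order \<open>n powr (1/8)\<close>, while the \<open>s = u ^ 4\<close> free entries cost only \<open>n powr (g * sqrt n)\<close>.\<close>

lemma eventually_dense_term_small:
  fixes D g G :: real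
  assumes "D > 0"
  shows "\<forall>\<^sub>F n in sequentially.
    2 ^ n * (D / real n powr (1/8)) ^ (n - 1) * real n powr (g * sqrt (real n)) \<le> real n powr (- G)"
proof -
  define c where "c = ln D"
  have "\<forall>\<^sub>F n in sequentially.
      real n * ln 2 + (real n - 1) * (c - ln (real n) / 8) + g * sqrt (real n) * ln (real n) \<le> - G * ln (real n)"
    by real_asymp
  then show ?thesis using eventually_gt_at_top[of 1]
  proof eventually_elim
    case (elim n)
    have n: "real n > 0" using elim by simp
    have "(2 :: real) ^ n = exp (real n * ln 2)" by (simp add: exp_of_nat_mult)
    moreover have "D / real n powr (1/8) = exp (c - ln (real n) / 8)"
      using assms n by (simp add: c_def exp_diff powr_def)
    then have "(D / real n powr (1/8)) ^ (n - 1) = exp ((real n - 1) * (c - ln (real n) / 8))"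
      using elim by (simp add: exp_of_nat_mult[symmetric] of_nat_diff)
    moreover have "real n powr (g * sqrt (real n)) = exp (g * sqrt (real n) * ln (real n))"
      using n by (simp add: powr_def)
    moreover have "real n powr (- G) = exp (- G * ln (real n))" using n by (simp add: powr_def)
    ultimately show ?case using elim(1) by (simp flip: exp_add)
  qed
qed

lemma eventually_sparse_term_small:
  fixes g G :: real
  shows "\<forall>\<^sub>F n in sequentially.
    real n powr (g * sqrt (real n)) * (1 / 2) ^ (n - 1) \<le> real n powr (- G)"
proof -
  have "\<forall>\<^sub>F n in sequentially.
      g * sqrt (real n) * ln (real n) - (real n - 1) * ln 2 \<le> - G * ln (real n)"
    by real_asymp
  then show ?thesis using eventually_gt_at_top[of 1]
  proof eventually_elim
    case (elim n)
    have n: "real n > 0" using elim by simp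
    have half: "(1 / 2 :: real) = exp (- ln 2)" by (simp add: exp_minus)
    have "(1 / 2 :: real) ^ (n - 1) = exp (real (n - 1) * (- ln 2))"
      unfolding half by (rule exp_of_nat_mult[symmetric])
    also have "real (n - 1) * (- ln 2) = - ((real n - 1) * ln 2)"
      using elim by (simp add: of_nat_diff)
    finally have "(1 / 2 :: real) ^ (n - 1) = exp (- ((real n - 1) * ln 2))" .
    moreover have "real n powr (g * sqrt (real n)) = exp (g * sqrt (real n) * ln (real n))"
      using n by (simp add: powr_def)
    moreover have "real n powr (- G) = exp (- G * ln (real n))" using n by (simp add: powr_def)
    ultimately show ?case using elim(1) by (simp flip: exp_add)
  qed
qed

lemma eventually_error_small:
  fixes c G :: real
  shows "\<forall>\<^sub>F n in sequentially.
    c * real n powr (- G - 1) + real n powr (- G - 1) + exp (- (real n powr (1/8) / 2)\<^sup>2 / 8) \<le> real n powr (- G) / 2"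
proof -
  have "\<forall>\<^sub>F n in sequentially.
      c / real n + 1 / real n + exp (G * ln (real n) - (real n powr (1/8) / 2)\<^sup>2 / 8) \<le> 1 / 2"
    by real_asymp
  then show ?thesis using eventually_gt_at_top[of 0]
  proof eventually_elim
    case (elim n)
    have n: "real n > 0" using elim by simp
    define Z where "Z = (real n powr (1/8) / 2)\<^sup>2 / 8"
    have Z: "- (real n powr (1/8) / 2)\<^sup>2 / 8 = - Z" by (simp add: Z_def)
    have "real n powr (- G) = exp (- G * ln (real n))" using n by (simp add: powr_def)
    then have e: "exp (- Z) = real n powr (- G) * exp (G * ln (real n) - Z)" by (simp add: exp_add[symmetric])
    have d: "real n powr (- G - 1) = real n powr (- G) / real n" using n by (simp add: powr_diff)
    have "c * real n powr (- G - 1) + real n powr (- G - 1) + exp (- (real n powr (1/8) / 2)\<^sup>2 / 8)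
        = real n powr (- G) * (c / real n + 1 / real n + exp (G * ln (real n) - (real n powr (1/8) / 2)\<^sup>2 / 8))"
      unfolding Z Z_def[symmetric] e d by (simp only: distrib_left times_divide_eq_right mult.commute[of c] mult_1_right)
    also have "\<dots> \<le> real n powr (- G) * (1 / 2)"
      using elim(1) by (intro mult_left_mono) auto
    finally show ?case by simp
  qed
qed

text \<open>Take \<open>u\<close> about \<open>n powr (1/8)\<close> and \<open>k\<close> slightly above \<open>2 * G\<close>. The lower bound on \<open>p\<close> makes the term
  \<open>1 / p\<close> negligible, the upper bound keeps the \<open>u ^ 4\<close> free entries of a bad vector cheap.\<close>

lemma eventually_prob_shift_singular_le:
  fixes d G :: nat
  assumes d: "d \<ge> 1"
  shows "\<forall>\<^sub>F n in sequentially. \<forall>(P :: 'a::comm_ring_1 set) C p \<gamma> B.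
    finite_residue_field P C p \<longrightarrow> card C \<le> p ^ d \<longrightarrow> n ^ (G + 1) < p \<longrightarrow> p \<le> 2 * (n ^ (G + 1)) ^ 2 \<longrightarrow>
    \<gamma> \<notin> P \<longrightarrow> B \<in> carrier_mat n n \<longrightarrow>
    measure_pmf.prob (random_sign_matrix n) {M. Determinant.det (\<gamma> \<cdot>\<^sub>m map_mat of_int M + B) \<in> P}
      \<le> 3 * real n * real n powr (- real G)"
proof -
  \<comment> \<open>The formally cancelling tuples have density about \<open>(u ^ 4) powr - k\<close>, so \<open>k > 2 * G\<close> is needed.\<close>
  define k where "k = 2 * G + 2"
  define g where "g = real ((2 * G + 3) * d) + 1"
  define D where "D = 2 * 16 ^ k * (32 * real d)"
  have D0: "D > 0" using d by (simp add: D_def)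
  have ev: "\<forall>\<^sub>F n in sequentially. real n powr (1/8) \<ge> 64 * real d \<and> n > 2 * k"
    by (intro eventually_conj eventually_gt_at_top) real_asymp
  show ?thesis
    using ev eventually_dense_term_small[OF D0, of g "real G"] eventually_sparse_term_small[of g "real G"]
      eventually_error_small[of "16 ^ k * real k ^ (2 * k) * 16 ^ k" "real G"]
  proof eventually_elim
    case (elim n)
    define x where "x = real n powr (1/8)"
    define u where "u = nat \<lfloor>x\<rfloor>"
    define m where "m = u div (8 * d)"
    have n: "n > 2 * k" "n \<ge> 4" "real n > 0" using elim(1) by (auto simp: k_def)
    have x: "x \<ge> 64 * real d" "x \<ge> 64" "x > 0" using elim(1) d by (auto simp: x_def)
    have u_le: "real u \<le> x" and u_ge: "x < real u + 1" using x by (simp_all add: u_def)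
    have u_half: "x / 2 \<le> real u" using u_ge x by linarith
    have u0: "real u > 0" using u_half x by linarith
    have x4: "x ^ 4 = sqrt (real n)" and x8: "x ^ 8 = real n"
      using n by (simp_all add: x_def powr_realpow[symmetric] powr_powr powr_half_sqrt)
    have m_ge: "x / (32 * real d) \<le> real m"
    proof -
      have "u < 8 * d * (m + 1)" using d dividend_less_times_div[of "8 * d" u] by (simp add: m_def)
      then have "real u < real (8 * d * (m + 1))" by (simp only: of_nat_less_iff)
      then have "real u < 8 * real d * (real m + 1)" by (simp add: algebra_simps)
      then have "x / 2 < 8 * real d * (real m + 1)" using u_half by linarith
      also have "\<dots> = 8 * real d * real m + 8 * real d" by (simp add: algebra_simps)
      finally have "x / 4 \<le> 8 * real d * real m" using x(1) by linarith
      then show ?thesis using d by (simp add: field_simps)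
    qed
    have "x / (32 * real d) > 0" using x d by simp
    then have m0: "m > 0" using m_ge by (cases m) auto
    show ?case
    proof (intro allI impI)
      fix P C :: "'a set" and p and \<gamma> :: 'a and B :: "'a mat"
      assume frf: "finite_residue_field P C p" and C: "card C \<le> p ^ d"
        and p: "n ^ (G + 1) < p" "p \<le> 2 * (n ^ (G + 1)) ^ 2" and \<gamma>: "\<gamma> \<notin> P" and B: "B \<in> carrier_mat n n"
      interpret finite_residue_field P C p by (rule frf)
      define \<rho> where "\<rho> = real n powr (- real G)"
      have "2 * k < p"
      proof -
        have "n ^ 1 \<le> n ^ (G + 1)" using n by (intro power_increasing) auto
        then show ?thesis using n(1) p(1) unfolding power_one_right by linarith
      qed
      have err: "16 ^ k * (k ^ (2 * k) / (u ^ 4) ^ k) / (u div (8 * d)) + 1 / p + exp (- (real u)\<^sup>2 / 8) \<le> \<rho> / 2"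
      proof -
        have "x ^ (4 * k) = real n powr (real G + 1)"
        proof -
          have "4 * k = 8 * (G + 1)" by (simp add: k_def)
          then have "x ^ (4 * k) = real n ^ (G + 1)" unfolding x8[symmetric] by (simp only: power_mult)
          also have "\<dots> = real n powr real (G + 1)" using n by (intro powr_realpow[symmetric]) auto
          finally show ?thesis by (simp only: of_nat_add of_nat_1)
        qed
        then have "(real u ^ 4) ^ k \<ge> real n powr (real G + 1) / 16 ^ k"
        proof -
          have "(x / 2) ^ (4 * k) \<le> real u ^ (4 * k)" using u_half x by (intro power_mono) auto
          then show ?thesis using \<open>x ^ (4 * k) = _\<close> by (simp add: power_divide power_mult)
        qed
        then have "1 / (real u ^ 4) ^ k \<le> 1 / (real n powr (real G + 1) / 16 ^ k)"
          using n u0 by (intro divide_left_mono mult_pos_pos) auto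
        also have "\<dots> = 16 ^ k * real n powr (- real G - 1)"
          by (simp add: powr_minus[of _ "real G + 1", simplified] divide_inverse)
        finally have inv: "1 / (real u ^ 4) ^ k \<le> 16 ^ k * real n powr (- real G - 1)" .
        have e1: "16 ^ k * (real k ^ (2 * k) / (real u ^ 4) ^ k) / real m
            \<le> 16 ^ k * real k ^ (2 * k) * 16 ^ k * real n powr (- real G - 1)"
        proof -
          have "16 ^ k * (real k ^ (2 * k) / (real u ^ 4) ^ k) / real m \<le> 16 ^ k * (real k ^ (2 * k) / (real u ^ 4) ^ k) / 1"
            using m0 by (intro divide_left_mono) auto
          also have "\<dots> = 16 ^ k * real k ^ (2 * k) * (1 / (real u ^ 4) ^ k)" by simp
          also have "\<dots> \<le> 16 ^ k * real k ^ (2 * k) * (16 ^ k * real n powr (- real G - 1))"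
            by (rule mult_left_mono[OF inv]) simp
          finally show ?thesis by (simp only: mult.assoc)
        qed
        have e2: "1 / real p \<le> real n powr (- real G - 1)"
        proof -
          have "real (n ^ (G + 1)) \<le> real p" using p(1) by (simp only: of_nat_le_iff)
          then have "1 / real p \<le> 1 / real n ^ (G + 1)" using n p(1) by (intro divide_left_mono) auto
          also have "\<dots> = real n powr (- real (G + 1))" using n by (simp only: powr_minus powr_realpow divide_inverse)
          also have "- real (G + 1) = - real G - 1" by simp
          finally show ?thesis .
        qed
        have "(x / 2)\<^sup>2 \<le> (real u)\<^sup>2" using u_half x by (intro power_mono) auto
        then have e3: "exp (- (real u)\<^sup>2 / 8) \<le> exp (- (x / 2)\<^sup>2 / 8)" by simp
        have "16 ^ k * (real k ^ (2 * k) / (real u ^ 4) ^ k) / real m + 1 / real p + exp (- (real u)\<^sup>2 / 8) \<le> \<rho> / 2"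
          using add_mono[OF add_mono[OF e1 e2] e3] elim(4) unfolding \<rho>_def x_def[symmetric]
          by (rule order_trans)
        then show ?thesis by (simp only: m_def of_nat_power)
      qed
      have Q: "real (card C) ^ (u ^ 4) \<le> real n powr ((g - 1) * sqrt (real n))"
      proof -
        have "card C \<le> (2 * (n ^ (G + 1)) ^ 2) ^ d" using C p(2) by (meson le_trans power_mono zero_le)
        also have "\<dots> \<le> (n * (n ^ (G + 1)) ^ 2) ^ d" using n by (intro power_mono mult_right_mono) auto
        also have "\<dots> = n ^ ((2 * G + 3) * d)" by (simp add: power_mult[symmetric] power_Suc[symmetric] algebra_simps del: power_Suc)
        finally have "real (card C) \<le> real (n ^ ((2 * G + 3) * d))" by (simp only: of_nat_le_iff)
        also have "\<dots> = real n powr (g - 1)" using n by (simp add: g_def powr_realpow[symmetric] del: of_nat_mult)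
        finally have "real (card C) ^ (u ^ 4) \<le> (real n powr (g - 1)) ^ (u ^ 4)" by (intro power_mono) auto
        also have "\<dots> = real n powr ((g - 1) * real (u ^ 4))" using n by (simp add: powr_powr powr_realpow[symmetric] del: of_nat_power)
        also have "\<dots> \<le> real n powr ((g - 1) * sqrt (real n))"
        proof (intro powr_mono mult_left_mono)
          have "real u ^ 4 \<le> x ^ 4" using u_le by (intro power_mono) auto
          then show "real (u ^ 4) \<le> sqrt (real n)" by (simp add: x4)
        qed (use n in \<open>auto simp: g_def\<close>)
        finally show ?thesis .
      qed
      have g_mono: "real n powr ((g - 1) * sqrt (real n)) \<le> real n powr (g * sqrt (real n))"
        using n by (intro powr_mono mult_right_mono) auto
      have dense: "2 ^ n * (2 * 16 ^ k / m) ^ (n - 1) * real (card C) ^ (u ^ 4) \<le> \<rho>"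
      proof -
        have "2 * 16 ^ k / real m \<le> 2 * 16 ^ k / (x / (32 * real d))"
          using m_ge m0 x d by (intro divide_left_mono) auto
        also have "\<dots> = D / x" by (simp add: D_def)
        finally have "2 ^ n * (2 * 16 ^ k / m) ^ (n - 1) * real (card C) ^ (u ^ 4)
            \<le> 2 ^ n * (D / x) ^ (n - 1) * real n powr (g * sqrt (real n))"
          using Q g_mono D0 x by (intro mult_mono mult_left_mono power_mono) auto
        also have "\<dots> \<le> \<rho>" using elim(2) by (simp add: x_def \<rho>_def)
        finally show ?thesis .
      qed
      have sparse: "real n ^ (u ^ 4) * real (card C) ^ (u ^ 4) * (1 / 2) ^ (n - 1) \<le> \<rho>"
      proof -
        have "real n ^ (u ^ 4) = real n powr real (u ^ 4)" using n by (intro powr_realpow[symmetric]) auto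
        also have "\<dots> \<le> real n powr (sqrt (real n))"
        proof (intro powr_mono)
          have "real u ^ 4 \<le> x ^ 4" using u_le by (intro power_mono) auto
          then show "real (u ^ 4) \<le> sqrt (real n)" by (simp add: x4)
        qed (use n in auto)
        finally have "real n ^ (u ^ 4) * real (card C) ^ (u ^ 4) \<le> real n powr (sqrt (real n)) * real n powr ((g - 1) * sqrt (real n))"
          using Q by (intro mult_mono) auto
        also have "\<dots> = real n powr (g * sqrt (real n))" by (simp add: powr_add[symmetric] algebra_simps)
        finally have "real n ^ (u ^ 4) * real (card C) ^ (u ^ 4) * (1 / 2) ^ (n - 1)
            \<le> real n powr (g * sqrt (real n)) * (1 / 2) ^ (n - 1)" by (intro mult_right_mono) auto
        also have "\<dots> \<le> \<rho>" using elim(3) by (simp add: \<rho>_def)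
        finally show ?thesis .
      qed
      have "measure_pmf.prob (random_sign_matrix n) {M. Determinant.det (\<gamma> \<cdot>\<^sub>m map_mat of_int M + B) \<in> P}
          \<le> real n * (2 ^ n * (2 * 16 ^ k / (u div (8 * d))) ^ (n - 1) * real (card C) ^ (u ^ 4)
            + real n ^ (u ^ 4) * real (card C) ^ (u ^ 4) * (1 / 2) ^ (n - 1) + \<rho>)"
        using m0 n by (intro prob_shift_singular_le C d \<open>2 * k < p\<close> err \<gamma> B) (auto simp: m_def)
      also have "\<dots> \<le> real n * (3 * \<rho>)"
        using dense sparse by (intro mult_left_mono) (auto simp: m_def)
      finally show "measure_pmf.prob (random_sign_matrix n) {M. Determinant.det (\<gamma> \<cdot>\<^sub>m map_mat of_int M + B) \<in> P}
          \<le> 3 * real n * real n powr (- real G)" by (simp add: \<rho>_def)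
    qed
  qed
qed

section \<open>Eigenvalues of bounded degree\<close>

lemma random_sign_matrix_entry:
  assumes "M \<in> set_pmf (random_sign_matrix n)" "i < n" "j < n"
  shows "\<bar>M $$ (i, j)\<bar> \<le> 1"
proof -
  let ?\<Omega> = "PiE {..<n} (\<lambda>_. PiE {..<n} (\<lambda>_. {-1, 1 :: int}))"
  have "finite ?\<Omega>" "?\<Omega> \<noteq> {}" by (auto intro!: finite_PiE simp: PiE_eq_empty_iff)
  then obtain r where "r \<in> ?\<Omega>" "M = Matrix.mat n n (\<lambda>(i, j). r i j)"
    using assms(1) by (auto simp: random_sign_matrix_conv)
  then have "M $$ (i, j) \<in> {-1, 1}" using assms(2,3) by (auto simp: PiE_iff)
  then show ?thesis by auto
qed

text \<open>A monic factor of the characteristic polynomial vanishes modulo a suitable prime ideal, so the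
  characteristic matrix is singular over the residue field.\<close>

lemma prob_dvd_char_poly_le:
  fixes f :: "int poly"
  assumes "finite_residue_field P C p" "f \<in> P" and m: "m \<ge> 1" and \<epsilon>: "\<epsilon> \<ge> 0"
    and H: "\<And>\<gamma> B. \<gamma> \<notin> P \<Longrightarrow> B \<in> carrier_mat n n \<Longrightarrow>
      measure_pmf.prob (random_sign_matrix n) {M. Determinant.det (\<gamma> \<cdot>\<^sub>m map_mat of_int M + B) \<in> P} \<le> \<epsilon>"
  shows "measure_pmf.prob (replicate_pmf m (random_sign_matrix n)) {Ms. f dvd char_poly (mat_product n Ms)} \<le> real m * \<epsilon>"
proof -
  interpret finite_residue_field P C p by fact
  let ?E = "{Ms. Determinant.det ([:0, 1:] \<cdot>\<^sub>m 1\<^sub>m n + (-1) \<cdot>\<^sub>m map_mat of_int (mat_product n Ms)) \<in> P}"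
  have "measure_pmf.prob (replicate_pmf m (random_sign_matrix n)) {Ms. f dvd char_poly (mat_product n Ms)}
      \<le> measure_pmf.prob (replicate_pmf m (random_sign_matrix n)) ?E"
  proof (rule measure_pmf.finite_measure_mono_AE, unfold AE_measure_pmf_iff, intro ballI impI)
    fix Ms assume Ms: "Ms \<in> set_pmf (replicate_pmf m (random_sign_matrix n))"
      "Ms \<in> {Ms. f dvd char_poly (mat_product n Ms)}"
    have A: "mat_product n Ms \<in> carrier_mat n n" by (rule replicate_carrier[OF Ms(1)])
    have "char_poly_matrix (mat_product n Ms) = [:0, 1:] \<cdot>\<^sub>m 1\<^sub>m n + (-1) \<cdot>\<^sub>m map_mat of_int (mat_product n Ms)"
      unfolding char_poly_matrix_def using A by (intro eq_matI) (auto simp: of_int_poly)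
    then have "char_poly (mat_product n Ms) = Determinant.det ([:0, 1:] \<cdot>\<^sub>m 1\<^sub>m n + (-1) \<cdot>\<^sub>m map_mat of_int (mat_product n Ms))"
      by (simp only: char_poly_def)
    moreover have "char_poly (mat_product n Ms) \<in> P" using Ms(2) assms(2) mult_in' by (auto simp: dvd_def)
    ultimately show "Ms \<in> ?E" by simp
  qed simp
  also have "\<dots> \<le> real m * \<epsilon>" by (rule prob_product_singular_le[OF \<epsilon> disjI1[OF m] H])
  finally show ?thesis .
qed

lemma candidate_count_le:
  fixes n m d :: nat
  assumes "n \<ge> 3"
  shows "real (nat (2 * (1 + int n ^ (m + 1)) ^ d + 1) ^ (d + 1)) \<le> real n ^ (((m + 2) * d + 2) * (d + 1))"
proof -
  have "n ^ (m + 1) \<ge> 1" using assms by (intro one_le_power) simp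
  then have "1 + n ^ (m + 1) \<le> 3 * n ^ (m + 1)" by simp
  also have "\<dots> \<le> n ^ (m + 2)" using assms by simp
  finally have "(1 + n ^ (m + 1)) ^ d \<le> n ^ ((m + 2) * d)" unfolding power_mult by (intro power_mono) auto
  moreover have "n ^ ((m + 2) * d) \<ge> 1" using assms by (intro one_le_power) simp
  ultimately have "2 * (1 + n ^ (m + 1)) ^ d + 1 \<le> 3 * n ^ ((m + 2) * d)" by linarith
  also have "\<dots> \<le> n ^ 2 * n ^ ((m + 2) * d)"
    using assms by (intro mult_right_mono) (auto simp: power2_eq_square intro: order_trans[of 3 n])
  also have "n ^ 2 * n ^ ((m + 2) * d) = n ^ ((m + 2) * d + 2)" by (subst power_add) (rule mult.commute)
  finally have "2 * (1 + n ^ (m + 1)) ^ d + 1 \<le> n ^ ((m + 2) * d + 2)" .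
  then have "(2 * (1 + n ^ (m + 1)) ^ d + 1) ^ (d + 1) \<le> n ^ (((m + 2) * d + 2) * (d + 1))"
    unfolding power_mult by (intro power_mono) auto
  moreover have "nat (2 * (1 + int n ^ (m + 1)) ^ d + 1) = 2 * (1 + n ^ (m + 1)) ^ d + 1"
    by (simp add: nat_eq_iff)
  ultimately have "real (nat (2 * (1 + int n ^ (m + 1)) ^ d + 1) ^ (d + 1)) \<le> real (n ^ (((m + 2) * d + 2) * (d + 1)))"
    by (simp only: of_nat_le_iff)
  then show ?thesis by simp
qed

theorem theorem2p10:
  fixes K B :: real and m :: nat
  assumes "K \<ge> 1" and "m \<ge> 1" and "B > 0"
  shows "\<exists>N. \<forall>n\<ge>N.
    measure_pmf.prob (replicate_pmf m (random_sign_matrix n))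
      {Ms. \<exists>z :: complex. eigenvalue (map_mat of_int (mat_product n Ms)) z \<and>
             algebraic z \<and> real (algebraic_degree z) \<le> K}
    \<le> real n powr (- B)"
proof -
  define d where "d = nat \<lfloor>K\<rfloor>"
  define A where "A = ((m + 2) * d + 2) * (d + 1)"
  define b where "b = nat \<lceil>B\<rceil>"
  \<comment> \<open>There are at most \<open>n ^ A\<close> candidates, and \<open>3\<close> absorbs the factors \<open>3 * m\<close> and \<open>n\<close>.\<close>
  define G where "G = A + b + 3"
  have d: "d \<ge> 1" using assms(1) by (simp add: d_def le_nat_floor)
  have degree_le: "x \<le> d" if "real x \<le> K" for x using that by (simp add: d_def le_nat_floor)
  have b: "B \<le> real b" by (simp add: b_def real_nat_ceiling_ge)
  have "\<forall>\<^sub>F n in sequentially.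
    measure_pmf.prob (replicate_pmf m (random_sign_matrix n))
      {Ms. \<exists>z :: complex. eigenvalue (map_mat of_int (mat_product n Ms)) z \<and>
             algebraic z \<and> real (algebraic_degree z) \<le> K}
    \<le> real n powr (- B)"
    using eventually_prob_shift_singular_le[OF d, of G, where 'a = "int poly"] eventually_ge_at_top[of "3 * m + 7"]
  proof eventually_elim
    case (elim n)
    have n: "n \<ge> 7" "n \<ge> 3 * m" "real n \<ge> 1" using elim(2) by auto
    let ?pr = "measure_pmf.prob (replicate_pmf m (random_sign_matrix n))"
    define H where "H = (1 + int n ^ (m + 1)) ^ d"
    define \<epsilon> where "\<epsilon> = 3 * real n * real n powr (- real G)"
    let ?F = "factor_candidates d H"
    let ?E = "{Ms. \<exists>z :: complex. eigenvalue (map_mat of_int (mat_product n Ms)) z \<and>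
             algebraic z \<and> real (algebraic_degree z) \<le> K}"
    have F: "finite ?F" "card ?F \<le> nat (2 * H + 1) ^ (d + 1)"
      by (intro factor_candidates_card; simp add: H_def)+
    have y: "n ^ (G + 1) \<ge> 7"
    proof -
      have "n ^ 1 \<le> n ^ (G + 1)" using n by (intro power_increasing) auto
      then show ?thesis using n(1) unfolding power_one_right by linarith
    qed
    obtain p where p: "prime p" "n ^ (G + 1) < p" "p \<le> 2 * (n ^ (G + 1)) ^ 2"
      using exists_prime_between[OF y] by blast
    have each: "?pr {Ms. f dvd char_poly (mat_product n Ms)} \<le> real m * \<epsilon>" if f: "f \<in> ?F" for f
    proof -
      have f': "lead_coeff f = 1" "degree f \<ge> 1" "degree f \<le> d" using f by (auto simp: factor_candidates_def)
      obtain P C where PC: "finite_residue_field P C p" "f \<in> P" "card C \<le> p ^ degree f"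
        using exists_residue_field[of p f] p(1,2) y f' by auto
      have "p ^ degree f \<le> p ^ d" using f'(3) p(2) by (intro power_increasing) auto
      then have C: "card C \<le> p ^ d" using PC(3) by linarith
      show ?thesis
      proof (rule prob_dvd_char_poly_le[OF PC(1,2) assms(2)])
        show "\<epsilon> \<ge> 0" by (simp add: \<epsilon>_def)
        show "measure_pmf.prob (random_sign_matrix n) {M. Determinant.det (\<gamma> \<cdot>\<^sub>m map_mat of_int M + B') \<in> P} \<le> \<epsilon>"
          if "\<gamma> \<notin> P" "B' \<in> carrier_mat n n" for \<gamma> B'
          unfolding \<epsilon>_def using elim(1) PC(1) C p(2,3) that by blast
      qed
    qed
    have "?pr ?E \<le> ?pr (\<Union>f\<in>?F. {Ms. f dvd char_poly (mat_product n Ms)})"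
    proof (rule measure_pmf.finite_measure_mono_AE, unfold AE_measure_pmf_iff, intro ballI impI)
      fix Ms assume Ms: "Ms \<in> set_pmf (replicate_pmf m (random_sign_matrix n))" "Ms \<in> ?E"
      obtain z where z: "eigenvalue (map_mat of_int (mat_product n Ms)) (z :: complex)" "algebraic z"
        "real (algebraic_degree z) \<le> K" using Ms(2) by blast
      have len: "length Ms = m" and mem: "\<And>M. M \<in> set Ms \<Longrightarrow> M \<in> set_pmf (random_sign_matrix n)"
        using Ms(1) by (auto simp: set_replicate_pmf)
      have "\<exists>f\<in>factor_candidates d ((1 + int n ^ (length Ms + 1)) ^ d). f dvd char_poly (mat_product n Ms)"
        by (rule exists_factor_candidate[OF _ _ z(1,2) degree_le[OF z(3)]])
          (use mem random_sign_matrix_carrier random_sign_matrix_entry in blast)+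
      then show "Ms \<in> (\<Union>f\<in>?F. {Ms. f dvd char_poly (mat_product n Ms)})" by (auto simp: len H_def)
    qed simp
    also have "\<dots> \<le> (\<Sum>f\<in>?F. ?pr {Ms. f dvd char_poly (mat_product n Ms)})"
      by (intro measure_pmf.finite_measure_subadditive_finite F) auto
    also have "\<dots> \<le> (\<Sum>f\<in>?F. real m * \<epsilon>)" using each by (rule sum_mono)
    also have "\<dots> = real (card ?F) * (real m * \<epsilon>)" by simp
    also have "\<dots> \<le> real n ^ A * (real m * \<epsilon>)"
    proof (rule mult_right_mono)
      have "real (card ?F) \<le> real (nat (2 * H + 1) ^ (d + 1))" using F(2) by (simp only: of_nat_le_iff)
      also have "\<dots> \<le> real n ^ A" using candidate_count_le[of n m d] n by (simp only: H_def A_def)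
      finally show "real (card ?F) \<le> real n ^ A" .
    qed (simp add: \<epsilon>_def)
    also have "\<dots> = (3 * real m) * (real n ^ A * real n * real n powr (- real G))" by (simp add: \<epsilon>_def)
    also have "\<dots> \<le> real n * (real n ^ A * real n * real n powr (- real G))"
    proof (rule mult_right_mono)
      have "real (3 * m) \<le> real n" using n(2) by (simp only: of_nat_le_iff)
      then show "3 * real m \<le> real n" by simp
    qed simp
    also have "\<dots> = real n powr (real A + 2 - real G)"
    proof -
      have "real n * (real n ^ A * real n * real n powr (- real G)) = real n ^ (A + 2) * real n powr (- real G)"
        by (simp add: power2_eq_square power_add)
      also have "real n ^ (A + 2) = real n powr (real (A + 2))" using n by (intro powr_realpow[symmetric]) auto
      also have "real n powr real (A + 2) * real n powr (- real G) = real n powr (real (A + 2) + - real G)"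
        by (rule powr_add[symmetric])
      also have "real (A + 2) + - real G = real A + 2 - real G" by simp
      finally show ?thesis .
    qed
    also have "\<dots> \<le> real n powr (- B)"
      using b n by (intro powr_mono) (auto simp: G_def)
    finally show ?case .
  qed
  then show ?thesis by (simp add: eventually_sequentially)
qed

end
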